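(* Let $\lambda>0$ and let $u_0\in H^3$, with $\mu_0=\int_{\mathbb S}u_0\,dx$, be such that $$\|\partial_x^3u_0\|_{L^2}\le2\sqrt3\,|\mu_0|.$$ Then the solution $u$ to the weakly dissipative $\mu$HS equation with initial value $u_0$ exists globally in time.
   Context: $\mathbb S=\mathbb R/\mathbb Z$; functions on $\mathbb S$ are identified with 1-periodic functions on $\mathbb R$; $H^s=H^s(\mathbb S)$, $L^2=L^2(\mathbb S)$ (real-valued). $\mu(w)=\int_{\mathbb S}w\,dx$, and $A=\mu-\partial_x^2$ (i.e. $Aw=\mu(w)-w_{xx}$), an isomorphism $H^s\to H^{s-2}$. The weakly dissipative $\mu$HS equation is $y_t+uy_x+2u_xy+\lambda y=0$ for $t>0$, $x\in\mathbb R$, with $y=\mu(u)-u_{xx}$, $u(0,x)=u_0(x)$, $u(t,x+1)=u(t,x)$; equivalently $$u_t+uu_x=-\partial_xA^{-1}\left(2\mu_0e^{-\lambda t}u+\tfrac12u_x^2\right)-\lambda u,\qquad u(0,\cdot)=u_0,\quad \mu_0=\mu(u_0).$$ For $u_0\in H^s$, $s>\frac32$, there is a unique solution $u\in C([0,T);H^s)\cap C^1([0,T);H^{s-1})$ of this nonlocal form (as an equation in $H^{s-1}$), where $T=T(u_0)\in(0,\infty]$ is the maximal existence time. "Exists globally in time" means $T=\infty$ (with $s=3$ here). *)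

theory Defs
  imports "HOL-Analysis.Analysis"
begin

text \<open>
  Functions on the circle are 1-periodic functions on the line. Elements of $L^2$ and of the
  Sobolev spaces are represented by functions rather than by equivalence classes, so identities
  between them are stated almost everywhere.
\<close>

definition mean :: "(real \<Rightarrow> real) \<Rightarrow> real" where
  "mean f = (LINT x:{0..1}|lebesgue. f x)"

definition L2 :: "(real \<Rightarrow> real) set" where
  "L2 = {f. (\<forall>x. f (x + 1) = f x) \<and> f \<in> borel_measurable lebesgue \<and>
            set_integrable lebesgue {0..1} (\<lambda>x. (f x)\<^sup>2)}"

definition L2_norm :: "(real \<Rightarrow> real) \<Rightarrow> real" where
  "L2_norm f = sqrt (LINT x:{0..1}|lebesgue. (f x)\<^sup>2)"

definition smooth_periodic :: "(real \<Rightarrow> real) \<Rightarrow> bool" where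
  "smooth_periodic \<phi> \<longleftrightarrow>
     (\<forall>x. \<phi> (x + 1) = \<phi> x) \<and> (\<forall>n. (deriv ^^ n) \<phi> differentiable_on UNIV)"

definition has_weak_deriv :: "(real \<Rightarrow> real) \<Rightarrow> (real \<Rightarrow> real) \<Rightarrow> bool" where
  "has_weak_deriv f g \<longleftrightarrow>
     (\<forall>\<phi>. smooth_periodic \<phi> \<longrightarrow>
        (LINT x:{0..1}|lebesgue. f x * deriv \<phi> x) = - (LINT x:{0..1}|lebesgue. g x * \<phi> x))"

text \<open>The space $H^k$ of the circle, for a natural number k.\<close>

primrec sobolev :: "nat \<Rightarrow> (real \<Rightarrow> real) set" where
  "sobolev 0 = L2"
| "sobolev (Suc k) = {f \<in> L2. \<exists>g \<in> sobolev k. has_weak_deriv f g}"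

text \<open>A weak derivative in $L^2$ is determined only almost everywhere; one is chosen.\<close>

definition wderiv :: "(real \<Rightarrow> real) \<Rightarrow> (real \<Rightarrow> real)" where
  "wderiv f = (SOME g. g \<in> L2 \<and> has_weak_deriv f g)"

definition sobolev_norm :: "nat \<Rightarrow> (real \<Rightarrow> real) \<Rightarrow> real" where
  "sobolev_norm k f = sqrt (\<Sum>j\<le>k. (L2_norm ((wderiv ^^ j) f))\<^sup>2)"

text \<open>
  The operator $A = \mu - \partial_x^2$ as a map from $H^2$ to $L^2$, and its inverse, whose
  values are again determined only almost everywhere.
\<close>

definition A_op :: "(real \<Rightarrow> real) \<Rightarrow> (real \<Rightarrow> real)" where
  "A_op w = (\<lambda>x. mean w - wderiv (wderiv w) x)"

definition A_inv :: "(real \<Rightarrow> real) \<Rightarrow> (real \<Rightarrow> real)" where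
  "A_inv f = (SOME w. w \<in> sobolev 2 \<and> (AE x in lebesgue. A_op w x = f x))"

definition sobolev_continuous_on ::
    "nat \<Rightarrow> real set \<Rightarrow> (real \<Rightarrow> real \<Rightarrow> real) \<Rightarrow> bool" where
  "sobolev_continuous_on k I u \<longleftrightarrow>
     (\<forall>t\<in>I. u t \<in> sobolev k \<and>
        ((\<lambda>s. sobolev_norm k (\<lambda>x. u s x - u t x)) \<longlongrightarrow> 0) (at t within I))"

text \<open>
  \<open>sobolev_C1_on k I u u'\<close>: the curve \<open>u\<close> belongs to $C^1(I; H^k)$ and has time derivative \<open>u'\<close>
  (one-sided at an endpoint of \<open>I\<close>).
\<close>

definition sobolev_C1_on ::
    "nat \<Rightarrow> real set \<Rightarrow> (real \<Rightarrow> real \<Rightarrow> real) \<Rightarrow> (real \<Rightarrow> real \<Rightarrow> real) \<Rightarrow> bool" where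
  "sobolev_C1_on k I u u' \<longleftrightarrow>
     sobolev_continuous_on k I u \<and> sobolev_continuous_on k I u' \<and>
     (\<forall>t\<in>I. ((\<lambda>s. sobolev_norm k (\<lambda>x. (u s x - u t x) / (s - t) - u' t x)) \<longlongrightarrow> 0)
              (at t within I))"

text \<open>
  Solutions on \<open>[0,T)\<close> of the nonlocal form of the equation,
  in $C([0,T);H^3) \cap C^1([0,T);H^2)$.
\<close>

definition muHS_solution ::
    "real \<Rightarrow> (real \<Rightarrow> real) \<Rightarrow> ereal \<Rightarrow> (real \<Rightarrow> real \<Rightarrow> real) \<Rightarrow> bool" where
  "muHS_solution lam u0 T u \<longleftrightarrow>
     0 < T \<and>
     (let I = {t. 0 \<le> t \<and> ereal t < T} in
       sobolev_continuous_on 3 I u \<and>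
       (AE x in lebesgue. u 0 x = u0 x) \<and>
       (\<exists>u'. sobolev_C1_on 2 I u u' \<and>
          (\<forall>t\<in>I. AE x in lebesgue.
             u' t x + u t x * wderiv (u t) x =
               - wderiv (A_inv (\<lambda>z. 2 * mean u0 * exp (- lam * t) * u t z
                                     + 1/2 * (wderiv (u t) z)\<^sup>2)) x
               - lam * u t x)))"

text \<open>
  \<open>u\<close> is the unique solution with initial value \<open>u0\<close>, and \<open>T\<close> its maximal existence time:
  every solution is a restriction of \<open>u\<close>.
\<close>

definition muHS_maximal_solution ::
    "real \<Rightarrow> (real \<Rightarrow> real) \<Rightarrow> ereal \<Rightarrow> (real \<Rightarrow> real \<Rightarrow> real) \<Rightarrow> bool" where
  "muHS_maximal_solution lam u0 T u \<longleftrightarrow>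
     muHS_solution lam u0 T u \<and>
     (\<forall>T' v. muHS_solution lam u0 T' v \<longrightarrow>
        T' \<le> T \<and> (\<forall>t\<ge>0. ereal t < T' \<longrightarrow> (AE x in lebesgue. v t x = u t x)))"

end

theory Submission
  imports Defs
begin

text \<open>
  Write \<open>m\<close> for the mean of the initial value and \<open>a t = m * exp (- lam * t)\<close>. The mean of a solution
  is \<open>a t\<close>, and with \<open>u = a * w\<close> the damping disappears: \<open>w\<close> has mean one, and \<open>K = 1 - w_xx\<close>
  satisfies \<open>K_t + a * (w * K_x + 2 * w_x * K) = 0\<close>. Let \<open>q\<close> be the flow of \<open>u\<close>, that is,
  \<open>q_t = u (t, q)\<close> and \<open>q (0, x) = x\<close>. Then \<open>K (t, q) * q_x^2\<close> keeps its initial value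
  \<open>k = 1 - u0'' / m\<close>. The hypothesis makes \<open>k\<close> nonnegative: a function with mean zero is bounded
  by the norm of its derivative divided by the square root of 12 (lemmas \<open>periodic_sup_mean\<close> and
  \<open>continuous_representative\<close>), hence \<open>\<bar>u0''\<bar> \<le> \<bar>m\<bar>\<close>.

  Nonnegativity excludes breaking of waves. With \<open>q_x = exp s\<close> the slope \<open>P = w_x (t, q)\<close> has the
  \<open>x\<close>-derivative \<open>exp s - k * exp (- s)\<close>, a difference of two nonnegative functions with integral one;
  so \<open>P\<close> is bounded, whatever \<open>s\<close> is. If both densities are normalised to integral one, then \<open>P\<close>
  is even a bounded and globally Lipschitz function of \<open>s\<close> in the supremum norm
  (\<open>drift_bound\<close>, \<open>drift_Lipschitz\<close>), and the ordinary differential equation \<open>s_t = a * P\<close> has a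
  solution for all times by the contraction principle (\<open>flow_exists\<close>). Along this solution the
  normalising factors are constant (\<open>rho_mass\<close>, \<open>kap_mass\<close>), so that it is the flow that was sought.

  It remains to show that \<open>u = a * w\<close>, with \<open>w\<close> recovered from \<open>s\<close> through the inverse of \<open>q\<close>, is a
  solution with the required regularity. By Poincare's inequality a Sobolev norm is controlled by the mean
  and the derivative of highest order (\<open>sobolev_norm_le\<close>), so only that derivative matters. The third
  derivative of \<open>u\<close> is merely square integrable. Its continuity in time comes from the density of smooth functions
  (\<open>k1_p_curve\<close>); the time derivative of \<open>u_xx\<close> is found by duality, since in the coordinates of the flow the
  integral of \<open>K\<close> against a smooth function can be differentiated under the integral sign
  (\<open>K_evolution\<close>, \<open>u2_difference_quotient\<close>).

  Maximality of the solution amounts to uniqueness, which is an \<open>L2\<close> energy estimate for the difference of two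
  solutions followed by Gronwall's argument (\<open>energy_estimate\<close>, \<open>muHS_solution_unique\<close>).

  The basis for all this is the density of smooth periodic functions in \<open>L2\<close> (\<open>L2_dense\<close>), a consequence of the
  theorem of Stone and Weierstrass. It makes a weak derivative unique, and it provides, for a function
  with a weak derivative, smooth approximations together with their derivatives (\<open>weak_deriv_approx\<close>);
  the product rule, the chain rule and continuous representatives follow by passing to the limit. The operator
  \<open>A_inv\<close> enters only through \<open>wderiv_A_inv\<close>: up to the sign, its derivative at \<open>f\<close> is the primitive with mean zero
  of \<open>f - mean f\<close>.
\<close>

section \<open>Square-integrable functions on the circle\<close>

text \<open>
  Integrals over one period are written over this finite measure, so that the rules for Bochner
  integrals apply directly; each notion of the statement is first translated to it.
\<close>

abbreviation circ :: "real measure" where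
  "circ \<equiv> lebesgue_on {0..1}"

definition periodic :: "(real \<Rightarrow> real) \<Rightarrow> bool" where
  "periodic f \<longleftrightarrow> (\<forall>x. f (x + 1) = f x)"

lemma finite_measure_circ: "finite_measure circ"
  by (rule finite_measureI) (simp add: emeasure_restrict_space)

lemma measure_circ [simp]: "measure circ {0..1} = 1"
  by (simp add: measure_restrict_space)

lemma integrable_circ_const [simp, intro]: "integrable circ (\<lambda>x. c :: real)"
  using finite_measure.integrable_const[OF finite_measure_circ] .

lemma set_integral_circ: "(LINT x:{0..1}|lebesgue. f x) = integral\<^sup>L circ f" for f :: "real \<Rightarrow> real"
  by (simp add: set_lebesgue_integral_def integral_restrict_space)

lemma set_integrable_circ: "set_integrable lebesgue {0..1} f \<longleftrightarrow> integrable circ f" for f :: "real \<Rightarrow> real"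
  by (simp add: set_integrable_def integrable_restrict_space)

lemma mean_circ: "mean f = integral\<^sup>L circ f"
  by (simp add: mean_def set_integral_circ)

lemma L2_norm_circ: "L2_norm f = sqrt (\<integral>x. (f x)\<^sup>2 \<partial>circ)"
  by (simp add: L2_norm_def set_integral_circ)

lemma weak_deriv_circ: "has_weak_deriv f g \<longleftrightarrow>
     (\<forall>\<phi>. smooth_periodic \<phi> \<longrightarrow> (\<integral>x. f x * deriv \<phi> x \<partial>circ) = - (\<integral>x. g x * \<phi> x \<partial>circ))"
  by (simp add: has_weak_deriv_def set_integral_circ)

lemma L2_circ: "f \<in> L2 \<longleftrightarrow> periodic f \<and> f \<in> borel_measurable lebesgue \<and> integrable circ (\<lambda>x. (f x)\<^sup>2)"
  by (simp add: L2_def set_integrable_circ periodic_def)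

lemma integral_circ_const [simp]: "(\<integral>x. c \<partial>circ) = (c::real)"
  by simp

lemma L2_periodic: "f \<in> L2 \<Longrightarrow> periodic f"
  by (simp add: L2_circ)

lemma L2_measurable [measurable_dest]: "f \<in> L2 \<Longrightarrow> f \<in> borel_measurable lebesgue"
  by (simp add: L2_circ)

lemma L2_measurable_circ [measurable_dest]: "f \<in> L2 \<Longrightarrow> f \<in> borel_measurable circ"
  by (auto simp: L2_circ intro: measurable_restrict_space1)

lemma L2_square_integrable: "f \<in> L2 \<Longrightarrow> integrable circ (\<lambda>x. (f x)\<^sup>2)"
  by (simp add: L2_circ)

lemma L2_mult_integrable:
  assumes f: "f \<in> L2" and g: "g \<in> L2"
  shows "integrable circ (\<lambda>x. f x * g x)"
proof (rule Bochner_Integration.integrable_bound)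
  show "integrable circ (\<lambda>x. (f x)\<^sup>2 + (g x)\<^sup>2)"
    using f g by (intro Bochner_Integration.integrable_add L2_square_integrable)
  show "(\<lambda>x. f x * g x) \<in> borel_measurable circ"
    using f g by measurable
  have "norm (a * b) \<le> norm (a\<^sup>2 + b\<^sup>2)" for a b :: real
  proof -
    have "0 \<le> (\<bar>a\<bar> - \<bar>b\<bar>)\<^sup>2" by simp
    then have "2 * \<bar>a * b\<bar> \<le> a\<^sup>2 + b\<^sup>2" by (simp add: power2_eq_square algebra_simps abs_mult)
    then show ?thesis by simp
  qed
  then show "AE x in circ. norm (f x * g x) \<le> norm ((f x)\<^sup>2 + (g x)\<^sup>2)"
    by (intro AE_I2) blast
qed

lemma continuous_imp_lebesgue_measurable:
  fixes f :: "real \<Rightarrow> real"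
  assumes "continuous_on UNIV f"
  shows "f \<in> borel_measurable lebesgue"
  using borel_measurable_continuous_onI[OF assms] by (simp add: measurable_completion)

lemma L2_continuous:
  assumes "periodic f" "continuous_on UNIV f"
  shows "f \<in> L2"
proof -
  have m: "f \<in> borel_measurable lebesgue"
    using assms(2) by (rule continuous_imp_lebesgue_measurable)
  have "continuous_on {0..1} (\<lambda>x. (f x)\<^sup>2)"
    using assms(2) by (intro continuous_intros) (auto intro: continuous_on_subset)
  then have "(\<lambda>x. (f x)\<^sup>2) absolutely_integrable_on {0..1}"
    by (rule absolutely_integrable_continuous_real)
  then show ?thesis using assms m by (simp add: L2_circ set_integrable_circ)
qed

lemma L2_const [simp]: "(\<lambda>x. c) \<in> L2"
  by (rule L2_continuous) (auto simp: periodic_def)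

lemma L2_integrable: "f \<in> L2 \<Longrightarrow> integrable circ f"
  using L2_mult_integrable[of f "\<lambda>x. 1"] by simp

lemma L2_add: assumes "f \<in> L2" "g \<in> L2" shows "(\<lambda>x. f x + g x) \<in> L2"
proof -
  have "integrable circ (\<lambda>x. (f x)\<^sup>2 + 2 * (f x * g x) + (g x)\<^sup>2)"
    using assms by (intro Bochner_Integration.integrable_add integrable_mult_right L2_square_integrable L2_mult_integrable)
  then have "integrable circ (\<lambda>x. (f x + g x)\<^sup>2)"
    by (simp add: power2_sum algebra_simps)
  then show ?thesis using assms by (auto simp: L2_circ periodic_def)
qed

lemma L2_cmult: assumes "f \<in> L2" shows "(\<lambda>x. c * f x) \<in> L2"
proof -
  have "integrable circ (\<lambda>x. c\<^sup>2 * (f x)\<^sup>2)"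
    using assms by (intro integrable_mult_right L2_square_integrable)
  then show ?thesis using assms by (auto simp: L2_circ periodic_def power_mult_distrib)
qed

lemma L2_uminus: "f \<in> L2 \<Longrightarrow> (\<lambda>x. - f x) \<in> L2"
  using L2_cmult[of f "-1"] by simp

lemma L2_diff: "f \<in> L2 \<Longrightarrow> g \<in> L2 \<Longrightarrow> (\<lambda>x. f x - g x) \<in> L2"
  using L2_add[of f "\<lambda>x. - g x"] L2_uminus[of g] by simp

lemma L2_bounded_mult:
  assumes f: "f \<in> L2" and b: "periodic b" "b \<in> borel_measurable lebesgue" "\<And>x. x \<in> {0..1} \<Longrightarrow> \<bar>b x\<bar> \<le> B"
  shows "(\<lambda>x. b x * f x) \<in> L2"
proof -
  have [measurable]: "b \<in> borel_measurable circ"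
    using b(2) by (rule measurable_restrict_space1)
  have "integrable circ (\<lambda>x. (b x * f x)\<^sup>2)"
  proof (rule Bochner_Integration.integrable_bound)
    show "integrable circ (\<lambda>x. B\<^sup>2 * (f x)\<^sup>2)"
      using f by (intro integrable_mult_right L2_square_integrable)
    show "(\<lambda>x. (b x * f x)\<^sup>2) \<in> borel_measurable circ" using f by measurable
    have "(b x)\<^sup>2 \<le> B\<^sup>2" if "x \<in> {0..1}" for x
      using b(3)[OF that] by (simp add: abs_le_square_iff[symmetric])
    then show "AE x in circ. norm ((b x * f x)\<^sup>2) \<le> norm (B\<^sup>2 * (f x)\<^sup>2)"
      by (intro AE_I2) (auto simp: power_mult_distrib intro: mult_right_mono)
  qed
  then show ?thesis using f b by (auto simp: L2_circ periodic_def)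
qed

lemma continuous_bounded_Icc:
  assumes "continuous_on UNIV (b :: real \<Rightarrow> real)"
  obtains B where "0 \<le> B" "\<And>x. x \<in> {0..1} \<Longrightarrow> \<bar>b x\<bar> \<le> B"
proof -
  have "compact (b ` {0..1})"
    using assms by (intro compact_continuous_image) (auto intro: continuous_on_subset)
  then have "bounded (b ` {0..1})" by (rule compact_imp_bounded)
  then obtain B where B: "\<forall>x\<in>{0..1}. norm (b x) \<le> B" by (auto simp: bounded_iff)
  from that[of "\<bar>B\<bar>"] B show thesis by force
qed

lemma L2_continuous_mult:
  assumes "periodic b" "continuous_on UNIV b" "f \<in> L2"
  shows "(\<lambda>x. b x * f x) \<in> L2"
proof -
  obtain B where "\<And>x. x \<in> {0..1} \<Longrightarrow> \<bar>b x\<bar> \<le> B"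
    using continuous_bounded_Icc[OF assms(2)] by metis
  then show ?thesis
    by (rule L2_bounded_mult[OF assms(3,1) continuous_imp_lebesgue_measurable[OF assms(2)]])
qed

lemma L2_norm_nonneg [simp]: "0 \<le> L2_norm f"
  by (simp add: L2_norm_circ)

lemma L2_norm_square: "(L2_norm f)\<^sup>2 = (\<integral>x. (f x)\<^sup>2 \<partial>circ)"
  by (simp add: L2_norm_circ)

text \<open>
  The integral of \<open>(c * f - d * g)\<^sup>2\<close> is a nonnegative quadratic form in \<open>c\<close> and \<open>d\<close>.
\<close>

lemma L2_Cauchy_Schwarz:
  assumes f: "f \<in> L2" and g: "g \<in> L2"
  shows "\<bar>\<integral>x. f x * g x \<partial>circ\<bar> \<le> L2_norm f * L2_norm g"
proof -
  define A B C where "A = (\<integral>x. (f x)\<^sup>2 \<partial>circ)" and "B = (\<integral>x. f x * g x \<partial>circ)" and "C = (\<integral>x. (g x)\<^sup>2 \<partial>circ)"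
  have q: "0 \<le> c\<^sup>2 * A - 2 * c * d * B + d\<^sup>2 * C" for c d
  proof -
    have "0 \<le> (\<integral>x. (c * f x - d * g x)\<^sup>2 \<partial>circ)" by simp
    also have "\<dots> = (\<integral>x. c\<^sup>2 * (f x)\<^sup>2 - 2 * c * d * (f x * g x) + d\<^sup>2 * (g x)\<^sup>2 \<partial>circ)"
      by (intro Bochner_Integration.integral_cong) (auto simp: power2_eq_square algebra_simps)
    also have "\<dots> = c\<^sup>2 * A - 2 * c * d * B + d\<^sup>2 * C"
      unfolding A_def B_def C_def using L2_mult_integrable[OF f g] L2_square_integrable[OF f] L2_square_integrable[OF g]
      by simp
    finally show ?thesis .
  qed
  have A: "0 \<le> A" and C: "0 \<le> C" by (auto simp: A_def C_def)
  have "B\<^sup>2 \<le> A * C"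
  proof (cases "C = 0")
    case True
    have "B = 0"
    proof (rule ccontr)
      assume "B \<noteq> 0"
      have "0 \<le> A - 2 * ((A + 1) / (2 * B)) * B" using q[of 1 "(A + 1) / (2 * B)"] True by simp
      then show False using \<open>B \<noteq> 0\<close> by simp
    qed
    then show ?thesis using True by simp
  next
    case False
    have "0 \<le> C\<^sup>2 * A - 2 * C * B * B + B\<^sup>2 * C" using q[of C B] by simp
    then have "0 \<le> C * (A * C - B\<^sup>2)" by (simp add: power2_eq_square algebra_simps)
    then show ?thesis using False C by (simp add: zero_le_mult_iff)
  qed
  then have "\<bar>B\<bar> \<le> sqrt (A * C)" by (simp add: real_le_rsqrt)
  then show ?thesis by (simp add: A_def B_def C_def L2_norm_circ real_sqrt_mult)
qed

lemma L2_norm_triangle: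
  assumes f: "f \<in> L2" and g: "g \<in> L2"
  shows "L2_norm (\<lambda>x. f x + g x) \<le> L2_norm f + L2_norm g"
proof (rule power2_le_imp_le)
  have "(L2_norm (\<lambda>x. f x + g x))\<^sup>2 = (\<integral>x. (f x)\<^sup>2 + 2 * (f x * g x) + (g x)\<^sup>2 \<partial>circ)"
    unfolding L2_norm_square by (intro Bochner_Integration.integral_cong) (auto simp: power2_eq_square algebra_simps)
  also have "\<dots> = (L2_norm f)\<^sup>2 + 2 * (\<integral>x. f x * g x \<partial>circ) + (L2_norm g)\<^sup>2"
    unfolding L2_norm_square using L2_mult_integrable[OF f g] L2_square_integrable[OF f] L2_square_integrable[OF g]
    by simp
  also have "\<dots> \<le> (L2_norm f + L2_norm g)\<^sup>2"
    using L2_Cauchy_Schwarz[OF f g] by (simp add: power2_sum)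
  finally show "(L2_norm (\<lambda>x. f x + g x))\<^sup>2 \<le> (L2_norm f + L2_norm g)\<^sup>2" .
qed simp

lemma L2_norm_cmult: "L2_norm (\<lambda>x. c * f x) = \<bar>c\<bar> * L2_norm f"
  by (simp add: L2_norm_circ power_mult_distrib real_sqrt_mult)

lemma L2_norm_uminus [simp]: "L2_norm (\<lambda>x. - f x) = L2_norm f"
  by (simp add: L2_norm_circ)

lemma L2_norm_minus_commute: "L2_norm (\<lambda>x. f x - g x) = L2_norm (\<lambda>x. g x - f x)"
  by (simp add: L2_norm_circ power2_commute)

lemma L2_norm_triangle_diff:
  assumes "f \<in> L2" "g \<in> L2"
  shows "L2_norm (\<lambda>x. f x - g x) \<le> L2_norm f + L2_norm g"
  using L2_norm_triangle[OF assms(1) L2_uminus[OF assms(2)]] by simp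

lemma L2_norm_diff_triangle:
  assumes "f \<in> L2" "g \<in> L2" "h \<in> L2"
  shows "L2_norm (\<lambda>x. f x - h x) \<le> L2_norm (\<lambda>x. f x - g x) + L2_norm (\<lambda>x. g x - h x)"
  using L2_norm_triangle[OF L2_diff[OF assms(1,2)] L2_diff[OF assms(2,3)]] by simp

lemma L2_norm_diff_ge:
  assumes "f \<in> L2" "g \<in> L2"
  shows "L2_norm f - L2_norm g \<le> L2_norm (\<lambda>x. f x - g x)"
  using L2_norm_triangle[OF L2_diff[OF assms] assms(2)] by simp

lemma L2_norm_cong_AE:
  assumes "AE x in circ. f x = g x" "f \<in> L2" "g \<in> L2"
  shows "L2_norm f = L2_norm g"
proof -
  have "(\<integral>x. (f x)\<^sup>2 \<partial>circ) = (\<integral>x. (g x)\<^sup>2 \<partial>circ)"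
    using assms by (intro integral_cong_AE) auto
  then show ?thesis by (simp add: L2_norm_circ)
qed

lemma L2_norm_eq_0:
  assumes "f \<in> L2" "L2_norm f = 0"
  shows "AE x in circ. f x = 0"
proof -
  have "(\<integral>x. (f x)\<^sup>2 \<partial>circ) = 0" using assms(2) by (simp add: L2_norm_circ)
  then have "AE x in circ. (f x)\<^sup>2 = 0"
    using integral_nonneg_eq_0_iff_AE[OF L2_square_integrable[OF assms(1)]] by simp
  then show ?thesis by simp
qed

lemma L2_norm_bounded_mult:
  assumes "f \<in> L2" "(\<lambda>x. b x * f x) \<in> L2" "\<And>x. x \<in> {0..1} \<Longrightarrow> \<bar>b x\<bar> \<le> B" "0 \<le> B"
  shows "L2_norm (\<lambda>x. b x * f x) \<le> B * L2_norm f"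
proof (rule power2_le_imp_le)
  have "(b x)\<^sup>2 \<le> B\<^sup>2" if "x \<in> {0..1}" for x
    using assms(3)[OF that] assms(4) by (simp add: abs_le_square_iff[symmetric])
  then have le: "(b x * f x)\<^sup>2 \<le> B\<^sup>2 * (f x)\<^sup>2" if "x \<in> {0..1}" for x
    using that by (simp add: power_mult_distrib mult_right_mono)
  have "(\<integral>x. (b x * f x)\<^sup>2 \<partial>circ) \<le> (\<integral>x. B\<^sup>2 * (f x)\<^sup>2 \<partial>circ)"
    by (rule integral_mono[OF L2_square_integrable[OF assms(2)]
          integrable_mult_right[OF L2_square_integrable[OF assms(1)]]]) (use le in simp)
  then show "(L2_norm (\<lambda>x. b x * f x))\<^sup>2 \<le> (B * L2_norm f)\<^sup>2"
    by (simp add: L2_norm_square power_mult_distrib)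
qed (use assms in simp)

lemma L2_norm_const [simp]: "L2_norm (\<lambda>x. c) = \<bar>c\<bar>"
  by (simp add: L2_norm_circ)

lemma L2_norm_le_bound:
  assumes "f \<in> L2" "\<And>x. x \<in> {0..1} \<Longrightarrow> \<bar>f x\<bar> \<le> B"
  shows "L2_norm f \<le> B"
proof -
  have "0 \<le> B" using assms(2)[of 0] by force
  then show ?thesis using L2_norm_bounded_mult[of "\<lambda>x. 1" f B] assms by simp
qed

lemma mean_le_L2_norm: "f \<in> L2 \<Longrightarrow> \<bar>mean f\<bar> \<le> L2_norm f"
  using L2_Cauchy_Schwarz[of f "\<lambda>x. 1"] by (simp add: mean_circ)

lemma AE_lebesgue_imp_circ: "AE x in lebesgue. P x \<Longrightarrow> AE x in circ. P x"
  by (auto simp: AE_restrict_space_iff elim: eventually_mono)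

lemma periodic_int:
  assumes "periodic f"
  shows "f (x + of_int n) = f x"
proof -
  have nat: "f (x + of_nat n) = f x" for x n
  proof (induction n)
    case (Suc n)
    have "f (x + of_nat (Suc n)) = f ((x + of_nat n) + 1)" by (simp add: ac_simps)
    also have "\<dots> = f (x + of_nat n)" using assms unfolding periodic_def by blast
    finally show ?case using Suc by simp
  qed simp
  show ?thesis
  proof (cases "n \<ge> 0")
    case True then show ?thesis using nat[of x "nat n"] by simp
  next
    case False then show ?thesis using nat[of "x + of_int n" "nat (-n)"] by simp
  qed
qed

lemma periodic_frac: "periodic f \<Longrightarrow> f (frac x) = f x"
  using periodic_int[of f "frac x" "\<lfloor>x\<rfloor>"] by (simp add: frac_def)

text \<open>
  The line is a countable union of integer translates of the period, and translates of null sets are null.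
\<close>

lemma AE_circ_imp_lebesgue:
  assumes "periodic f" "periodic g" "AE x in circ. f x = g x"
  shows "AE x in lebesgue. f x = g x"
proof -
  have "AE x in lebesgue. x \<in> {0..1} \<longrightarrow> f x = g x"
    using assms(3) by (simp add: AE_restrict_space_iff)
  then obtain N where N: "N \<in> null_sets lebesgue" "{x. \<not> (x \<in> {0..1} \<longrightarrow> f x = g x)} \<subseteq> N"
    by (auto simp: eventually_ae_filter)
  have neg: "negligible ((\<lambda>x. of_int n + x) ` N)" for n :: int
    using N(1) negligible_iff_null_sets negligible_translation by blast
  have "negligible (\<Union>n::int. (\<lambda>x. of_int n + x) ` N)"
    by (intro negligible_countable_Union) (auto simp: neg)
  moreover have "x \<in> (\<Union>n::int. (\<lambda>x. of_int n + x) ` N)" if "f x \<noteq> g x" for x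
  proof -
    have "f (frac x) \<noteq> g (frac x)" using that assms(1,2) by (simp add: periodic_frac)
    moreover have "frac x \<in> {0..1}" by (simp add: frac_ge_0 less_imp_le frac_lt_1)
    ultimately have "frac x \<in> N" using N(2) by auto
    then show ?thesis by (intro UN_I[of "\<lfloor>x\<rfloor>"]) (auto simp: frac_def intro!: image_eqI[of _ _ "x - of_int \<lfloor>x\<rfloor>"])
  qed
  ultimately show ?thesis
    using negligible_iff_null_sets by (intro AE_I'[of "\<Union>n::int. (\<lambda>x. of_int n + x) ` N"]) auto
qed

section \<open>Density of smooth functions\<close>

text \<open>
  This class is closed under differentiation, which makes its members smooth, and it is an algebra, which
  makes the theorem of Stone and Weierstrass applicable.
\<close>

inductive trig_poly :: "(real \<Rightarrow> real) \<Rightarrow> bool" where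
  trig_const: "trig_poly (\<lambda>x. c)"
| trig_cos: "trig_poly (\<lambda>x. cos (2 * pi * x))"
| trig_sin: "trig_poly (\<lambda>x. sin (2 * pi * x))"
| trig_add: "trig_poly f \<Longrightarrow> trig_poly g \<Longrightarrow> trig_poly (\<lambda>x. f x + g x)"
| trig_mult: "trig_poly f \<Longrightarrow> trig_poly g \<Longrightarrow> trig_poly (\<lambda>x. f x * g x)"

lemma trig_poly_derivative:
  "trig_poly f \<Longrightarrow> \<exists>f'. trig_poly f' \<and> (\<forall>x. (f has_real_derivative f' x) (at x))"
proof (induction rule: trig_poly.induct)
  case (trig_const c)
  show ?case by (rule exI[of _ "\<lambda>x. 0"]) (auto intro: trig_poly.intros)
next
  case trig_cos
  have "trig_poly (\<lambda>x. (- 2 * pi) * sin (2 * pi * x))" by (intro trig_poly.intros)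
  moreover have "((\<lambda>x. cos (2 * pi * x)) has_real_derivative (- 2 * pi) * sin (2 * pi * x)) (at x)" for x
    by (auto intro!: derivative_eq_intros)
  ultimately show ?case by blast
next
  case trig_sin
  have "trig_poly (\<lambda>x. (2 * pi) * cos (2 * pi * x))" by (intro trig_poly.intros)
  moreover have "((\<lambda>x. sin (2 * pi * x)) has_real_derivative (2 * pi) * cos (2 * pi * x)) (at x)" for x
    by (auto intro!: derivative_eq_intros)
  ultimately show ?case by blast
next
  case (trig_add f g)
  then obtain f' g' where "trig_poly f'" "trig_poly g'"
    "\<And>x. (f has_real_derivative f' x) (at x)" "\<And>x. (g has_real_derivative g' x) (at x)" by blast
  then show ?case
    by (intro exI[of _ "\<lambda>x. f' x + g' x"]) (auto intro: trig_poly.intros derivative_intros)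
next
  case (trig_mult f g)
  then obtain f' g' where *: "trig_poly f'" "trig_poly g'"
    "\<And>x. (f has_real_derivative f' x) (at x)" "\<And>x. (g has_real_derivative g' x) (at x)" by blast
  have "((\<lambda>x. f x * g x) has_real_derivative f' x * g x + f x * g' x) (at x)" for x
    using DERIV_mult[OF *(3,4), of x] by (simp add: mult.commute)
  moreover have "trig_poly (\<lambda>x. f' x * g x + f x * g' x)"
    using * trig_mult by (intro trig_poly.intros) auto
  ultimately show ?case by blast
qed

lemma trig_poly_periodic: "trig_poly f \<Longrightarrow> periodic f"
  by (induction rule: trig_poly.induct) (auto simp: periodic_def algebra_simps cos_add sin_add)

lemma trig_poly_smooth:
  assumes "trig_poly f"
  shows "smooth_periodic f"
proof -
  have *: "deriv g = g'" if "\<forall>x. (g has_real_derivative g' x) (at x)" for g g' :: "real \<Rightarrow> real"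
    using that DERIV_imp_deriv by blast
  have t: "trig_poly ((deriv ^^ n) f)" for n
  proof (induction n)
    case (Suc n)
    then show ?case using trig_poly_derivative[OF Suc] * by auto
  qed (use assms in simp)
  have "(deriv ^^ n) f differentiable_on UNIV" for n
    using trig_poly_derivative[OF t[of n]]
    by (auto simp: differentiable_on_def real_differentiable_def)
  then show ?thesis
    using trig_poly_periodic[OF assms] by (simp add: smooth_periodic_def periodic_def)
qed

text \<open>
  A periodic function is a function \<open>F\<close> on the unit circle of the complex plane. Its continuity at the cut of
  \<open>Arg\<close> is seen by passing to \<open>Arg2pi\<close>, whose cut is on the other side. Then the theorem of Stone and Weierstrass
  applies to the functions on the circle that pull back to trigonometric polynomials.
\<close>

lemma trig_poly_dense:
  assumes f: "periodic f" "continuous_on UNIV f" and e: "0 < e"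
  obtains g where "trig_poly g" "\<And>x. \<bar>f x - g x\<bar> < e"
proof -
  define F where "F z = f (Arg z / (2 * pi))" for z
  define P where "P G \<longleftrightarrow> continuous_on (sphere 0 1) G \<and> trig_poly (\<lambda>x. G (cis (2 * pi * x)))" for G :: "complex \<Rightarrow> real"
  have isc: "isCont f x" for x using f(2) by (simp add: continuous_on_eq_continuous_at)
  have shift: "f (a / (2 * pi)) = f (b / (2 * pi))" if "cis a = cis b" for a b
  proof -
    have "exp (\<i> * of_real a) = exp (\<i> * of_real b)" using that by (simp add: cis_conv_exp)
    then obtain n :: int where "\<i> * of_real a = \<i> * of_real b + (of_real (of_int (2 * n) * pi)) * \<i>"
      unfolding exp_eq by blast
    then have "\<i> * complex_of_real a = \<i> * of_real (b + of_int (2 * n) * pi)"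
      by (simp add: algebra_simps)
    then have "a = b + of_int (2 * n) * pi"
      using mult_left_cancel[OF complex_i_not_zero] of_real_eq_iff by blast
    then have "a / (2 * pi) = b / (2 * pi) + of_int n" by (simp add: field_simps)
    then show ?thesis using periodic_int[OF f(1)] by simp
  qed
  have F2: "F z = f (Arg2pi z / (2 * pi))" if "z \<noteq> 0" for z
  proof -
    have "cis (Arg z) = cis (Arg2pi z)"
      using is_Arg_Arg[OF that] Arg2pi[of z] that unfolding is_Arg_def cis_conv_exp
      by (metis mult_left_cancel norm_eq_zero of_real_eq_0_iff)
    then show ?thesis unfolding F_def by (rule shift)
  qed
  have Fcis: "F (cis (2 * pi * x)) = f x" for x
  proof -
    have "cis (Arg (cis (2 * pi * x))) = cis (2 * pi * x)"
      by (simp add: cis_Arg)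
    from shift[OF this] show ?thesis by (simp add: F_def)
  qed
  have contF: "isCont F z" if "norm z = 1" for z
  proof (cases "z \<in> \<real>\<^sub>\<le>\<^sub>0")
    case False
    then show ?thesis unfolding F_def
      by (intro continuous_at_Arg isCont_o2[OF _ isc] continuous_intros) auto
  next
    case True
    have z: "z \<noteq> 0" using that by auto
    have "z \<notin> \<real>\<^sub>\<ge>\<^sub>0" using True z by (auto simp: complex_nonpos_Reals_iff complex_nonneg_Reals_iff complex_eq_iff)
    then have "isCont (\<lambda>z. f (Arg2pi z / (2 * pi))) z"
      by (intro continuous_at_Arg2pi isCont_o2[OF _ isc] continuous_intros) auto
    moreover have "\<forall>\<^sub>F w in nhds z. F w = f (Arg2pi w / (2 * pi))"
      using F2 t1_space_nhds[OF z] by (auto elim: eventually_mono)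
    ultimately show ?thesis using isCont_cong[of F "\<lambda>z. f (Arg2pi z / (2 * pi))" z] by simp
  qed
  have "\<exists>G. P G \<and> (\<forall>z\<in>sphere 0 1. \<bar>F z - G z\<bar> < e)"
  proof (rule Stone_Weierstrass_HOL)
    show "compact (sphere (0::complex) 1)" by simp
    show "P (\<lambda>x. c)" for c by (auto simp: P_def intro: trig_poly.intros)
    show "continuous_on (sphere 0 1) G" if "P G" for G using that by (simp add: P_def)
    show "P (\<lambda>x. f x + g x)" if "P f \<and> P g" for f g
      using that by (auto simp: P_def intro: trig_poly.intros continuous_intros)
    show "P (\<lambda>x. f x * g x)" if "P f \<and> P g" for f g
      using that by (auto simp: P_def intro: trig_poly.intros continuous_intros)
    have "P Re" "P Im"
      by (auto simp: P_def intro: trig_poly.intros continuous_intros)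
    then show "\<exists>f. P f \<and> f x \<noteq> f y" if "x \<in> sphere 0 1 \<and> y \<in> sphere 0 1 \<and> x \<noteq> y" for x y
      using that complex_eqI by blast
    show "continuous_on (sphere 0 1) F"
      using contF by (auto intro!: continuous_at_imp_continuous_on)
  qed (rule e)
  then obtain G where G: "P G" "\<forall>z\<in>sphere 0 1. \<bar>F z - G z\<bar> < e" by blast
  have "\<bar>f x - G (cis (2 * pi * x))\<bar> < e" for x
    using G(2)[rule_format, of "cis (2 * pi * x)"] by (simp add: Fcis)
  then show thesis using G(1) that unfolding P_def by blast
qed

lemma smooth_periodicD:
  assumes "smooth_periodic \<phi>"
  shows "periodic \<phi>" "(\<phi> has_real_derivative deriv \<phi> x) (at x)" "continuous_on UNIV \<phi>"
proof -
  have "(deriv ^^ 0) \<phi> differentiable_on UNIV" using assms unfolding smooth_periodic_def by blast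
  then have d: "\<phi> differentiable_on UNIV" by simp
  then have "\<phi> differentiable (at x)" for x by (simp add: differentiable_on_def)
  then show "(\<phi> has_real_derivative deriv \<phi> x) (at x)"
    using DERIV_deriv_iff_real_differentiable by blast
  show "continuous_on UNIV \<phi>" using d by (rule differentiable_imp_continuous_on)
  show "periodic \<phi>" using assms by (simp add: smooth_periodic_def periodic_def)
qed

lemma periodic_deriv:
  assumes "periodic f" "\<And>x. (f has_real_derivative f' x) (at x)"
  shows "periodic f'"
  unfolding periodic_def
proof
  fix x
  have "((\<lambda>y. f (y + 1)) has_real_derivative f' (x + 1)) (at x)"
    using assms(2)[of "x + 1"] DERIV_shift by blast
  moreover have "(\<lambda>y. f (y + 1)) = f" using assms(1) by (auto simp: periodic_def)
  ultimately show "f' (x + 1) = f' x" using assms(2)[of x] DERIV_unique by auto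
qed

lemma smooth_periodic_deriv: "smooth_periodic \<phi> \<Longrightarrow> smooth_periodic (deriv \<phi>)"
  using periodic_deriv[OF smooth_periodicD(1) smooth_periodicD(2), of \<phi>]
  unfolding smooth_periodic_def periodic_def
  by (metis funpow_Suc_right o_apply)

text \<open>
  All derivatives of \<open>f\<close> but the zeroth are derivatives of \<open>g\<close>. In this way primitives of test functions
  become test functions.
\<close>

lemma smooth_periodicI:
  assumes "periodic f" "\<And>x. (f has_real_derivative g x) (at x)" "smooth_periodic g"
  shows "smooth_periodic f"
proof -
  have "deriv f = g" using assms(2) DERIV_imp_deriv by blast
  have "(deriv ^^ n) f differentiable_on UNIV" for n
  proof (cases n)
    case 0
    then show ?thesis using assms(2) by (auto simp: differentiable_on_def real_differentiable_def)
  next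
    case (Suc m)
    then show ?thesis using assms(3) \<open>deriv f = g\<close> by (simp add: funpow_Suc_right smooth_periodic_def del: funpow.simps)
  qed
  then show ?thesis using assms(1) by (simp add: smooth_periodic_def periodic_def)
qed

lemma smooth_periodic_const_diff:
  assumes "smooth_periodic \<phi>"
  shows "smooth_periodic (\<lambda>x. \<phi> x - c)"
proof (rule smooth_periodicI[where g = "deriv \<phi>"])
  show "periodic (\<lambda>x. \<phi> x - c)" using smooth_periodicD(1)[OF assms] by (simp add: periodic_def)
  show "((\<lambda>x. \<phi> x - c) has_real_derivative deriv \<phi> x) (at x)" for x
    using smooth_periodicD(2)[OF assms] by (auto intro!: derivative_eq_intros)
qed (rule smooth_periodic_deriv[OF assms])

lemma smooth_periodic_const: "smooth_periodic (\<lambda>x. c)"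
  by (intro trig_poly_smooth trig_poly.intros)

lemma smooth_periodic_L2: "smooth_periodic \<phi> \<Longrightarrow> \<phi> \<in> L2"
  by (intro L2_continuous smooth_periodicD)

lemma smooth_periodic_deriv_L2: "smooth_periodic \<phi> \<Longrightarrow> deriv \<phi> \<in> L2"
  by (intro smooth_periodic_L2 smooth_periodic_deriv)

text \<open>
  A Lebesgue measurable function is almost everywhere a limit of continuous functions, and dominated convergence
  makes the limit one in \<open>L2\<close> once everything is bounded. The continuous functions need not be periodic; they
  are cut off at the ends of the period and repeated. Trigonometric polynomials
  approximate the result uniformly.
\<close>

lemma L2_dense:
  assumes f: "f \<in> L2" and e: "0 < e"
  obtains \<phi> where "smooth_periodic \<phi>" "L2_norm (\<lambda>x. f x - \<phi> x) < e"
proof -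
  have "f measurable_on UNIV"
    using f by (intro lebesgue_measurable_imp_measurable_on) (auto simp: L2_circ)
  then obtain N g where N: "negligible N" and g: "\<And>n. continuous_on UNIV (g n)"
    and lim: "\<And>x. x \<notin> N \<Longrightarrow> (\<lambda>n. g n x) \<longlonglongrightarrow> f x"
    by (auto simp: measurable_on_def)
  define clip where "clip M y = max (- M) (min M y)" for M y :: real
  have clip_cont: "continuous_on UNIV (\<lambda>x. clip M (h x))" if "continuous_on UNIV h" for M and h :: "real \<Rightarrow> real"
    unfolding clip_def using that by (intro continuous_intros)
  have fm [measurable]: "f \<in> borel_measurable circ" using f by measurable
  \<comment> \<open>Truncation at a level \<open>M\<close> costs little and provides a constant majorant for the second limit.\<close>
  have "(\<lambda>n. \<integral>x. (f x - clip (real n) (f x))\<^sup>2 \<partial>circ) \<longlonglongrightarrow> (\<integral>x. 0 \<partial>circ)"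
  proof (rule integral_dominated_convergence[where w = "\<lambda>x. (f x)\<^sup>2"])
    show "AE x in circ. (\<lambda>n. (f x - clip (real n) (f x))\<^sup>2) \<longlonglongrightarrow> 0"
    proof (intro AE_I2 tendsto_eventually)
      fix x
      obtain m :: nat where m: "\<bar>f x\<bar> \<le> real m" using real_arch_simple by blast
      show "\<forall>\<^sub>F n in sequentially. (f x - clip (real n) (f x))\<^sup>2 = 0"
        using eventually_ge_at_top[of m] by eventually_elim (use m in \<open>auto simp: clip_def\<close>)
    qed
    fix n
    have "(y - clip (real n) y)\<^sup>2 \<le> y\<^sup>2" for y
      unfolding abs_le_square_iff[symmetric] by (auto simp: clip_def)
    then show "AE x in circ. norm ((f x - clip (real n) (f x))\<^sup>2) \<le> (f x)\<^sup>2" by auto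
  qed (use L2_square_integrable[OF f] in \<open>auto simp: clip_def\<close>)
  then have "\<forall>\<^sub>F n in sequentially. (\<integral>x. (f x - clip (real n) (f x))\<^sup>2 \<partial>circ) < (e / 2)\<^sup>2"
    using e by (intro order_tendstoD(2)) auto
  then obtain n where n: "(\<integral>x. (f x - clip (real n) (f x))\<^sup>2 \<partial>circ) < (e / 2)\<^sup>2"
    unfolding eventually_sequentially by blast
  define M where "M = real n"
  have M: "0 \<le> M" by (simp add: M_def)
  have clip_bound: "\<bar>clip M y\<bar> \<le> M" for y using M by (auto simp: clip_def)
  define f1 where "f1 x = clip M (f x)" for x
  have f1: "f1 \<in> L2"
  proof -
    have "f1 \<in> borel_measurable lebesgue" using f unfolding f1_def clip_def by measurable
    moreover have "periodic f1" using L2_periodic[OF f] by (auto simp: periodic_def f1_def)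
    ultimately have "(\<lambda>x. f1 x * 1) \<in> L2"
      by (intro L2_bounded_mult[where B = M and b = f1]) (auto simp: f1_def clip_bound)
    then show ?thesis by simp
  qed
  have d1: "L2_norm (\<lambda>x. f x - f1 x) < e / 2"
    using real_sqrt_less_mono[OF n] e by (simp add: L2_norm_circ f1_def M_def)
  \<comment> \<open>The cut-off \<open>c m\<close> vanishes at the integers and tends to one elsewhere, so \<open>h m\<close> is continuous across the integers.\<close>
  define c where "c m x = min 1 (real m * (frac x * (1 - frac x)))" for m x
  define h where "h m x = c m x * clip M (g m (frac x))" for m x
  have hper: "periodic (h m)" for m by (auto simp: periodic_def h_def c_def frac_def)
  have c0: "0 \<le> c m x" "c m x \<le> 1" for m x
    by (auto simp: c_def intro!: mult_nonneg_nonneg frac_ge_0 less_imp_le[OF frac_lt_1])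
  have hb: "\<bar>h m x\<bar> \<le> M" for m x
    using mult_mono[OF c0(2)[of m x] clip_bound[of "g m (frac x)"]] c0 by (simp add: h_def abs_mult)
  have hcont: "continuous_on UNIV (h m)" for m
  proof -
    define h0 where "h0 y = min 1 (real m * (y * (1 - y))) * clip M (g m y)" for y
    have h0c: "continuous_on UNIV h0"
      unfolding h0_def by (intro continuous_intros clip_cont g)
    have h0e: "h0 0 = 0" "h0 1 = 0" by (auto simp: h0_def)
    have "isCont (h m) x" for x
    proof -
      \<comment> \<open>Near \<open>x\<close> the periodic function is \<open>h0\<close> on the current period and a shifted \<open>h0\<close> on the previous one.\<close>
      define k where "k y = (if y \<le> of_int \<lfloor>x\<rfloor> then h0 (y - of_int \<lfloor>x\<rfloor> + 1)
          else h0 (y - of_int \<lfloor>x\<rfloor>))" for y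
      have h0i: "isCont h0 y" for y using h0c by (simp add: continuous_on_eq_continuous_at)
      have "continuous_on ({..of_int \<lfloor>x\<rfloor>} \<union> {of_int \<lfloor>x\<rfloor>..}) k"
        unfolding k_def
        by (intro continuous_on_If continuous_on_compose2[OF h0c] continuous_intros) (auto simp: h0e)
      moreover have "{..of_int \<lfloor>x\<rfloor>} \<union> {of_int \<lfloor>x\<rfloor>..} = (UNIV :: real set)" by auto
      ultimately have "isCont k x" by (simp add: continuous_on_eq_continuous_at)
      moreover have "\<forall>\<^sub>F y in nhds x. k y = h m y"
      proof -
        have "\<forall>\<^sub>F y in nhds x. y \<in> {of_int \<lfloor>x\<rfloor> - 1 <..< of_int \<lfloor>x\<rfloor> + 1}"
        proof (rule eventually_nhds_in_open[OF open_greaterThanLessThan])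
          show "x \<in> {of_int \<lfloor>x\<rfloor> - 1 <..< of_int \<lfloor>x\<rfloor> + 1}"
            unfolding greaterThanLessThan_iff by linarith
        qed
        then show ?thesis
        proof eventually_elim
          case (elim y)
          consider "y = of_int \<lfloor>x\<rfloor>" | "y < of_int \<lfloor>x\<rfloor>" | "of_int \<lfloor>x\<rfloor> < y" by linarith
          then show ?case
          proof cases
            case 1 then show ?thesis by (simp add: k_def h0e h_def c_def)
          next
            case 2
            then have "\<lfloor>y\<rfloor> = \<lfloor>x\<rfloor> - 1" using elim by (intro floor_unique) auto
            then have "frac y = y - of_int \<lfloor>x\<rfloor> + 1" by (simp add: frac_def)
            then show ?thesis using 2 by (simp add: k_def h_def h0_def c_def)
          next
            case 3
            then have "\<lfloor>y\<rfloor> = \<lfloor>x\<rfloor>" using elim by (intro floor_unique) auto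
            then have "frac y = y - of_int \<lfloor>x\<rfloor>" by (simp add: frac_def)
            then show ?thesis using 3 by (simp add: k_def h_def h0_def c_def)
          qed
        qed
      qed
      ultimately show ?thesis using isCont_cong[of k "h m" x] by simp
    qed
    then show ?thesis by (simp add: continuous_at_imp_continuous_on)
  qed
  have hL2: "h m \<in> L2" for m by (rule L2_continuous[OF hper hcont])
  have "(\<lambda>m. \<integral>x. (f1 x - h m x)\<^sup>2 \<partial>circ) \<longlonglongrightarrow> (\<integral>x. 0 \<partial>circ)"
  proof (rule integral_dominated_convergence[where w = "\<lambda>x. (2 * M)\<^sup>2"])
    have "AE x in lebesgue. x \<notin> N \<union> {0, 1}"
      using N by (intro AE_not_in) (auto simp: negligible_iff_null_sets[symmetric])
    then have "AE x in circ. x \<notin> N \<union> {0, 1}" by (rule AE_lebesgue_imp_circ)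
    moreover have "AE x in circ. x \<in> space circ" by (rule AE_space)
    ultimately show "AE x in circ. (\<lambda>m. (f1 x - h m x)\<^sup>2) \<longlonglongrightarrow> 0"
    proof eventually_elim
      case (elim x)
      then have x: "0 < x" "x < 1" "x \<notin> N" by auto
      then have fr: "frac x = x" by (simp add: frac_eq)
      have "(\<lambda>m. c m x) \<longlonglongrightarrow> 1"
      proof (rule tendsto_eventually)
        obtain k :: nat where k: "1 / (x * (1 - x)) \<le> real k" using real_arch_simple by blast
        have "0 < x * (1 - x)" using x by simp
        show "\<forall>\<^sub>F m in sequentially. c m x = 1"
          using eventually_ge_at_top[of k]
        proof eventually_elim
          case (elim m)
          have "1 / (x * (1 - x)) \<le> real m" using k elim by linarith
          then have "1 \<le> real m * (x * (1 - x))" using \<open>0 < x * (1 - x)\<close> by (simp add: divide_le_eq)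
          then show ?case by (simp add: c_def fr)
        qed
      qed
      moreover have "(\<lambda>m. clip M (g m x)) \<longlonglongrightarrow> clip M (f x)"
        unfolding clip_def by (intro tendsto_intros lim x)
      ultimately have "(\<lambda>m. h m x) \<longlonglongrightarrow> 1 * f1 x"
        unfolding h_def f1_def fr by (rule tendsto_mult)
      then have "(\<lambda>m. (f1 x - h m x)\<^sup>2) \<longlonglongrightarrow> (f1 x - f1 x)\<^sup>2"
        by (intro tendsto_intros) simp
      then show ?case by simp
    qed
    fix m
    have "\<bar>f1 x - h m x\<bar> \<le> \<bar>2 * M\<bar>" for x
      using hb[of m x] clip_bound[of "f x"] by (simp add: f1_def)
    then have "(f1 x - h m x)\<^sup>2 \<le> (2 * M)\<^sup>2" for x
      unfolding abs_le_square_iff[symmetric] .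
    then show "AE x in circ. norm ((f1 x - h m x)\<^sup>2) \<le> (2 * M)\<^sup>2" by simp
    show "(\<lambda>x. (f1 x - h m x)\<^sup>2) \<in> borel_measurable circ"
      using f1 hL2[of m] by measurable
  qed auto
  then have "\<forall>\<^sub>F m in sequentially. (\<integral>x. (f1 x - h m x)\<^sup>2 \<partial>circ) < (e / 4)\<^sup>2"
    using e by (intro order_tendstoD(2)) auto
  then obtain m where m: "(\<integral>x. (f1 x - h m x)\<^sup>2 \<partial>circ) < (e / 4)\<^sup>2"
    unfolding eventually_sequentially by blast
  have d2: "L2_norm (\<lambda>x. f1 x - h m x) < e / 4"
    using real_sqrt_less_mono[OF m] e by (simp add: L2_norm_circ)
  obtain p where p: "trig_poly p" "\<And>x. \<bar>h m x - p x\<bar> < e / 4"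
    using trig_poly_dense[OF hper hcont, of "e / 4"] e by auto
  have pL2: "p \<in> L2" using p(1) by (intro smooth_periodic_L2 trig_poly_smooth)
  have d3: "L2_norm (\<lambda>x. h m x - p x) \<le> e / 4"
    using p(2) by (intro L2_norm_le_bound L2_diff hL2 pL2) (auto intro: less_imp_le)
  have "L2_norm (\<lambda>x. f x - p x) < e"
    using L2_norm_diff_triangle[OF f f1 pL2] L2_norm_diff_triangle[OF f1 hL2[of m] pL2] d1 d2 d3 by linarith
  then show thesis using that trig_poly_smooth[OF p(1)] by blast
qed

text \<open>
  The function \<open>f\<close> can be tested against a smooth function close to \<open>f\<close> itself. Inequalities between norms thus
  reduce to identities for integrals against smooth functions, also where \<open>f\<close> has no usable formula.
\<close>

lemma L2_norm_le_dual:
  assumes f: "f \<in> L2" and c: "0 \<le> c"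
    and dual: "\<And>\<phi>. smooth_periodic \<phi> \<Longrightarrow> \<bar>\<integral>x. f x * \<phi> x \<partial>circ\<bar> \<le> c * L2_norm \<phi>"
  shows "L2_norm f \<le> c"
proof (rule ccontr)
  assume "\<not> L2_norm f \<le> c"
  define n where "n = L2_norm f"
  have n: "c < n" "0 < n" using \<open>\<not> L2_norm f \<le> c\<close> c by (auto simp: n_def)
  \<comment> \<open>Small enough for \<open>n * d + c * (n + d) < n\<^sup>2\<close>, the contradiction below.\<close>
  define d where "d = n * (n - c) / (n + c + 1)"
  have d: "0 < d" using n c by (simp add: d_def)
  obtain \<phi> where \<phi>: "smooth_periodic \<phi>" "L2_norm (\<lambda>x. f x - \<phi> x) < d" using L2_dense[OF f d] .
  note pL = smooth_periodic_L2[OF \<phi>(1)]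
  have "n\<^sup>2 = (\<integral>x. f x * (f x - \<phi> x) + f x * \<phi> x \<partial>circ)"
    unfolding n_def L2_norm_square by (intro Bochner_Integration.integral_cong) (auto simp: power2_eq_square algebra_simps)
  also have "\<dots> = (\<integral>x. f x * (f x - \<phi> x) \<partial>circ) + (\<integral>x. f x * \<phi> x \<partial>circ)"
    using L2_mult_integrable[OF f L2_diff[OF f pL]] L2_mult_integrable[OF f pL] by simp
  also have "\<dots> \<le> n * L2_norm (\<lambda>x. f x - \<phi> x) + c * L2_norm \<phi>"
    using L2_Cauchy_Schwarz[OF f L2_diff[OF f pL]] dual[OF \<phi>(1)] by (simp add: n_def)
  also have "\<dots> \<le> n * d + c * (n + d)"
  proof (intro add_mono mult_left_mono)
    show "L2_norm \<phi> \<le> n + d"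
      using L2_norm_diff_ge[OF pL f] \<phi>(2) L2_norm_minus_commute[of f \<phi>] by (simp add: n_def)
  qed (use \<phi> n c in auto)
  also have "\<dots> = d * (n + c) + c * n" by (simp add: algebra_simps)
  also have "\<dots> < d * (n + c + 1) + c * n" using d by simp
  also have "d * (n + c + 1) = n * (n - c)" using n c by (simp add: d_def)
  also have "n * (n - c) + c * n = n\<^sup>2" by (simp add: power2_eq_square algebra_simps)
  finally show False by simp
qed

section \<open>Weak derivatives\<close>

lemma integrable_circ_continuous:
  fixes f :: "real \<Rightarrow> real"
  assumes "continuous_on UNIV f"
  shows "integrable circ f"
  using absolutely_integrable_continuous_real[of 0 1 f] assms continuous_on_subset
  by (auto simp: set_integrable_circ[symmetric])

lemma integral_circ_has_integral:
  fixes f :: "real \<Rightarrow> real"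
  assumes "integrable circ f" "(f has_integral I) {0..1}"
  shows "integral\<^sup>L circ f = I"
  using lebesgue_integral_eq_integral[OF assms(1)] assms(2) by (simp add: integral_unique)

lemma integral_circ_eq_integral:
  fixes f :: "real \<Rightarrow> real"
  assumes "continuous_on UNIV f"
  shows "integral\<^sup>L circ f = integral {0..1} f"
  by (rule lebesgue_integral_eq_integral[OF integrable_circ_continuous[OF assms]]) simp

lemma circ_FTC:
  assumes "continuous_on UNIV f" "\<And>x. (F has_real_derivative f x) (at x)"
  shows "integral\<^sup>L circ f = F 1 - F 0"
proof (rule integral_circ_has_integral[OF integrable_circ_continuous[OF assms(1)]])
  show "(f has_integral (F 1 - F 0)) {0..1}"
    using assms(2) by (intro fundamental_theorem_of_calculus)
      (auto simp: has_real_derivative_iff_has_vector_derivative[symmetric] intro: has_field_derivative_at_within)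
qed

text \<open>
  A primitive on the whole line is glued from integrals to the right and to the left of the origin.
\<close>

lemma ex_primitive:
  fixes f :: "real \<Rightarrow> real"
  assumes f: "continuous_on UNIV f"
  obtains F where "\<And>x. (F has_real_derivative f x) (at x)" "F 0 = c"
proof
  define F where "F x = (if 0 \<le> x then integral {0..x} f else - integral {x..0} f)" for x
  have int: "f integrable_on {a..b}" for a b
    using f by (intro integrable_continuous_real) (auto intro: continuous_on_subset)
  show "((\<lambda>x. F x + c) has_real_derivative f x) (at x)" for x
  proof -
    define a b where "a = min x 0 - 1" and "b = max x 0 + 1"
    have "a \<le> 0" by (simp add: a_def)
    have "((\<lambda>y. integral {a..y} f) has_real_derivative f x) (at x within {a..b})"
      using f by (intro integral_has_real_derivative) (auto simp: a_def b_def intro: continuous_on_subset)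
    moreover have "at x within {a..b} = at x"
      by (rule at_within_interior) (auto simp: a_def b_def)
    ultimately have "((\<lambda>y. integral {a..y} f + (c - integral {a..0} f)) has_real_derivative f x) (at x)"
      by (auto intro!: derivative_eq_intros)
    moreover have "\<forall>\<^sub>F y in nhds x. integral {a..y} f + (c - integral {a..0} f) = F y + c"
    proof -
      have "\<forall>\<^sub>F y in nhds x. y \<in> {a<..<b}"
        by (intro eventually_nhds_in_open) (auto simp: a_def b_def)
      then show ?thesis
      proof eventually_elim
        case (elim y)
        show ?case
        proof (cases "0 \<le> y")
          case True
          then show ?thesis using Henstock_Kurzweil_Integration.integral_combine[of a 0 y f] int \<open>a \<le> 0\<close> by (simp add: F_def)
        next
          case False
          then show ?thesis using Henstock_Kurzweil_Integration.integral_combine[of a y 0 f] int elim by (simp add: F_def)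
        qed
      qed
    qed
    ultimately show ?thesis
      using DERIV_cong_ev[of x x "\<lambda>y. integral {a..y} f + (c - integral {a..0} f)" "\<lambda>y. F y + c" "f x" "f x"]
      by simp
  qed
  show "F 0 + c = c" by (simp add: F_def)
qed

lemma periodic_primitive:
  assumes "periodic f" "continuous_on UNIV f" "\<And>x. (F has_real_derivative f x) (at x)" "integral\<^sup>L circ f = 0"
  shows "periodic F"
proof -
  have "((\<lambda>y. F (y + 1) - F y) has_real_derivative 0) (at x)" for x
  proof -
    have "((\<lambda>y. F (y + 1)) has_real_derivative f (x + 1)) (at x)"
      using assms(3)[of "x + 1"] DERIV_shift by blast
    from DERIV_diff[OF this assms(3)[of x]] show ?thesis
      using assms(1) by (simp add: periodic_def)
  qed
  then have "F (x + 1) - F x = F (0 + 1) - F 0" for x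
    using DERIV_const_ratio_const2[of _ _ _ 0] DERIV_isconst_all by blast
  also have "F (0 + 1) - F 0 = 0" using circ_FTC[OF assms(2,3)] assms(4) by simp
  finally show ?thesis by (auto simp: periodic_def)
qed

lemma DERIV_continuous_UNIV:
  assumes "\<And>x. (F has_real_derivative f x) (at x)"
  shows "continuous_on UNIV F"
  using assms by (meson DERIV_isCont continuous_at_imp_continuous_on)

lemma ex_periodic_primitive_mean:
  assumes f: "periodic f" "continuous_on UNIV f" "integral\<^sup>L circ f = 0"
  obtains F where "\<And>x. (F has_real_derivative f x) (at x)" "periodic F" "mean F = c"
proof -
  obtain F0 where F0: "\<And>x. (F0 has_real_derivative f x) (at x)" using ex_primitive[OF f(2), of 0] by blast
  note p = periodic_primitive[OF f(1,2) F0 f(3)]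
  define F where "F = (\<lambda>x. F0 x + (c - mean F0))"
  have "(F has_real_derivative f x) (at x)" for x
    unfolding F_def using F0 by (auto intro!: derivative_eq_intros)
  moreover have "periodic F" using p by (simp add: periodic_def F_def)
  moreover have "mean F = c"
    using integrable_circ_continuous[OF DERIV_continuous_UNIV[OF F0]] by (simp add: F_def mean_circ)
  ultimately show thesis by (rule that)
qed

text \<open>
  The value \<open>F x - mean F\<close> is the integral of the derivative against the sawtooth \<open>frac (r - x) - 1/2\<close>, whose
  norm is \<open>1 / sqrt 12\<close>. This sharp constant is the one that turns the bound \<open>2 * sqrt 3 * \<bar>m\<bar>\<close> on the third
  derivative into the bound \<open>\<bar>m\<bar>\<close> on the second.
\<close>

lemma periodic_sup_mean:
  assumes F: "periodic F" "\<And>x. (F has_real_derivative f x) (at x)" "continuous_on UNIV f"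
  shows "\<bar>F x - mean F\<bar> \<le> L2_norm f / sqrt 12"
proof -
  have *: "\<bar>F x - mean F\<bar> \<le> L2_norm f / sqrt 12" if x: "0 \<le> x" "x < 1" for x
  proof -
    define k where "k r = frac (r - x) - 1 / 2" for r
    have k1: "k r = r - x + 1 / 2" if "0 < r" "r < x" for r
    proof -
      have "\<lfloor>r - x\<rfloor> = -1" using that x by (intro floor_unique) auto
      then show ?thesis by (simp add: k_def frac_def)
    qed
    have k2: "k r = r - x - 1 / 2" if "x < r" "r < 1" for r
    proof -
      have "\<lfloor>r - x\<rfloor> = 0" using that x by (intro floor_unique) auto
      then show ?thesis by (simp add: k_def frac_def)
    qed
    have FC: "continuous_on UNIV F" by (rule DERIV_continuous_UNIV[OF F(2)])
    have kb: "\<bar>k r\<bar> \<le> 1" for r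
      using frac_ge_0[of "r - x"] frac_lt_1[of "r - x"] unfolding k_def by arith
    have kL: "k \<in> L2"
    proof -
      have "k \<in> borel_measurable borel" unfolding k_def frac_def by measurable
      then have "k \<in> borel_measurable lebesgue" by (simp add: measurable_completion)
      moreover have "frac (y + 1 - x) = frac (y - x)" for y
        using frac_1_eq[of "y - x"] by (simp add: algebra_simps)
      then have "periodic k" by (simp add: periodic_def k_def)
      ultimately have "(\<lambda>r. k r * 1) \<in> L2"
        using kb by (intro L2_bounded_mult[where B = 1]) auto
      then show ?thesis by simp
    qed
    have fL: "f \<in> L2" using F periodic_deriv[OF F(1,2)] by (intro L2_continuous)
    have FL: "F \<in> L2" using F FC by (intro L2_continuous)
    \<comment> \<open>The sawtooth jumps at \<open>x\<close>, so the fundamental theorem is applied on both sides of \<open>x\<close>.\<close>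
    have "((\<lambda>r. (k r)\<^sup>2) has_integral ((x - x + 1/2)^3 / 3 - (0 - x + 1/2)^3 / 3)) {0..x}"
    proof (rule fundamental_theorem_of_calculus_interior)
      show "((\<lambda>r. (r - x + 1/2)^3 / 3) has_vector_derivative (k r)\<^sup>2) (at r)" if "r \<in> {0<..<x}" for r
        unfolding has_real_derivative_iff_has_vector_derivative[symmetric] using k1[of r] that
        by (auto intro!: derivative_eq_intros)
    qed (use x in \<open>auto intro!: continuous_intros\<close>)
    moreover have "((\<lambda>r. (k r)\<^sup>2) has_integral ((1 - x - 1/2)^3 / 3 - (x - x - 1/2)^3 / 3)) {x..1}"
    proof (rule fundamental_theorem_of_calculus_interior)
      show "((\<lambda>r. (r - x - 1/2)^3 / 3) has_vector_derivative (k r)\<^sup>2) (at r)" if "r \<in> {x<..<1}" for r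
        unfolding has_real_derivative_iff_has_vector_derivative[symmetric] using k2[of r] that
        by (auto intro!: derivative_eq_intros)
    qed (use x in \<open>auto intro!: continuous_intros\<close>)
    ultimately have "((\<lambda>r. (k r)\<^sup>2) has_integral
        ((x - x + 1/2)^3 / 3 - (0 - x + 1/2)^3 / 3) + ((1 - x - 1/2)^3 / 3 - (x - x - 1/2)^3 / 3)) {0..1}"
      using x by (intro has_integral_combine[where c = x]) auto
    moreover have "((x - x + 1/2)^3 / 3 - (0 - x + 1/2)^3 / 3) + ((1 - x - 1/2)^3 / 3 - (x - x - 1/2)^3 / 3) = 1 / 12"
      by (simp add: power3_eq_cube algebra_simps)
    ultimately have "(\<integral>r. (k r)\<^sup>2 \<partial>circ) = 1 / 12"
      using integral_circ_has_integral[OF L2_square_integrable[OF kL]] by simp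
    then have nk: "L2_norm k = 1 / sqrt 12" by (simp only: L2_norm_circ real_sqrt_divide real_sqrt_one)
    have "((\<lambda>r. k r * f r + F r) has_integral ((x - x + 1/2) * F x - (0 - x + 1/2) * F 0)) {0..x}"
    proof (rule fundamental_theorem_of_calculus_interior)
      show "((\<lambda>r. (r - x + 1/2) * F r) has_vector_derivative k r * f r + F r) (at r)" if "r \<in> {0<..<x}" for r
        unfolding has_real_derivative_iff_has_vector_derivative[symmetric] using k1[of r] that F(2)[of r]
        by (auto intro!: derivative_eq_intros)
    qed (use x FC in \<open>auto intro!: continuous_intros intro: continuous_on_subset\<close>)
    moreover have "((\<lambda>r. k r * f r + F r) has_integral ((1 - x - 1/2) * F 1 - (x - x - 1/2) * F x)) {x..1}"
    proof (rule fundamental_theorem_of_calculus_interior)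
      show "((\<lambda>r. (r - x - 1/2) * F r) has_vector_derivative k r * f r + F r) (at r)" if "r \<in> {x<..<1}" for r
        unfolding has_real_derivative_iff_has_vector_derivative[symmetric] using k2[of r] that F(2)[of r]
        by (auto intro!: derivative_eq_intros)
    qed (use x FC in \<open>auto intro!: continuous_intros intro: continuous_on_subset\<close>)
    ultimately have "((\<lambda>r. k r * f r + F r) has_integral
        ((x - x + 1/2) * F x - (0 - x + 1/2) * F 0) + ((1 - x - 1/2) * F 1 - (x - x - 1/2) * F x)) {0..1}"
      using x by (intro has_integral_combine[where c = x]) auto
    moreover have "((x - x + 1/2) * F x - (0 - x + 1/2) * F 0) + ((1 - x - 1/2) * F 1 - (x - x - 1/2) * F x) = F x"
      using F(1)[unfolded periodic_def, rule_format, of 0] by (simp add: algebra_simps)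
    ultimately have "((\<lambda>r. k r * f r + F r) has_integral F x) {0..1}" by (simp only:)
    then have "(\<integral>r. k r * f r + F r \<partial>circ) = F x"
      using L2_mult_integrable[OF kL fL] L2_integrable[OF FL] by (intro integral_circ_has_integral) auto
    then have "F x - mean F = (\<integral>r. k r * f r \<partial>circ)"
      using L2_mult_integrable[OF kL fL] L2_integrable[OF FL] by (simp add: mean_circ)
    then show ?thesis using L2_Cauchy_Schwarz[OF kL fL] nk by simp
  qed
  show ?thesis using *[of "frac x"] frac_lt_1 periodic_frac[OF F(1)] by (metis frac_ge_0)
qed

lemma weak_deriv_C1:
  assumes "periodic f" "\<And>x. (f has_real_derivative f' x) (at x)" "continuous_on UNIV f'"
  shows "has_weak_deriv f f'"
  unfolding weak_deriv_circ
proof safe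
  fix \<phi> assume \<phi>: "smooth_periodic \<phi>"
  note p = smooth_periodicD[OF \<phi>] smooth_periodicD(3)[OF smooth_periodic_deriv[OF \<phi>]]
  have fc: "continuous_on UNIV f" by (rule DERIV_continuous_UNIV[OF assms(2)])
  have "(\<integral>x. f' x * \<phi> x + f x * deriv \<phi> x \<partial>circ) = f 1 * \<phi> 1 - f 0 * \<phi> 0"
  proof (rule circ_FTC)
    show "((\<lambda>x. f x * \<phi> x) has_real_derivative f' x * \<phi> x + f x * deriv \<phi> x) (at x)" for x
      using DERIV_mult[OF assms(2) p(2), of x] by (simp add: mult.commute)
  qed (intro continuous_intros assms p fc)
  also have "\<dots> = 0" using assms(1) p(1) unfolding periodic_def by (metis add_0 diff_self)
  finally have "(\<integral>x. f' x * \<phi> x \<partial>circ) + (\<integral>x. f x * deriv \<phi> x \<partial>circ) = 0"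
    by (subst (asm) Bochner_Integration.integral_add)
      (intro integrable_circ_continuous continuous_intros assms p fc | simp)+
  then show "(\<integral>x. f x * deriv \<phi> x \<partial>circ) = - (\<integral>x. f' x * \<phi> x \<partial>circ)" by simp
qed

lemma weak_deriv_cong_AE:
  assumes "has_weak_deriv f g" "f \<in> L2" "g \<in> L2" "f' \<in> L2" "g' \<in> L2"
    and ae: "AE x in circ. f x = f' x" "AE x in circ. g x = g' x"
  shows "has_weak_deriv f' g'"
  unfolding weak_deriv_circ
proof safe
  fix \<phi> assume \<phi>: "smooth_periodic \<phi>"
  note L = smooth_periodic_L2[OF \<phi>] smooth_periodic_deriv_L2[OF \<phi>]
  have "(\<integral>x. f' x * deriv \<phi> x \<partial>circ) = (\<integral>x. f x * deriv \<phi> x \<partial>circ)"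
    using assms(2,4) L(2) by (intro integral_cong_AE) (use ae(1) in \<open>auto elim!: eventually_mono\<close>)
  moreover have "(\<integral>x. g' x * \<phi> x \<partial>circ) = (\<integral>x. g x * \<phi> x \<partial>circ)"
    using assms(3,5) L(1) by (intro integral_cong_AE) (use ae(2) in \<open>auto elim!: eventually_mono\<close>)
  ultimately show "(\<integral>x. f' x * deriv \<phi> x \<partial>circ) = - (\<integral>x. g' x * \<phi> x \<partial>circ)"
    using assms(1) \<phi> by (simp add: weak_deriv_circ)
qed

lemma weak_deriv_lincomb:
  assumes "has_weak_deriv f g" "has_weak_deriv f' g'" "f \<in> L2" "g \<in> L2" "f' \<in> L2" "g' \<in> L2"
  shows "has_weak_deriv (\<lambda>x. a * f x + b * f' x) (\<lambda>x. a * g x + b * g' x)"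
  unfolding weak_deriv_circ
proof safe
  fix \<phi> assume \<phi>: "smooth_periodic \<phi>"
  note L = smooth_periodic_L2[OF \<phi>] smooth_periodic_deriv_L2[OF \<phi>]
  have "(\<integral>x. (a * f x + b * f' x) * deriv \<phi> x \<partial>circ) =
      (\<integral>x. a * (f x * deriv \<phi> x) + b * (f' x * deriv \<phi> x) \<partial>circ)"
    by (simp add: algebra_simps)
  also have "\<dots> = a * (\<integral>x. f x * deriv \<phi> x \<partial>circ) + b * (\<integral>x. f' x * deriv \<phi> x \<partial>circ)"
    using assms L by (simp add: L2_mult_integrable)
  also have "\<dots> = - (a * (\<integral>x. g x * \<phi> x \<partial>circ) + b * (\<integral>x. g' x * \<phi> x \<partial>circ))"
    using assms \<phi> by (simp add: weak_deriv_circ)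
  also have "a * (\<integral>x. g x * \<phi> x \<partial>circ) + b * (\<integral>x. g' x * \<phi> x \<partial>circ) =
      (\<integral>x. a * (g x * \<phi> x) + b * (g' x * \<phi> x) \<partial>circ)"
    using assms L by (simp add: L2_mult_integrable)
  also have "\<dots> = (\<integral>x. (a * g x + b * g' x) * \<phi> x \<partial>circ)"
    by (simp add: algebra_simps)
  finally show "(\<integral>x. (a * f x + b * f' x) * deriv \<phi> x \<partial>circ) = - (\<integral>x. (a * g x + b * g' x) * \<phi> x \<partial>circ)" .
qed

lemma weak_deriv_diff:
  assumes "has_weak_deriv f g" "has_weak_deriv f' g'" "f \<in> L2" "g \<in> L2" "f' \<in> L2" "g' \<in> L2"
  shows "has_weak_deriv (\<lambda>x. f x - f' x) (\<lambda>x. g x - g' x)"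
  using weak_deriv_lincomb[OF assms, of 1 "-1"] by simp

lemma weak_deriv_add:
  assumes "has_weak_deriv f g" "has_weak_deriv f' g'" "f \<in> L2" "g \<in> L2" "f' \<in> L2" "g' \<in> L2"
  shows "has_weak_deriv (\<lambda>x. f x + f' x) (\<lambda>x. g x + g' x)"
  using weak_deriv_lincomb[OF assms, of 1 1] by simp

lemma weak_deriv_cmult:
  assumes "has_weak_deriv f g" "f \<in> L2" "g \<in> L2"
  shows "has_weak_deriv (\<lambda>x. c * f x) (\<lambda>x. c * g x)"
  using weak_deriv_lincomb[OF assms(1,1) assms(2,3,2,3), of c 0] by simp

lemma weak_deriv_const: "has_weak_deriv (\<lambda>x. c) (\<lambda>x. 0)"
  by (rule weak_deriv_C1) (auto simp: periodic_def)

lemma weak_deriv_mean: "has_weak_deriv f g \<Longrightarrow> integral\<^sup>L circ g = 0"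
  using smooth_periodic_const[of 1] by (force simp: weak_deriv_circ)

text \<open>
  By duality: a smooth function with mean zero is the derivative of a smooth function \<open>\<Psi>\<close> with mean zero, whose
  norm is at most half as large.
\<close>

lemma weak_Poincare:
  assumes h: "h \<in> L2" and k: "k \<in> L2" and w: "has_weak_deriv h k" and m: "mean h = 0"
  shows "L2_norm h \<le> L2_norm k"
proof (rule L2_norm_le_dual[OF h L2_norm_nonneg])
  fix \<phi> assume \<phi>: "smooth_periodic \<phi>"
  define \<psi> where "\<psi> = (\<lambda>x. \<phi> x - mean \<phi>)"
  have \<psi>: "smooth_periodic \<psi>" unfolding \<psi>_def by (rule smooth_periodic_const_diff[OF \<phi>])
  note pL = smooth_periodic_L2[OF \<phi>] smooth_periodic_L2[OF \<psi>]
  have "integral\<^sup>L circ \<psi> = 0" using L2_integrable[OF pL(1)] by (simp add: \<psi>_def mean_circ)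
  then obtain \<Psi> where \<Psi>: "\<And>x. (\<Psi> has_real_derivative \<psi> x) (at x)" "periodic \<Psi>" "mean \<Psi> = 0"
    using ex_periodic_primitive_mean[OF smooth_periodicD(1,3)[OF \<psi>]] by blast
  have s\<Psi>: "smooth_periodic \<Psi>" by (rule smooth_periodicI[OF \<Psi>(2,1) \<psi>])
  have d\<Psi>: "deriv \<Psi> = \<psi>" using \<Psi>(1) DERIV_imp_deriv by blast
  have "L2_norm \<psi> \<le> 2 * L2_norm \<phi>"
    using L2_norm_triangle_diff[OF pL(1) L2_const[of "mean \<phi>"]] mean_le_L2_norm[OF pL(1)] by (simp add: \<psi>_def)
  moreover have "L2_norm \<Psi> \<le> L2_norm \<psi> / sqrt 12"
    using periodic_sup_mean[OF \<Psi>(2,1) smooth_periodicD(3)[OF \<psi>]] \<Psi>(3)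
    by (intro L2_norm_le_bound smooth_periodic_L2 s\<Psi>) auto
  moreover have "L2_norm \<psi> / sqrt 12 \<le> L2_norm \<psi> / 2"
    by (rule divide_left_mono) (auto intro: real_le_rsqrt)
  ultimately have n: "L2_norm \<Psi> \<le> L2_norm \<phi>" by linarith
  have "(\<integral>x. h x * \<psi> x \<partial>circ) = (\<integral>x. h x * \<phi> x - mean \<phi> * h x \<partial>circ)"
    by (simp add: \<psi>_def algebra_simps)
  also have "\<dots> = (\<integral>x. h x * \<phi> x \<partial>circ) - mean \<phi> * mean h"
    using L2_mult_integrable[OF h pL(1)] L2_integrable[OF h] by (simp add: mean_circ)
  finally have "(\<integral>x. h x * \<phi> x \<partial>circ) = (\<integral>x. h x * \<psi> x \<partial>circ)" using m by simp
  also have "\<dots> = - (\<integral>x. k x * \<Psi> x \<partial>circ)" using w s\<Psi> d\<Psi> by (auto simp: weak_deriv_circ)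
  finally have "\<bar>\<integral>x. h x * \<phi> x \<partial>circ\<bar> \<le> L2_norm k * L2_norm \<Psi>"
    using L2_Cauchy_Schwarz[OF k smooth_periodic_L2[OF s\<Psi>]] by simp
  also have "\<dots> \<le> L2_norm k * L2_norm \<phi>" by (intro mult_left_mono n) simp
  finally show "\<bar>\<integral>x. h x * \<phi> x \<partial>circ\<bar> \<le> L2_norm k * L2_norm \<phi>" .
qed

lemma L2_norm_le_mean_deriv:
  assumes "h \<in> L2" "k \<in> L2" "has_weak_deriv h k"
  shows "L2_norm h \<le> \<bar>mean h\<bar> + L2_norm k"
proof -
  have L: "(\<lambda>x. h x - mean h) \<in> L2" by (rule L2_diff[OF assms(1) L2_const])
  have "has_weak_deriv (\<lambda>x. h x - mean h) (\<lambda>x. k x - 0)"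
    by (rule weak_deriv_diff[OF assms(3) weak_deriv_const assms(1,2) L2_const L2_const])
  moreover have "mean (\<lambda>x. h x - mean h) = 0" using L2_integrable[OF assms(1)] by (simp add: mean_circ)
  ultimately have "L2_norm (\<lambda>x. h x - mean h) \<le> L2_norm k"
    using weak_Poincare[OF L assms(2)] by simp
  then show ?thesis using L2_norm_triangle[OF L L2_const[of "mean h"]] by simp
qed

lemma weak_deriv_unique:
  assumes "has_weak_deriv f g" "has_weak_deriv f g'" "g \<in> L2" "g' \<in> L2"
  shows "AE x in lebesgue. g x = g' x"
proof -
  have L: "(\<lambda>x. g x - g' x) \<in> L2" by (rule L2_diff[OF assms(3,4)])
  have "L2_norm (\<lambda>x. g x - g' x) \<le> 0"
  proof (rule L2_norm_le_dual[OF L])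
    fix \<phi> assume \<phi>: "smooth_periodic \<phi>"
    have "(\<integral>x. g x * \<phi> x \<partial>circ) = (\<integral>x. g' x * \<phi> x \<partial>circ)"
      using assms(1,2) \<phi> by (simp add: weak_deriv_circ)
    then have "(\<integral>x. (g x - g' x) * \<phi> x \<partial>circ) = 0"
      using L2_mult_integrable[OF assms(3) smooth_periodic_L2[OF \<phi>]] L2_mult_integrable[OF assms(4) smooth_periodic_L2[OF \<phi>]]
      by (simp add: left_diff_distrib)
    then show "\<bar>\<integral>x. (g x - g' x) * \<phi> x \<partial>circ\<bar> \<le> 0 * L2_norm \<phi>" by simp
  qed simp
  then have "L2_norm (\<lambda>x. g x - g' x) = 0" using L2_norm_nonneg by (rule antisym)
  from L2_norm_eq_0[OF L this] show ?thesis
    by (intro AE_circ_imp_lebesgue L2_periodic assms) auto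
qed

text \<open>
  Choose \<open>\<phi>\<close> close to \<open>g\<close> and integrate; Poincare's inequality controls the distance of the primitives. Classical
  identities pass to weak derivatives through these approximations.
\<close>

lemma weak_deriv_approx:
  assumes f: "f \<in> L2" and g: "g \<in> L2" and w: "has_weak_deriv f g" and e: "0 < e"
  obtains F \<phi> where "smooth_periodic F" "smooth_periodic \<phi>" "\<forall>x. (F has_real_derivative \<phi> x) (at x)"
    "mean F = mean f" "L2_norm (\<lambda>x. g x - \<phi> x) < e" "L2_norm (\<lambda>x. f x - F x) < e"
proof -
  obtain \<phi>0 where \<phi>0: "smooth_periodic \<phi>0" "L2_norm (\<lambda>x. g x - \<phi>0 x) < e / 2"
    using L2_dense[OF g, of "e / 2"] e by auto
  define \<phi> where "\<phi> = (\<lambda>x. \<phi>0 x - mean \<phi>0)"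
  have \<phi>: "smooth_periodic \<phi>" unfolding \<phi>_def by (rule smooth_periodic_const_diff[OF \<phi>0(1)])
  note pL = smooth_periodic_L2[OF \<phi>0(1)] smooth_periodic_L2[OF \<phi>]
  have dL: "(\<lambda>x. g x - \<phi>0 x) \<in> L2" by (rule L2_diff[OF g pL(1)])
  have "mean (\<lambda>x. g x - \<phi>0 x) = - mean \<phi>0"
    using weak_deriv_mean[OF w] L2_integrable[OF g] L2_integrable[OF pL(1)] by (simp add: mean_circ)
  then have m: "\<bar>mean \<phi>0\<bar> < e / 2" using mean_le_L2_norm[OF dL] \<phi>0(2) by simp
  have c: "L2_norm (\<lambda>x. g x - \<phi> x) < e"
    using L2_norm_triangle[OF dL L2_const[of "mean \<phi>0"]] m \<phi>0(2) by (simp add: \<phi>_def algebra_simps)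
  have "integral\<^sup>L circ \<phi> = 0" using L2_integrable[OF pL(1)] by (simp add: \<phi>_def mean_circ)
  then obtain F where F: "\<And>x. (F has_real_derivative \<phi> x) (at x)" "periodic F" "mean F = mean f"
    using ex_periodic_primitive_mean[OF smooth_periodicD(1,3)[OF \<phi>]] by blast
  have sF: "smooth_periodic F" by (rule smooth_periodicI[OF F(2,1) \<phi>])
  have FL: "F \<in> L2" by (rule smooth_periodic_L2[OF sF])
  have "has_weak_deriv (\<lambda>x. f x - F x) (\<lambda>x. g x - \<phi> x)"
    by (intro weak_deriv_diff w weak_deriv_C1 F smooth_periodicD \<phi> f g FL pL)
  moreover have "mean (\<lambda>x. f x - F x) = 0"
    using F(3) L2_integrable[OF f] L2_integrable[OF FL] by (simp add: mean_circ)
  ultimately have "L2_norm (\<lambda>x. f x - F x) \<le> L2_norm (\<lambda>x. g x - \<phi> x)"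
    by (intro weak_Poincare L2_diff f g FL pL)
  then show thesis using c by (intro that[OF sF \<phi> _ F(3) c]) (auto simp: F(1))
qed

lemma weak_deriv_limit:
  assumes f: "f \<in> L2" and g: "g \<in> L2"
    and approx: "\<And>e. 0 < e \<Longrightarrow> \<exists>F \<phi>. F \<in> L2 \<and> \<phi> \<in> L2 \<and> has_weak_deriv F \<phi> \<and>
        L2_norm (\<lambda>x. f x - F x) < e \<and> L2_norm (\<lambda>x. g x - \<phi> x) < e"
  shows "has_weak_deriv f g"
  unfolding weak_deriv_circ
proof safe
  fix \<psi> assume \<psi>: "smooth_periodic \<psi>"
  note L = smooth_periodic_L2[OF \<psi>] smooth_periodic_deriv_L2[OF \<psi>]
  define r where "r = (\<integral>x. f x * deriv \<psi> x \<partial>circ) + (\<integral>x. g x * \<psi> x \<partial>circ)"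
  define C where "C = L2_norm \<psi> + L2_norm (deriv \<psi>) + 1"
  have C: "0 < C" unfolding C_def by (intro add_nonneg_pos add_nonneg_nonneg) auto
  have "\<bar>r\<bar> \<le> 0 + e" if e: "0 < e" for e
  proof -
    obtain F \<phi> where F: "F \<in> L2" "\<phi> \<in> L2" "has_weak_deriv F \<phi>"
      "L2_norm (\<lambda>x. f x - F x) < e / C" "L2_norm (\<lambda>x. g x - \<phi> x) < e / C"
      using approx[of "e / C"] e C by auto
    have "(\<integral>x. F x * deriv \<psi> x \<partial>circ) + (\<integral>x. \<phi> x * \<psi> x \<partial>circ) = 0"
      using F(3) \<psi> by (simp add: weak_deriv_circ)
    then have "r = (\<integral>x. (f x - F x) * deriv \<psi> x \<partial>circ) + (\<integral>x. (g x - \<phi> x) * \<psi> x \<partial>circ)"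
      using f g F L by (simp add: r_def left_diff_distrib L2_mult_integrable)
    then have "\<bar>r\<bar> \<le> L2_norm (\<lambda>x. f x - F x) * L2_norm (deriv \<psi>) + L2_norm (\<lambda>x. g x - \<phi> x) * L2_norm \<psi>"
      using L2_Cauchy_Schwarz[OF L2_diff[OF f F(1)] L(2)] L2_Cauchy_Schwarz[OF L2_diff[OF g F(2)] L(1)] by linarith
    also have "\<dots> \<le> e / C * L2_norm (deriv \<psi>) + e / C * L2_norm \<psi>"
      using F by (intro add_mono mult_right_mono) auto
    also have "\<dots> = e / C * (L2_norm (deriv \<psi>) + L2_norm \<psi>)" by (simp add: distrib_left)
    also have "\<dots> \<le> e / C * C" using e C by (intro mult_left_mono) (auto simp: C_def)
    also have "\<dots> = e" using C by simp
    finally show ?thesis by simp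
  qed
  then have "\<bar>r\<bar> \<le> 0" by (rule field_le_epsilon)
  then show "(\<integral>x. f x * deriv \<psi> x \<partial>circ) = - (\<integral>x. g x * \<psi> x \<partial>circ)" by (simp add: r_def)
qed

lemma weak_deriv_mult_C1:
  assumes f: "f \<in> L2" and g: "g \<in> L2" and w: "has_weak_deriv f g"
    and b: "periodic b" "\<And>x. (b has_real_derivative b' x) (at x)" "continuous_on UNIV b'"
  shows "has_weak_deriv (\<lambda>x. b x * f x) (\<lambda>x. b' x * f x + b x * g x)"
proof -
  have bc: "continuous_on UNIV b" by (rule DERIV_continuous_UNIV[OF b(2)])
  have bp: "periodic b'" by (rule periodic_deriv[OF b(1,2)])
  obtain B where B: "0 \<le> B" "\<And>x. x \<in> {0..1} \<Longrightarrow> \<bar>b x\<bar> \<le> B" using continuous_bounded_Icc[OF bc] by metis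
  obtain B' where B': "0 \<le> B'" "\<And>x. x \<in> {0..1} \<Longrightarrow> \<bar>b' x\<bar> \<le> B'" using continuous_bounded_Icc[OF b(3)] by metis
  have mb: "h \<in> L2 \<Longrightarrow> (\<lambda>x. b x * h x) \<in> L2" and mb': "h \<in> L2 \<Longrightarrow> (\<lambda>x. b' x * h x) \<in> L2" for h
    using L2_continuous_mult b bc bp by blast+
  show ?thesis
  proof (rule weak_deriv_limit[OF mb[OF f] L2_add[OF mb'[OF f] mb[OF g]]])
    fix e :: real assume e: "0 < e"
    define d where "d = e / (B + B' + 1)"
    have d: "0 < d" using e B B' by (simp add: d_def)
    obtain F \<phi> where F: "smooth_periodic F" "smooth_periodic \<phi>" "\<And>x. (F has_real_derivative \<phi> x) (at x)"
       "L2_norm (\<lambda>x. g x - \<phi> x) < d" "L2_norm (\<lambda>x. f x - F x) < d"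
      using weak_deriv_approx[OF f g w d] by metis
    note FL = smooth_periodic_L2[OF F(1)] smooth_periodic_L2[OF F(2)]
    note dL = L2_diff[OF f FL(1)] L2_diff[OF g FL(2)]
    have dd: "(B + B') * d < e"
    proof -
      have "(B + B') * d < (B + B' + 1) * d" using d by simp
      also have "\<dots> = e" using B B' by (simp add: d_def)
      finally show ?thesis .
    qed
    have w1: "has_weak_deriv (\<lambda>x. b x * F x) (\<lambda>x. b' x * F x + b x * \<phi> x)"
    proof (rule weak_deriv_C1)
      show "((\<lambda>x. b x * F x) has_real_derivative b' x * F x + b x * \<phi> x) (at x)" for x
        using DERIV_mult[OF b(2) F(3), of x] by (simp add: mult.commute)
      show "periodic (\<lambda>x. b x * F x)" using b(1) smooth_periodicD(1)[OF F(1)] by (simp add: periodic_def)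
    qed (intro continuous_intros bc b smooth_periodicD(3) F)
    have w2: "L2_norm (\<lambda>x. b x * f x - b x * F x) < e"
    proof -
      have "L2_norm (\<lambda>x. b x * (f x - F x)) \<le> B * L2_norm (\<lambda>x. f x - F x)"
        by (rule L2_norm_bounded_mult[OF dL(1) mb[OF dL(1)] B(2,1)])
      also have "\<dots> \<le> (B + B') * d" using B B' F by (intro mult_mono) auto
      finally show ?thesis using dd by (simp add: right_diff_distrib)
    qed
    have w3: "L2_norm (\<lambda>x. (b' x * f x + b x * g x) - (b' x * F x + b x * \<phi> x)) < e"
    proof -
      have "L2_norm (\<lambda>x. b' x * (f x - F x) + b x * (g x - \<phi> x)) \<le>
          L2_norm (\<lambda>x. b' x * (f x - F x)) + L2_norm (\<lambda>x. b x * (g x - \<phi> x))"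
        by (rule L2_norm_triangle[OF mb'[OF dL(1)] mb[OF dL(2)]])
      also have "\<dots> \<le> B' * L2_norm (\<lambda>x. f x - F x) + B * L2_norm (\<lambda>x. g x - \<phi> x)"
        by (intro add_mono L2_norm_bounded_mult[OF dL(1) mb'[OF dL(1)] B'(2,1)] L2_norm_bounded_mult[OF dL(2) mb[OF dL(2)] B(2,1)])
      also have "\<dots> \<le> B' * d + B * d" using B B' F by (intro add_mono mult_left_mono) auto
      finally show ?thesis using dd by (simp add: algebra_simps)
    qed
    show "\<exists>F \<phi>. F \<in> L2 \<and> \<phi> \<in> L2 \<and> has_weak_deriv F \<phi> \<and>
        L2_norm (\<lambda>x. b x * f x - F x) < e \<and> L2_norm (\<lambda>x. b' x * f x + b x * g x - \<phi> x) < e"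
      using w1 w2 w3 mb[OF FL(1)] L2_add[OF mb'[OF FL(1)] mb[OF FL(2)]]
      by (intro exI[of _ "\<lambda>x. b x * F x"] exI[of _ "\<lambda>x. b' x * F x + b x * \<phi> x"] conjI)
  qed
qed

text \<open>
  The weak derivative of the product \<open>b * f\<close> has mean zero. Hence functions that are only continuously differentiable
  can serve as test functions.
\<close>

lemma weak_deriv_test_C1:
  assumes f: "f \<in> L2" and g: "g \<in> L2" and w: "has_weak_deriv f g"
    and b: "periodic b" "\<And>x. (b has_real_derivative b' x) (at x)" "continuous_on UNIV b'"
  shows "(\<integral>x. b' x * f x \<partial>circ) = - (\<integral>x. b x * g x \<partial>circ)"
proof -
  have "(\<integral>x. b' x * f x + b x * g x \<partial>circ) = 0"
    by (rule weak_deriv_mean[OF weak_deriv_mult_C1[OF assms]])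
  moreover have "integrable circ (\<lambda>x. b' x * f x)" "integrable circ (\<lambda>x. b x * g x)"
    using b periodic_deriv[OF b(1,2)] DERIV_continuous_UNIV[OF b(2)] f g
    by (auto intro!: L2_mult_integrable L2_continuous)
  ultimately show ?thesis by simp
qed

lemma weak_deriv_zero_imp_const:
  assumes "h \<in> L2" "has_weak_deriv h k" "k \<in> L2" "AE x in circ. k x = 0"
  shows "AE x in lebesgue. h x = mean h"
proof -
  have w: "has_weak_deriv h (\<lambda>x. 0)"
    using assms by (intro weak_deriv_cong_AE[OF assms(2,1,3,1)]) auto
  have L: "(\<lambda>x. h x - mean h) \<in> L2" by (intro L2_diff assms L2_const)
  have "L2_norm (\<lambda>x. h x - mean h) \<le> L2_norm (\<lambda>x. 0 - 0)"
  proof (rule weak_Poincare[OF L])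
    show "has_weak_deriv (\<lambda>x. h x - mean h) (\<lambda>x. 0 - 0)"
      by (rule weak_deriv_diff[OF w weak_deriv_const assms(1) L2_const L2_const L2_const])
    show "mean (\<lambda>x. h x - mean h) = 0" using L2_integrable[OF assms(1)] by (simp add: mean_circ)
  qed simp
  then have "L2_norm (\<lambda>x. h x - mean h) = 0" using L2_norm_nonneg[of "\<lambda>x. h x - mean h"] by simp
  from L2_norm_eq_0[OF L this] show ?thesis
    by (intro AE_circ_imp_lebesgue L2_periodic assms L2_const) auto
qed

text \<open>
  The smooth approximations of \<open>f\<close> form a Cauchy sequence for uniform convergence, because the supremum of their
  differences is controlled by the derivatives, which converge in \<open>L2\<close>.
\<close>

lemma continuous_representative:
  assumes f: "f \<in> L2" and g: "g \<in> L2" and w: "has_weak_deriv f g"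
  obtains h where "periodic h" "continuous_on UNIV h" "AE x in lebesgue. f x = h x"
    "\<And>x. \<bar>h x - mean f\<bar> \<le> L2_norm g / sqrt 12"
proof -
  define P where "P n p \<longleftrightarrow> smooth_periodic (fst p) \<and> smooth_periodic (snd p) \<and>
      (\<forall>x. (fst p has_real_derivative snd p x) (at x)) \<and> mean (fst p) = mean f \<and>
      L2_norm (\<lambda>x. g x - snd p x) < 1 / Suc n \<and> L2_norm (\<lambda>x. f x - fst p x) < 1 / Suc n"
    for n :: nat and p :: "(real \<Rightarrow> real) \<times> (real \<Rightarrow> real)"
  have "\<exists>p. P n p" for n
  proof -
    have "0 < 1 / real (Suc n)" by simp
    from weak_deriv_approx[OF f g w this] obtain F \<phi> where "smooth_periodic F" "smooth_periodic \<phi>"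
      "\<forall>x. (F has_real_derivative \<phi> x) (at x)" "mean F = mean f"
      "L2_norm (\<lambda>x. g x - \<phi> x) < 1 / Suc n" "L2_norm (\<lambda>x. f x - F x) < 1 / Suc n" .
    then have "P n (F, \<phi>)" by (simp add: P_def)
    then show ?thesis ..
  qed
  then obtain p where p: "\<And>n. P n (p n)" using choice[of P] by blast
  define F \<phi> where "F n = fst (p n)" and "\<phi> n = snd (p n)" for n
  have F: "smooth_periodic (F n)" "smooth_periodic (\<phi> n)"
    "(F n has_real_derivative \<phi> n x) (at x)" "mean (F n) = mean f"
    "L2_norm (\<lambda>x. g x - \<phi> n x) < 1 / Suc n" "L2_norm (\<lambda>x. f x - F n x) < 1 / Suc n" for n x
    using p[of n] by (auto simp: P_def F_def \<phi>_def)
  note FL = smooth_periodic_L2[OF F(1)] smooth_periodic_L2[OF F(2)]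
  have s12: "L2_norm u / sqrt 12 \<le> L2_norm u" for u
  proof -
    have "(1::real) \<le> sqrt 12" by simp
    then have "L2_norm u / sqrt 12 \<le> L2_norm u / 1" by (intro divide_left_mono) auto
    then show ?thesis by simp
  qed
  have cauchy: "\<bar>F n x - F m x\<bar> \<le> 1 / Suc n + 1 / Suc m" for n m x
  proof -
    have "mean (\<lambda>x. F n x - F m x) = 0"
      using F(4) L2_integrable[OF FL(1)[of n]] L2_integrable[OF FL(1)[of m]] by (simp add: mean_circ)
    moreover have "\<bar>(F n x - F m x) - mean (\<lambda>x. F n x - F m x)\<bar> \<le> L2_norm (\<lambda>x. \<phi> n x - \<phi> m x) / sqrt 12"
      by (rule periodic_sup_mean)
        (use smooth_periodicD(1)[OF F(1)] smooth_periodicD(3)[OF F(2)] F(3) in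
          \<open>auto simp: periodic_def intro!: DERIV_diff continuous_on_diff\<close>)
    ultimately have "\<bar>F n x - F m x\<bar> \<le> L2_norm (\<lambda>x. \<phi> n x - \<phi> m x) / sqrt 12" by simp
    also have "\<dots> \<le> L2_norm (\<lambda>x. \<phi> n x - \<phi> m x)" by (rule s12)
    also have "\<dots> \<le> 1 / Suc n + 1 / Suc m"
      using L2_norm_diff_triangle[OF FL(2) g FL(2), of n m] F(5)[of m] F(5)[of n]
        L2_norm_minus_commute[of g "\<phi> n"] by linarith
    finally show ?thesis .
  qed
  have inv0: "(\<lambda>n. 1 / real (Suc n)) \<longlonglongrightarrow> 0" by (rule LIMSEQ_Suc[OF lim_inverse_n'])
  have "Cauchy (\<lambda>n. F n x)" for x
  proof (rule CauchyI)
    fix e :: real assume "0 < e"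
    then have "\<forall>\<^sub>F n in sequentially. 1 / real (Suc n) < e / 2"
      using inv0 by (intro order_tendstoD(2)) auto
    then obtain M where M: "\<And>n. n \<ge> M \<Longrightarrow> 1 / real (Suc n) < e / 2" by (auto simp: eventually_sequentially)
    have "norm (F m x - F n x) < e" if "m \<ge> M" "n \<ge> M" for m n
      using cauchy[of m x n] M[OF that(1)] M[OF that(2)] unfolding real_norm_def by linarith
    then show "\<exists>M. \<forall>m\<ge>M. \<forall>n\<ge>M. norm (F m x - F n x) < e" by blast
  qed
  then have conv: "convergent (\<lambda>n. F n x)" for x by (rule real_Cauchy_convergent)
  define h where "h x = lim (\<lambda>n. F n x)" for x
  have h: "(\<lambda>n. F n x) \<longlonglongrightarrow> h x" for x
    unfolding h_def using conv by (simp add: convergent_LIMSEQ_iff)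
  have unif: "\<bar>F n x - h x\<bar> \<le> 1 / Suc n" for n x
  proof (rule LIMSEQ_le)
    show "(\<lambda>m. \<bar>F n x - F m x\<bar>) \<longlonglongrightarrow> \<bar>F n x - h x\<bar>" by (intro tendsto_intros h)
    show "(\<lambda>m. 1 / real (Suc n) + 1 / real (Suc m)) \<longlonglongrightarrow> 1 / Suc n"
      using tendsto_add[OF tendsto_const inv0] by simp
    show "\<exists>N. \<forall>m\<ge>N. \<bar>F n x - F m x\<bar> \<le> 1 / real (Suc n) + 1 / real (Suc m)" using cauchy by blast
  qed
  have ul: "uniform_limit UNIV F h sequentially"
  proof (rule uniform_limitI)
    fix e :: real assume "0 < e"
    then have "\<forall>\<^sub>F n in sequentially. 1 / real (Suc n) < e" using inv0 by (intro order_tendstoD(2)) auto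
    then show "\<forall>\<^sub>F n in sequentially. \<forall>x\<in>UNIV. dist (F n x) (h x) < e"
    proof eventually_elim
      case (elim n)
      then show ?case using unif[of n] by (auto simp: dist_real_def intro: le_less_trans)
    qed
  qed
  have hc: "continuous_on UNIV h"
    by (rule uniform_limit_theorem[OF _ ul]) (use smooth_periodicD(3)[OF F(1)] in auto)
  have hp: "periodic h"
    unfolding periodic_def
  proof
    fix x
    have "(\<lambda>n. F n (x + 1)) = (\<lambda>n. F n x)" using smooth_periodicD(1)[OF F(1)] by (simp add: periodic_def)
    then show "h (x + 1) = h x" using h[of "x + 1"] h[of x] LIMSEQ_unique by auto
  qed
  have hL: "h \<in> L2" by (rule L2_continuous[OF hp hc])
  have "L2_norm (\<lambda>x. f x - h x) \<le> 0 + e" if e: "0 < e" for e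
  proof -
    have "\<forall>\<^sub>F n in sequentially. 1 / real (Suc n) < e / 2"
      using inv0 e by (intro order_tendstoD(2)) auto
    then obtain n where n: "1 / real (Suc n) < e / 2" by (auto simp: eventually_sequentially)
    have "L2_norm (\<lambda>x. F n x - h x) \<le> 1 / Suc n"
      using unif[of n] by (intro L2_norm_le_bound L2_diff FL hL) auto
    then show ?thesis using L2_norm_diff_triangle[OF f FL(1)[of n] hL] F(6)[of n] n by linarith
  qed
  then have "L2_norm (\<lambda>x. f x - h x) \<le> 0" by (rule field_le_epsilon)
  then have "L2_norm (\<lambda>x. f x - h x) = 0" using L2_norm_nonneg by (rule antisym)
  from L2_norm_eq_0[OF L2_diff[OF f hL] this] have "AE x in lebesgue. f x = h x"
    by (intro AE_circ_imp_lebesgue L2_periodic f hL) auto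
  moreover have "\<bar>h x - mean f\<bar> \<le> L2_norm g / sqrt 12" for x
  proof (rule LIMSEQ_le)
    show "(\<lambda>n. \<bar>F n x - mean f\<bar>) \<longlonglongrightarrow> \<bar>h x - mean f\<bar>" by (intro tendsto_intros h)
    have "(\<lambda>n. (L2_norm g + 1 / real (Suc n)) / sqrt 12) \<longlonglongrightarrow> (L2_norm g + 0) / sqrt 12"
      by (intro tendsto_intros inv0) auto
    then show "(\<lambda>n. (L2_norm g + 1 / real (Suc n)) / sqrt 12) \<longlonglongrightarrow> L2_norm g / sqrt 12" by simp
    have "\<bar>F n x - mean f\<bar> \<le> (L2_norm g + 1 / real (Suc n)) / sqrt 12" for n
    proof -
      have "\<bar>F n x - mean f\<bar> \<le> L2_norm (\<phi> n) / sqrt 12"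
        using periodic_sup_mean[OF smooth_periodicD(1)[OF F(1)] F(3) smooth_periodicD(3)[OF F(2)], of n x] F(4) by simp
      also have "\<dots> \<le> (L2_norm g + 1 / real (Suc n)) / sqrt 12"
        using L2_norm_diff_ge[OF FL(2) g, of n] F(5)[of n] L2_norm_minus_commute[of g "\<phi> n"]
        by (intro divide_right_mono) auto
      finally show ?thesis .
    qed
    then show "\<exists>N. \<forall>n\<ge>N. \<bar>F n x - mean f\<bar> \<le> (L2_norm g + 1 / real (Suc n)) / sqrt 12" by blast
  qed
  ultimately show thesis using that hp hc by blast
qed

section \<open>Sobolev spaces and the operator A\<close>

lemma L2_cong_AE:
  assumes "g \<in> L2" "periodic f" "f \<in> borel_measurable lebesgue" "AE x in lebesgue. f x = g x"
  shows "f \<in> L2"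
proof -
  have [measurable]: "f \<in> borel_measurable circ" using assms(3) by (rule measurable_restrict_space1)
  have "integrable circ (\<lambda>x. (f x)\<^sup>2)"
  proof (rule integrable_cong_AE_imp[OF L2_square_integrable[OF assms(1)]])
    show "AE x in circ. (g x)\<^sup>2 = (f x)\<^sup>2" using AE_lebesgue_imp_circ[OF assms(4)] by (auto elim: eventually_mono)
  qed measurable
  then show ?thesis using assms by (simp add: L2_circ)
qed

lemma mean_cong_AE:
  assumes "f \<in> L2" "g \<in> L2" "AE x in lebesgue. f x = g x"
  shows "mean f = mean g"
  unfolding mean_circ
  by (intro integral_cong_AE AE_lebesgue_imp_circ[OF assms(3)] L2_measurable_circ assms)

lemma sobolev_L2: "f \<in> sobolev k \<Longrightarrow> f \<in> L2"
  by (cases k) auto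

lemma sobolev_cong_AE:
  assumes "f \<in> sobolev k" "g \<in> L2" "AE x in lebesgue. f x = g x"
  shows "g \<in> sobolev k"
proof (cases k)
  case 0
  then show ?thesis using assms by simp
next
  case (Suc m)
  then obtain h where h: "h \<in> sobolev m" "has_weak_deriv f h" using assms(1) by auto
  have "has_weak_deriv g h"
    using AE_lebesgue_imp_circ[OF assms(3)]
    by (intro weak_deriv_cong_AE[OF h(2) sobolev_L2[OF assms(1)] sobolev_L2[OF h(1)] assms(2) sobolev_L2[OF h(1)]]) auto
  then show ?thesis using Suc h assms(2) by auto
qed

lemma wderiv_L2:
  assumes "g \<in> L2" "has_weak_deriv f g"
  shows "wderiv f \<in> L2" "has_weak_deriv f (wderiv f)" "AE x in lebesgue. wderiv f x = g x"
proof -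
  have "wderiv f \<in> L2 \<and> has_weak_deriv f (wderiv f)"
    unfolding wderiv_def by (rule someI[of _ g]) (use assms in simp)
  then show "wderiv f \<in> L2" and w: "has_weak_deriv f (wderiv f)" by auto
  then show "AE x in lebesgue. wderiv f x = g x" by (intro weak_deriv_unique[OF w assms(2) _ assms(1)])
qed

lemma sobolev_wderiv:
  assumes "f \<in> sobolev (Suc k)"
  shows "wderiv f \<in> sobolev k" "has_weak_deriv f (wderiv f)"
proof -
  obtain h where h: "h \<in> sobolev k" "has_weak_deriv f h" using assms by auto
  note w = wderiv_L2[OF sobolev_L2[OF h(1)] h(2)]
  show "has_weak_deriv f (wderiv f)" by (rule w)
  show "wderiv f \<in> sobolev k"
    using w(3) by (intro sobolev_cong_AE[OF h(1) w(1)]) (auto elim: eventually_mono)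
qed

text \<open>
  A function with its successive weak derivatives. In contrast to iterates of \<open>wderiv\<close> the derivatives are given, so
  that they can be classical ones.
\<close>

definition deriv_chain :: "nat \<Rightarrow> (nat \<Rightarrow> real \<Rightarrow> real) \<Rightarrow> bool" where
  "deriv_chain k D \<longleftrightarrow> (\<forall>j\<le>k. D j \<in> L2) \<and> (\<forall>j<k. has_weak_deriv (D j) (D (Suc j)))"

lemma deriv_chain_sobolev: "deriv_chain k D \<Longrightarrow> D 0 \<in> sobolev k"
proof (induction k arbitrary: D)
  case 0
  then show ?case by (simp add: deriv_chain_def)
next
  case (Suc k)
  then have "deriv_chain k (\<lambda>j. D (Suc j))" by (auto simp: deriv_chain_def)
  from Suc.IH[OF this] show ?case using Suc.prems by (auto simp: deriv_chain_def)
qed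

lemma deriv_chain_wderiv:
  assumes D: "deriv_chain k D" and f: "f \<in> L2" "AE x in lebesgue. f x = D 0 x" and "j \<le> k"
  shows "(wderiv ^^ j) f \<in> L2 \<and> (AE x in lebesgue. (wderiv ^^ j) f x = D j x)"
  using \<open>j \<le> k\<close>
proof (induction j)
  case 0
  then show ?case using f by simp
next
  case (Suc j)
  define g where "g = (wderiv ^^ j) f"
  have g: "g \<in> L2" "AE x in lebesgue. g x = D j x" using Suc by (auto simp: g_def)
  have L: "D j \<in> L2" "D (Suc j) \<in> L2" "has_weak_deriv (D j) (D (Suc j))"
    using D Suc.prems by (auto simp: deriv_chain_def)
  have "has_weak_deriv g (D (Suc j))"
    using AE_lebesgue_imp_circ[OF g(2)]
    by (intro weak_deriv_cong_AE[OF L(3,1,2) g(1) L(2)]) (auto elim: eventually_mono)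
  from wderiv_L2[OF L(2) this] show ?case by (simp add: g_def)
qed

lemma sobolev_deriv_chain: "f \<in> sobolev k \<Longrightarrow> deriv_chain k (\<lambda>j. (wderiv ^^ j) f)"
proof (induction k arbitrary: f)
  case 0
  then show ?case by (simp add: deriv_chain_def)
next
  case (Suc k)
  have IH: "deriv_chain k (\<lambda>j. (wderiv ^^ j) (wderiv f))" by (rule Suc.IH[OF sobolev_wderiv(1)[OF Suc.prems]])
  have shift: "(wderiv ^^ Suc j) f = (wderiv ^^ j) (wderiv f)" for j by (simp add: funpow_swap1)
  show ?case unfolding deriv_chain_def
  proof (intro conjI allI impI)
    fix j assume "j \<le> Suc k"
    then show "(wderiv ^^ j) f \<in> L2"
      using IH sobolev_L2[OF Suc.prems] by (cases j) (auto simp only: shift deriv_chain_def Suc_le_mono funpow_0)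
  next
    fix j assume "j < Suc k"
    then show "has_weak_deriv ((wderiv ^^ j) f) ((wderiv ^^ Suc j) f)"
      using IH sobolev_wderiv(2)[OF Suc.prems]
      by (cases j) (auto simp only: shift deriv_chain_def Suc_less_eq funpow_0)
  qed
qed

lemma deriv_chain_lincomb:
  assumes "deriv_chain k D" "deriv_chain k E"
  shows "deriv_chain k (\<lambda>j x. a * D j x + b * E j x)"
  using assms unfolding deriv_chain_def
  by (auto intro!: L2_add L2_cmult weak_deriv_lincomb)

lemma deriv_chain_diff:
  assumes "deriv_chain k D" "deriv_chain k E"
  shows "deriv_chain k (\<lambda>j x. D j x - E j x)"
  using deriv_chain_lincomb[OF assms, of 1 "-1"] by simp

lemma deriv_chain_norm_eq:
  assumes "deriv_chain k D" "f \<in> L2" "AE x in lebesgue. f x = D 0 x" "j \<le> k"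
  shows "L2_norm ((wderiv ^^ j) f) = L2_norm (D j)"
  using deriv_chain_wderiv[OF assms] assms(1,4)
  by (intro L2_norm_cong_AE AE_lebesgue_imp_circ) (auto simp: deriv_chain_def)

lemma L2_norm_le_sobolev_norm:
  assumes "j \<le> k"
  shows "L2_norm ((wderiv ^^ j) f) \<le> sobolev_norm k f"
  unfolding sobolev_norm_def
  by (rule real_le_rsqrt) (use assms in \<open>auto intro!: member_le_sum[of j "{..k}" "\<lambda>j. (L2_norm ((wderiv ^^ j) f))\<^sup>2"]\<close>)

text \<open>
  Derivatives of positive order have mean zero, so Poincare's inequality bounds each one by the next.
\<close>

lemma sobolev_norm_le:
  assumes D: "deriv_chain k D" and f: "f \<in> L2" "AE x in lebesgue. f x = D 0 x"
  shows "sobolev_norm k f \<le> (real k + 1) * (\<bar>mean (D 0)\<bar> + L2_norm (D k))"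
proof -
  have top: "L2_norm (D j) \<le> L2_norm (D k)" if "1 \<le> j" "j \<le> k" for j
    using that(2,1)
  proof (induction rule: inc_induct)
    case (step n)
    obtain m where m: "n = Suc m" using step by (cases n) auto
    have c: "D n \<in> L2" "D (Suc n) \<in> L2" "has_weak_deriv (D n) (D (Suc n))" "has_weak_deriv (D m) (D n)"
      using D step m by (auto simp: deriv_chain_def)
    have "mean (D n) = 0" using weak_deriv_mean[OF c(4)] by (simp add: mean_circ)
    then have "L2_norm (D n) \<le> L2_norm (D (Suc n))"
      using L2_norm_le_mean_deriv[OF c(1-3)] by simp
    then show ?case using step by simp
  qed simp
  have all: "L2_norm (D j) \<le> \<bar>mean (D 0)\<bar> + L2_norm (D k)" if "j \<le> k" for j
  proof (cases "j = 0")
    case True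
    show ?thesis
    proof (cases "k = 0")
      case False
      then have "L2_norm (D 0) \<le> \<bar>mean (D 0)\<bar> + L2_norm (D 1)"
        using D by (intro L2_norm_le_mean_deriv) (auto simp: deriv_chain_def)
      then show ?thesis using top[of 1] False True by auto
    qed (use True in auto)
  next
    case False
    then show ?thesis using top[of j] that by auto
  qed
  have "sobolev_norm k f = sqrt (\<Sum>j\<le>k. (L2_norm (D j))\<^sup>2)"
    unfolding sobolev_norm_def using deriv_chain_norm_eq[OF D f] by (auto intro!: sum.cong)
  also have "\<dots> \<le> (\<Sum>j\<le>k. L2_norm (D j))"
    using L2_set_le_sum[of "{..k}" "\<lambda>j. L2_norm (D j)"] by (simp add: L2_set_def)
  also have "\<dots> \<le> (\<Sum>j\<le>k. \<bar>mean (D 0)\<bar> + L2_norm (D k))"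
    by (intro sum_mono all) auto
  also have "\<dots> = (real k + 1) * (\<bar>mean (D 0)\<bar> + L2_norm (D k))" by simp
  finally show ?thesis .
qed

lemma continuous_weak_deriv_imp_C1:
  assumes f: "f \<in> L2" "g \<in> L2" "has_weak_deriv f g"
    and g0: "periodic g0" "continuous_on UNIV g0" "AE x in lebesgue. g x = g0 x"
  obtains f0 where "periodic f0" "\<forall>x. (f0 has_real_derivative g0 x) (at x)" "AE x in lebesgue. f x = f0 x"
proof -
  have g0L: "g0 \<in> L2" by (rule L2_continuous[OF g0(1,2)])
  have w: "has_weak_deriv f g0"
    by (rule weak_deriv_cong_AE[OF f(3,1,2,1) g0L]) (use AE_lebesgue_imp_circ[OF g0(3)] in auto)
  obtain f0 where f0: "\<And>x. (f0 has_real_derivative g0 x) (at x)" "periodic f0" "mean f0 = mean f"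
    using ex_periodic_primitive_mean[OF g0(1,2) weak_deriv_mean[OF w]] by blast
  have f0L: "f0 \<in> L2" by (rule L2_continuous[OF f0(2) DERIV_continuous_UNIV[OF f0(1)]])
  have "AE x in lebesgue. f x - f0 x = mean (\<lambda>x. f x - f0 x)"
    by (rule weak_deriv_zero_imp_const[OF L2_diff[OF f(1) f0L]
        weak_deriv_diff[OF w weak_deriv_C1[OF f0(2,1) g0(2)] f(1) g0L f0L g0L] L2_diff[OF g0L g0L]]) simp
  moreover have "mean (\<lambda>x. f x - f0 x) = 0"
    using f0(3) L2_integrable[OF f(1)] L2_integrable[OF f0L] by (simp add: mean_circ)
  ultimately have "AE x in lebesgue. f x = f0 x" by simp
  then show thesis using that f0 by blast
qed

text \<open>
  The second weak derivative has a continuous representative; integrating it twice gives representatives of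
  the first derivative and of the function.
\<close>

lemma sobolev3_classical:
  assumes f: "f \<in> sobolev 3"
  obtains f0 f1 f2 where "periodic f0" "periodic f1" "periodic f2"
    "\<forall>x. (f0 has_real_derivative f1 x) (at x)" "\<forall>x. (f1 has_real_derivative f2 x) (at x)" "continuous_on UNIV f2"
    "AE x in lebesgue. f x = f0 x" "AE x in lebesgue. wderiv f x = f1 x"
    "has_weak_deriv f2 ((wderiv ^^ 3) f)" "(wderiv ^^ 3) f \<in> L2"
    "\<forall>x. \<bar>f1 x\<bar> \<le> L2_norm ((wderiv ^^ 3) f) / sqrt 12" "\<forall>x. \<bar>f2 x\<bar> \<le> L2_norm ((wderiv ^^ 3) f) / sqrt 12"
proof -
  have ch: "deriv_chain 3 (\<lambda>j. (wderiv ^^ j) f)" by (rule sobolev_deriv_chain[OF f])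
  have c: "f \<in> L2" "wderiv f \<in> L2" "(wderiv ^^ 2) f \<in> L2" "(wderiv ^^ 3) f \<in> L2"
    "has_weak_deriv f (wderiv f)" "has_weak_deriv (wderiv f) ((wderiv ^^ 2) f)"
    "has_weak_deriv ((wderiv ^^ 2) f) ((wderiv ^^ 3) f)"
    using ch[unfolded deriv_chain_def, THEN conjunct1, rule_format, of 0]
      ch[unfolded deriv_chain_def, THEN conjunct1, rule_format, of 1]
      ch[unfolded deriv_chain_def, THEN conjunct1, rule_format, of 2]
      ch[unfolded deriv_chain_def, THEN conjunct1, rule_format, of 3]
      ch[unfolded deriv_chain_def, THEN conjunct2, rule_format, of 0]
      ch[unfolded deriv_chain_def, THEN conjunct2, rule_format, of 1]
      ch[unfolded deriv_chain_def, THEN conjunct2, rule_format, of 2]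
    by (simp_all add: numeral_2_eq_2 numeral_3_eq_3)
  have m2: "mean ((wderiv ^^ 2) f) = 0" using weak_deriv_mean[OF c(6)] by (simp add: mean_circ)
  obtain f2 where f2: "periodic f2" "continuous_on UNIV f2" "AE x in lebesgue. (wderiv ^^ 2) f x = f2 x"
    "\<And>x. \<bar>f2 x - mean ((wderiv ^^ 2) f)\<bar> \<le> L2_norm ((wderiv ^^ 3) f) / sqrt 12"
    using continuous_representative[OF c(3,4,7)] by blast
  obtain f1 where f1: "periodic f1" "\<forall>x. (f1 has_real_derivative f2 x) (at x)" "AE x in lebesgue. wderiv f x = f1 x"
    using continuous_weak_deriv_imp_C1[OF c(2,3,6) f2(1-3)] .
  have f1c: "continuous_on UNIV f1" using f1(2) by (intro DERIV_continuous_UNIV) auto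
  obtain f0 where f0: "periodic f0" "\<forall>x. (f0 has_real_derivative f1 x) (at x)" "AE x in lebesgue. f x = f0 x"
    using continuous_weak_deriv_imp_C1[OF c(1,2,5) f1(1) f1c f1(3)] .
  have f2L: "f2 \<in> L2" by (rule L2_continuous[OF f2(1,2)])
  have w: "has_weak_deriv f2 ((wderiv ^^ 3) f)"
    by (rule weak_deriv_cong_AE[OF c(7,3,4) f2L c(4)]) (use AE_lebesgue_imp_circ[OF f2(3)] in auto)
  have b2: "\<bar>f2 x\<bar> \<le> L2_norm ((wderiv ^^ 3) f) / sqrt 12" for x using f2(4)[of x] m2 by simp
  have "mean f1 = 0" using weak_deriv_mean[OF weak_deriv_C1[OF f0(1) _ f1c]] f0(2) by (simp add: mean_circ)
  then have "\<bar>f1 x\<bar> \<le> L2_norm f2 / sqrt 12" for x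
    using periodic_sup_mean[OF f1(1) _ f2(2), of x] f1(2) by simp
  moreover have "L2_norm f2 / sqrt 12 \<le> L2_norm ((wderiv ^^ 3) f) / sqrt 12"
  proof (rule divide_right_mono)
    have "mean f2 = 0" using weak_deriv_mean[OF weak_deriv_C1[OF f1(1) _ f2(2)]] f1(2) by (simp add: mean_circ)
    then show "L2_norm f2 \<le> L2_norm ((wderiv ^^ 3) f)" using L2_norm_le_mean_deriv[OF f2L c(4) w] by simp
  qed simp
  ultimately have b1: "\<bar>f1 x\<bar> \<le> L2_norm ((wderiv ^^ 3) f) / sqrt 12" for x using order_trans by blast
  show thesis
    using that[OF f0(1) f1(1) f2(1) f0(2) f1(2) f2(2) f0(3) f1(3) w c(4)] b1 b2 by blast
qed

text \<open>
  If \<open>A w = f\<close>, then integration over the period shows that \<open>w\<close> and \<open>f\<close> have the same mean, so the second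
  derivative of \<open>w\<close> is \<open>mean f - f\<close>. Both sides of the claim are then primitives of \<open>f - mean f\<close> with mean zero. The chosen value
  of \<open>A_inv\<close> is a genuine solution because one can be written down by integrating \<open>- \<Phi>\<close>.
\<close>

lemma wderiv_A_inv:
  assumes f: "periodic f" "f \<in> borel_measurable lebesgue" "AE x in lebesgue. f x = f0 x"
    and f0: "periodic f0" "continuous_on UNIV f0"
    and \<Phi>: "periodic \<Phi>" "\<And>x. (\<Phi> has_real_derivative f0 x - mean f0) (at x)" "mean \<Phi> = 0"
  shows "AE x in lebesgue. - wderiv (A_inv f) x = \<Phi> x"
proof -
  have f0L: "f0 \<in> L2" by (rule L2_continuous[OF f0])
  have fL: "f \<in> L2" by (rule L2_cong_AE[OF f0L f])
  have \<Phi>c: "continuous_on UNIV \<Phi>" by (rule DERIV_continuous_UNIV[OF \<Phi>(2)])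
  have \<Phi>L: "\<Phi> \<in> L2" by (rule L2_continuous[OF \<Phi>(1) \<Phi>c])
  have gL: "(\<lambda>x. f0 x - mean f0) \<in> L2" by (rule L2_diff[OF f0L L2_const])
  have w\<Phi>: "has_weak_deriv \<Phi> (\<lambda>x. f0 x - mean f0)"
    by (rule weak_deriv_C1[OF \<Phi>(1,2)]) (intro continuous_intros f0)
  obtain W where W: "\<And>x. (W has_real_derivative - \<Phi> x) (at x)" "periodic W" "mean W = mean f0"
  proof (rule ex_periodic_primitive_mean[of "\<lambda>x. - \<Phi> x"])
    show "integral\<^sup>L circ (\<lambda>x. - \<Phi> x) = 0" using \<Phi>(3) by (simp add: mean_circ)
    show "periodic (\<lambda>x. - \<Phi> x)" using \<Phi>(1) by (simp add: periodic_def)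
  qed (intro continuous_intros \<Phi>c | blast)+
  have WL: "W \<in> L2" by (rule L2_continuous[OF W(2) DERIV_continuous_UNIV[OF W(1)]])
  define D where "D j = (if j = 0 then W else if j = 1 then (\<lambda>x. - \<Phi> x) else (\<lambda>x. mean f0 - f0 x))" for j :: nat
  have D: "deriv_chain 2 D"
  proof -
    have "has_weak_deriv W (\<lambda>x. - \<Phi> x)" by (rule weak_deriv_C1[OF W(2,1)]) (intro continuous_intros \<Phi>c)
    moreover have "has_weak_deriv (\<lambda>x. - \<Phi> x) (\<lambda>x. mean f0 - f0 x)"
      using weak_deriv_cmult[OF w\<Phi> \<Phi>L gL, of "-1"] by simp
    ultimately show ?thesis
      using WL L2_uminus[OF \<Phi>L] L2_diff[OF L2_const f0L]
      by (auto simp: deriv_chain_def D_def less_2_cases_iff)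
  qed
  have W2: "W \<in> sobolev 2" using deriv_chain_sobolev[OF D] by (simp add: D_def)
  have WA: "AE x in lebesgue. A_op W x = f x"
  proof -
    have "AE x in lebesgue. wderiv (wderiv W) x = mean f0 - f0 x"
      using deriv_chain_wderiv[OF D WL, of 2] by (simp add: D_def numeral_2_eq_2)
    then show ?thesis using f(3) by eventually_elim (simp add: A_op_def W(3))
  qed
  define w where "w = A_inv f"
  have w: "w \<in> sobolev 2" "AE x in lebesgue. A_op w x = f x"
    using someI[of "\<lambda>w. w \<in> sobolev 2 \<and> (AE x in lebesgue. A_op w x = f x)" W] W2 WA
    by (auto simp: w_def A_inv_def)
  have w1: "wderiv w \<in> sobolev (Suc 0)" "has_weak_deriv w (wderiv w)"
    using sobolev_wderiv[of w 1] w(1) by (auto simp: numeral_2_eq_2)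
  note w2 = sobolev_wderiv[OF w1(1)]
  have L: "wderiv w \<in> L2" "wderiv (wderiv w) \<in> L2" using w1(1) w2(1) sobolev_L2 by blast+
  have ae: "AE x in lebesgue. wderiv (wderiv w) x = mean w - f0 x"
    using w(2) f(3) by eventually_elim (simp add: A_op_def)
  have "mean (wderiv (wderiv w)) = mean (\<lambda>x. mean w - f0 x)"
    by (rule mean_cong_AE[OF L(2) L2_diff[OF L2_const f0L] ae])
  then have "mean w = mean f0"
    using weak_deriv_mean[OF w2(2)] L2_integrable[OF f0L] by (simp add: mean_circ)
  then have wd: "has_weak_deriv (wderiv w) (\<lambda>x. mean f0 - f0 x)"
    using ae by (intro weak_deriv_cong_AE[OF w2(2) L L(1) L2_diff[OF L2_const f0L]] AE_lebesgue_imp_circ) auto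
  have sL: "(\<lambda>x. wderiv w x + \<Phi> x) \<in> L2" by (rule L2_add[OF L(1) \<Phi>L])
  have "AE x in lebesgue. wderiv w x + \<Phi> x = mean (\<lambda>x. wderiv w x + \<Phi> x)"
    by (rule weak_deriv_zero_imp_const[OF sL weak_deriv_add[OF wd w\<Phi> L(1) L2_diff[OF L2_const f0L] \<Phi>L gL]
         L2_add[OF L2_diff[OF L2_const f0L] gL]]) simp
  moreover have "mean (\<lambda>x. wderiv w x + \<Phi> x) = 0"
    using \<Phi>(3) weak_deriv_mean[OF w1(2)] L2_integrable[OF L(1)] L2_integrable[OF \<Phi>L] by (simp add: mean_circ)
  ultimately show ?thesis by (auto simp: w_def elim!: eventually_mono)
qed

section \<open>Uniqueness by an energy estimate\<close>

text \<open>
  The function \<open>exp (- C * t) * E t\<close> is nonincreasing.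
\<close>

lemma Gronwall_zero:
  fixes E :: "real \<Rightarrow> real"
  assumes "0 < b" and E0: "E 0 = 0" and nonneg: "0 \<le> E b"
    and der: "\<And>t. t \<in> {0..b} \<Longrightarrow> (E has_real_derivative E' t) (at t within {0..b})"
    and le: "\<And>t. t \<in> {0..b} \<Longrightarrow> E' t \<le> C * E t"
  shows "E b = 0"
proof -
  have "exp (- C * b) * E b \<le> exp (- C * 0) * E 0"
  proof (rule DERIV_nonpos_imp_decreasing_open[of 0 b "\<lambda>t. exp (- C * t) * E t"])
    show "\<exists>y. ((\<lambda>t. exp (- C * t) * E t) has_real_derivative y) (at t) \<and> y \<le> 0" if "0 < t" "t < b" for t
    proof -
      have "at t within {0..b} = at t" using that by (intro at_within_interior) auto
      then have d: "(E has_real_derivative E' t) (at t)" using der[of t] that by simp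
      have "((\<lambda>t. exp (- C * t) * E t) has_real_derivative exp (- C * t) * (E' t - C * E t)) (at t)"
        by (rule derivative_eq_intros d refl)+ (simp add: algebra_simps)
      moreover have "exp (- C * t) * (E' t - C * E t) \<le> 0"
        using le[of t] that by (intro mult_nonneg_nonpos) auto
      ultimately show ?thesis by blast
    qed
    have "continuous_on {0..b} E" using der by (rule DERIV_continuous_on)
    then show "continuous_on {0..b} (\<lambda>t. exp (- C * t) * E t)" by (intro continuous_intros)
  qed (use assms in simp)
  then have "exp (- C * b) * E b \<le> 0" using E0 by simp
  then have "E b \<le> 0" by (simp add: mult_le_0_iff)
  then show ?thesis using nonneg by simp
qed

text \<open>
  With \<open>r s\<close> the error of the difference quotient, \<open>h s = h t + (s - t) * (h' + r s)\<close>; expand the square.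
\<close>

lemma L2_norm_square_derivative:
  assumes h: "\<And>s. s \<in> S \<Longrightarrow> h s \<in> L2" and h': "h' \<in> L2" and t: "t \<in> S"
    and lim: "((\<lambda>s. L2_norm (\<lambda>x. (h s x - h t x) / (s - t) - h' x)) \<longlongrightarrow> 0) (at t within S)"
  shows "((\<lambda>s. (L2_norm (h s))\<^sup>2) has_real_derivative 2 * (\<integral>x. h t x * h' x \<partial>circ)) (at t within S)"
proof -
  define r where "r = (\<lambda>s x. (h s x - h t x) / (s - t) - h' x)"
  define N where "N = (\<lambda>s. L2_norm (r s))"
  have N: "(N \<longlongrightarrow> 0) (at t within S)" using lim by (simp add: N_def r_def)
  have bound: "\<bar>((L2_norm (h s))\<^sup>2 - (L2_norm (h t))\<^sup>2) / (s - t) - 2 * (\<integral>x. h t x * h' x \<partial>circ)\<bar>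
      \<le> 2 * (N s * L2_norm (h t)) + \<bar>s - t\<bar> * (L2_norm h' + N s)\<^sup>2" if s: "s \<in> S" "s \<noteq> t" for s
  proof -
    note L = h[OF s(1)] h[OF t] h'
    have rL: "r s \<in> L2"
      unfolding r_def using L2_diff[OF L2_cmult[OF L2_diff[OF L(1,2)], of "1 / (s - t)"] L(3)] by simp
    have qL: "(\<lambda>x. h' x + r s x) \<in> L2" by (rule L2_add[OF h' rL])
    have hs: "h s = (\<lambda>x. h t x + (s - t) * (h' x + r s x))" using s by (auto simp: r_def)
    have "(L2_norm (h s))\<^sup>2 = (\<integral>x. (h t x)\<^sup>2 + (s - t) * (2 * (h t x * h' x) + 2 * (r s x * h t x) + (s - t) * (h' x + r s x)\<^sup>2) \<partial>circ)"
      unfolding L2_norm_square by (subst hs, intro Bochner_Integration.integral_cong)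
         (auto simp: power2_eq_square algebra_simps)
    also have "\<dots> = (L2_norm (h t))\<^sup>2 + (s - t) * (2 * (\<integral>x. h t x * h' x \<partial>circ) + 2 * (\<integral>x. r s x * h t x \<partial>circ)
        + (s - t) * (L2_norm (\<lambda>x. h' x + r s x))\<^sup>2)"
      unfolding L2_norm_square
      using L rL qL by (simp add: L2_mult_integrable L2_square_integrable)
    finally have "((L2_norm (h s))\<^sup>2 - (L2_norm (h t))\<^sup>2) / (s - t) - 2 * (\<integral>x. h t x * h' x \<partial>circ) =
        2 * (\<integral>x. r s x * h t x \<partial>circ) + (s - t) * (L2_norm (\<lambda>x. h' x + r s x))\<^sup>2"
      using s by (simp add: field_simps)
    also have "\<bar>\<dots>\<bar> \<le> 2 * \<bar>\<integral>x. r s x * h t x \<partial>circ\<bar> + \<bar>s - t\<bar> * (L2_norm (\<lambda>x. h' x + r s x))\<^sup>2"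
      by (rule order_trans[OF abs_triangle_ineq]) (simp add: abs_mult)
    also have "\<dots> \<le> 2 * (N s * L2_norm (h t)) + \<bar>s - t\<bar> * (L2_norm h' + N s)\<^sup>2"
      using L2_Cauchy_Schwarz[OF rL L(2)] L2_norm_triangle[OF h' rL]
      by (intro add_mono mult_left_mono power_mono) (auto simp: N_def)
    finally show ?thesis .
  qed
  have "((\<lambda>s. 2 * (N s * L2_norm (h t)) + \<bar>s - t\<bar> * (L2_norm h' + N s)\<^sup>2) \<longlongrightarrow>
      2 * (0 * L2_norm (h t)) + \<bar>t - t\<bar> * (L2_norm h' + 0)\<^sup>2) (at t within S)"
    by (intro tendsto_intros N)
  then have "((\<lambda>s. 2 * (N s * L2_norm (h t)) + \<bar>s - t\<bar> * (L2_norm h' + N s)\<^sup>2) \<longlongrightarrow> 0) (at t within S)"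
    by simp
  moreover have "\<forall>\<^sub>F s in at t within S.
      norm (((L2_norm (h s))\<^sup>2 - (L2_norm (h t))\<^sup>2) / (s - t) - 2 * (\<integral>x. h t x * h' x \<partial>circ))
      \<le> 2 * (N s * L2_norm (h t)) + \<bar>s - t\<bar> * (L2_norm h' + N s)\<^sup>2"
    unfolding eventually_at_filter
  proof (rule always_eventually, intro allI impI)
    fix s assume "s \<noteq> t" "s \<in> S"
    from bound[OF this(2,1)] show "norm (((L2_norm (h s))\<^sup>2 - (L2_norm (h t))\<^sup>2) / (s - t) - 2 * (\<integral>x. h t x * h' x \<partial>circ))
      \<le> 2 * (N s * L2_norm (h t)) + \<bar>s - t\<bar> * (L2_norm h' + N s)\<^sup>2"
      unfolding real_norm_def .
  qed
  ultimately have "((\<lambda>s. ((L2_norm (h s))\<^sup>2 - (L2_norm (h t))\<^sup>2) / (s - t) - 2 * (\<integral>x. h t x * h' x \<partial>circ)) \<longlongrightarrow> 0) (at t within S)"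
    by (rule Lim_null_comparison[rotated])
  then show ?thesis unfolding has_field_derivative_iff by (simp only: LIM_zero_iff)
qed

text \<open>
  By the triangle inequality the norm of the highest derivative is a continuous function of time, and the
  time interval is compact.
\<close>

lemma sobolev_continuous_bounded:
  assumes u: "sobolev_continuous_on k I u" and b: "{0..b} \<subseteq> I"
  obtains M where "0 \<le> M" "\<forall>t\<in>{0..b}. L2_norm ((wderiv ^^ k) (u t)) \<le> M"
proof -
  define N where "N t = L2_norm ((wderiv ^^ k) (u t))" for t
  have "continuous_on {0..b} N"
    unfolding continuous_on_def
  proof
    fix t assume t: "t \<in> {0..b}"
    have lim: "((\<lambda>s. sobolev_norm k (\<lambda>x. u s x - u t x)) \<longlongrightarrow> 0) (at t within {0..b})"
      using u t b unfolding sobolev_continuous_on_def by (meson subsetD tendsto_within_subset)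
    have "\<bar>N s - N t\<bar> \<le> sobolev_norm k (\<lambda>x. u s x - u t x)" if s: "s \<in> {0..b}" for s
    proof -
      have H: "u s \<in> sobolev k" "u t \<in> sobolev k" using u s t b by (auto simp: sobolev_continuous_on_def)
      note c = sobolev_deriv_chain[OF H(1)] sobolev_deriv_chain[OF H(2)]
      have L: "(wderiv ^^ k) (u s) \<in> L2" "(wderiv ^^ k) (u t) \<in> L2" using c by (auto simp: deriv_chain_def)
      have "L2_norm (\<lambda>x. (wderiv ^^ k) (u s) x - (wderiv ^^ k) (u t) x) = L2_norm ((wderiv ^^ k) (\<lambda>x. u s x - u t x))"
        by (rule deriv_chain_norm_eq[OF deriv_chain_diff[OF c], symmetric])
          (auto intro: L2_diff sobolev_L2 H)
      also have "\<dots> \<le> sobolev_norm k (\<lambda>x. u s x - u t x)" by (rule L2_norm_le_sobolev_norm) simp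
      finally show ?thesis
        using L2_norm_diff_ge[OF L] L2_norm_diff_ge[OF L(2,1)]
          L2_norm_minus_commute[of "(wderiv ^^ k) (u s)" "(wderiv ^^ k) (u t)"] by (simp add: N_def abs_le_iff)
    qed
    then have "((\<lambda>s. N s - N t) \<longlongrightarrow> 0) (at t within {0..b})"
      by (intro Lim_null_comparison[OF _ lim]) (auto simp: eventually_at_filter)
    then show "(N \<longlongrightarrow> N t) (at t within {0..b})" by (simp add: LIM_zero_iff)
  qed
  then have "compact (N ` {0..b})" by (intro compact_continuous_image) auto
  then have "bounded (N ` {0..b})" by (rule compact_imp_bounded)
  then obtain B where B: "\<forall>t\<in>{0..b}. norm (N t) \<le> B" by (auto simp: bounded_iff)
  show thesis
  proof (rule that[of "\<bar>B\<bar>"])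
    show "\<forall>t\<in>{0..b}. L2_norm ((wderiv ^^ k) (u t)) \<le> \<bar>B\<bar>"
      using B by (fastforce simp: N_def)
  qed simp
qed

text \<open>
  Let \<open>d = v0 - u0\<close> and \<open>S = u0 + v0\<close>. The transport terms differ by the derivative of \<open>d * S / 2\<close>, and its
  integral against \<open>d\<close> contains no derivative of \<open>d\<close> after an integration by parts. The sources of the nonlocal terms
  differ by \<open>2 * a * d + S' * d' / 2\<close>; the second summand contains a derivative of \<open>d\<close>, but the nonlocal term is its primitive,
  which is \<open>S' * d / 2\<close> up to a function whose derivative involves \<open>d\<close> only.
\<close>

lemma energy_estimate:
  fixes a M A lam :: real
  assumes per: "periodic u0" "periodic u1" "periodic u2" "periodic v0" "periodic v1" "periodic v2"
    and du: "\<forall>x. (u0 has_real_derivative u1 x) (at x)" "\<forall>x. (u1 has_real_derivative u2 x) (at x)" "continuous_on UNIV u2"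
    and dv: "\<forall>x. (v0 has_real_derivative v1 x) (at x)" "\<forall>x. (v1 has_real_derivative v2 x) (at x)" "continuous_on UNIV v2"
    and M: "\<And>x. \<bar>u1 x\<bar> \<le> M" "\<And>x. \<bar>u2 x\<bar> \<le> M" "\<And>x. \<bar>v1 x\<bar> \<le> M" "\<And>x. \<bar>v2 x\<bar> \<le> M"
    and a: "\<bar>a\<bar> \<le> A" and lam: "0 \<le> lam"
    and \<Phi>: "periodic \<Phi>" "\<forall>x. (\<Phi> has_real_derivative 2 * a * u0 x + 1/2 * (u1 x)\<^sup>2 - c) (at x)" "mean \<Phi> = 0"
    and \<Psi>: "periodic \<Psi>" "\<forall>x. (\<Psi> has_real_derivative 2 * a * v0 x + 1/2 * (v1 x)\<^sup>2 - c') (at x)" "mean \<Psi> = 0"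
  shows "(\<integral>x. (v0 x - u0 x) * ((- v0 x * v1 x + \<Psi> x - lam * v0 x) - (- u0 x * u1 x + \<Phi> x - lam * u0 x)) \<partial>circ)
      \<le> (5 * M + 4 * A) * (L2_norm (\<lambda>x. v0 x - u0 x))\<^sup>2"
proof -
  define d where "d = (\<lambda>x. v0 x - u0 x)"
  define S where "S = (\<lambda>x. u0 x + v0 x)"
  define S1 where "S1 = (\<lambda>x. u1 x + v1 x)"
  define S2 where "S2 = (\<lambda>x. u2 x + v2 x)"
  define d1 where "d1 = (\<lambda>x. v1 x - u1 x)"
  have D: "(d has_real_derivative d1 x) (at x)" "(S has_real_derivative S1 x) (at x)" "(S1 has_real_derivative S2 x) (at x)" for x
    unfolding d_def d1_def S_def S1_def S2_def
    using du dv by (auto intro!: derivative_intros)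
  have u1c: "continuous_on UNIV u1" "continuous_on UNIV v1" using du dv by (auto intro!: DERIV_continuous_UNIV)
  have C: "continuous_on UNIV d" "continuous_on UNIV S" "continuous_on UNIV S1" "continuous_on UNIV S2" "continuous_on UNIV d1"
    using DERIV_continuous_UNIV[OF D(1)] DERIV_continuous_UNIV[OF D(2)] DERIV_continuous_UNIV[OF D(3)]
      continuous_on_add[OF du(3) dv(3)] continuous_on_diff[OF u1c(2,1)] by (auto simp: S2_def d1_def)
  have P: "periodic d" "periodic S" "periodic S1" "periodic S2" "periodic d1"
    using per by (auto simp: periodic_def d_def S_def S1_def S2_def d1_def)
  have dL: "d \<in> L2" by (rule L2_continuous[OF P(1) C(1)])
  define n where "n = L2_norm d"
  have n: "0 \<le> n" by (simp add: n_def)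
  have M0: "0 \<le> M" using M(1)[of 0] by linarith
  have A0: "0 \<le> A" using a by linarith
  have S1b: "\<bar>S1 x\<bar> \<le> 2 * M" for x using M(1)[of x] M(3)[of x] by (simp add: S1_def)
  have S2b: "\<bar>S2 x\<bar> \<le> 2 * M" for x using M(2)[of x] M(4)[of x] by (simp add: S2_def)
  define X where "X = (\<lambda>x. \<Psi> x - \<Phi> x)"
  have XC: "continuous_on UNIV X" unfolding X_def using \<Phi>(2) \<Psi>(2)
    by (auto intro!: continuous_intros intro: DERIV_continuous_UNIV)
  have XP: "periodic X" using \<Phi>(1) \<Psi>(1) by (simp add: periodic_def X_def)
  have XL: "X \<in> L2" by (rule L2_continuous[OF XP XC])
  have Xm: "mean X = 0"
  proof -
    have "integrable circ \<Phi>" "integrable circ \<Psi>"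
      using \<Phi>(2) \<Psi>(2) by (auto intro!: integrable_circ_continuous intro: DERIV_continuous_UNIV)
    then show ?thesis using \<Phi>(3) \<Psi>(3) by (simp add: X_def mean_circ)
  qed
  \<comment> \<open>After subtracting the part that is local in \<open>d\<close>, no derivative of \<open>d\<close> remains in the derivative of \<open>G\<close>.\<close>
  define G where "G = (\<lambda>x. X x - 1/2 * S1 x * d x)"
  define g where "g = (\<lambda>x. (2 * a - 1/2 * S2 x) * d x)"
  have gC: "continuous_on UNIV g" unfolding g_def by (intro continuous_intros C)
  have gP: "periodic g" using P by (simp add: periodic_def g_def)
  have gL: "g \<in> L2" by (rule L2_continuous[OF gP gC])
  have GD: "(G has_real_derivative g x - (c' - c)) (at x)" for x
  proof -
    have "(X has_real_derivative (2 * a * v0 x + 1/2 * (v1 x)\<^sup>2 - c') - (2 * a * u0 x + 1/2 * (u1 x)\<^sup>2 - c)) (at x)"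
      unfolding X_def using \<Phi>(2) \<Psi>(2) by (auto intro!: derivative_intros)
    moreover have "((\<lambda>x. 1/2 * S1 x * d x) has_real_derivative 1/2 * S2 x * d x + 1/2 * S1 x * d1 x) (at x)"
      by (rule derivative_eq_intros D refl)+ (simp add: algebra_simps)
    ultimately have "(G has_real_derivative ((2 * a * v0 x + 1/2 * (v1 x)\<^sup>2 - c') - (2 * a * u0 x + 1/2 * (u1 x)\<^sup>2 - c)) -
       (1/2 * S2 x * d x + 1/2 * S1 x * d1 x)) (at x)"
      unfolding G_def by (rule DERIV_diff)
    moreover have "((2 * a * v0 x + 1/2 * (v1 x)\<^sup>2 - c') - (2 * a * u0 x + 1/2 * (u1 x)\<^sup>2 - c)) -
       (1/2 * S2 x * d x + 1/2 * S1 x * d1 x) = g x - (c' - c)"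
      by (simp add: g_def d_def S1_def d1_def power2_eq_square field_simps)
    ultimately show ?thesis by (rule DERIV_cong)
  qed
  have GC: "continuous_on UNIV G" by (rule DERIV_continuous_UNIV[OF GD])
  have GP: "periodic G" using P XP by (simp add: periodic_def G_def)
  have GL: "G \<in> L2" by (rule L2_continuous[OF GP GC])
  have gcC: "continuous_on UNIV (\<lambda>x. g x - (c' - c))" by (intro continuous_intros gC)
  have gn: "L2_norm g \<le> (2 * A + M) * n"
  proof -
    have "L2_norm (\<lambda>x. (2 * a - 1/2 * S2 x) * d x) \<le> (2 * A + M) * L2_norm d"
    proof (rule L2_norm_bounded_mult[OF dL])
      show "\<bar>2 * a - 1/2 * S2 x\<bar> \<le> 2 * A + M" for x using S2b[of x] a by (simp add: abs_le_iff)
    qed (use gL A0 M0 in \<open>auto simp: g_def\<close>)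
    then show ?thesis by (simp add: g_def n_def)
  qed
  have "integral\<^sup>L circ (\<lambda>x. g x - (c' - c)) = 0"
    using weak_deriv_mean[OF weak_deriv_C1[OF GP GD gcC]] .
  then have "mean g = c' - c" using L2_integrable[OF gL] by (simp add: mean_circ)
  then have cc: "\<bar>c' - c\<bar> \<le> L2_norm g" using mean_le_L2_norm[OF gL] by simp
  have gc: "L2_norm (\<lambda>x. g x - (c' - c)) \<le> 2 * ((2 * A + M) * n)"
    using L2_norm_triangle_diff[OF gL L2_const[of "c' - c"]] cc gn by simp
  have S1dL: "(\<lambda>x. S1 x * d x) \<in> L2" by (rule L2_continuous_mult[OF P(3) C(3) dL])
  have S1d: "L2_norm (\<lambda>x. S1 x * d x) \<le> 2 * M * n"
    unfolding n_def using M0 by (intro L2_norm_bounded_mult[OF dL S1dL]) (auto simp: S1b)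
  have Gm: "\<bar>mean G\<bar> \<le> M * n"
  proof -
    have "mean G = mean X - 1/2 * mean (\<lambda>x. S1 x * d x)"
      using L2_integrable[OF XL] L2_integrable[OF S1dL] by (simp add: G_def mean_circ mult.assoc)
    then show ?thesis using Xm mean_le_L2_norm[OF S1dL] S1d by simp
  qed
  have Gn: "L2_norm G \<le> (4 * A + 3 * M) * n"
  proof -
    have gcL: "(\<lambda>x. g x - (c' - c)) \<in> L2" by (rule L2_diff[OF gL L2_const])
    have "L2_norm G \<le> \<bar>mean G\<bar> + L2_norm (\<lambda>x. g x - (c' - c))"
      by (rule L2_norm_le_mean_deriv[OF GL gcL weak_deriv_C1[OF GP GD gcC]])
    then show ?thesis using Gm gc by (simp add: algebra_simps)
  qed
  have Xn: "L2_norm X \<le> (4 * A + 4 * M) * n"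
  proof -
    have "L2_norm (\<lambda>x. G x + 1/2 * (S1 x * d x)) \<le> L2_norm G + L2_norm (\<lambda>x. 1/2 * (S1 x * d x))"
      by (rule L2_norm_triangle[OF GL L2_cmult[OF S1dL]])
    moreover have "L2_norm (\<lambda>x. 1/2 * (S1 x * d x)) = 1/2 * L2_norm (\<lambda>x. S1 x * d x)"
      by (subst L2_norm_cmult) simp
    moreover have "(\<lambda>x. G x + 1/2 * (S1 x * d x)) = X" by (auto simp: G_def)
    ultimately show ?thesis using Gn S1d by (simp add: algebra_simps)
  qed
  have dX: "(\<integral>x. d x * X x \<partial>circ) \<le> (4 * A + 4 * M) * n\<^sup>2"
  proof -
    have "(\<integral>x. d x * X x \<partial>circ) \<le> n * L2_norm X" using L2_Cauchy_Schwarz[OF dL XL] by (simp add: n_def)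
    also have "\<dots> \<le> n * ((4 * A + 4 * M) * n)" by (intro mult_left_mono Xn n)
    finally show ?thesis by (simp add: power2_eq_square algebra_simps)
  qed
  have d2S: "(\<integral>x. S1 x * d x * d x \<partial>circ) \<ge> - (2 * M * n\<^sup>2)"
    using L2_Cauchy_Schwarz[OF S1dL dL] mult_right_mono[OF S1d n] by (simp add: n_def power2_eq_square algebra_simps)
  \<comment> \<open>The integrand is the derivative of the periodic function \<open>d\<^sup>2 * S\<close>.\<close>
  have parts: "(\<integral>x. 2 * (d x * d1 x) * S x + (d x)\<^sup>2 * S1 x \<partial>circ) = 0"
  proof (rule weak_deriv_mean[OF weak_deriv_C1])
    show "periodic (\<lambda>x. (d x)\<^sup>2 * S x)" using P by (simp add: periodic_def)
    show "((\<lambda>x. (d x)\<^sup>2 * S x) has_real_derivative 2 * (d x * d1 x) * S x + (d x)\<^sup>2 * S1 x) (at x)" for x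
      by (rule derivative_eq_intros D refl)+ (simp add: power2_eq_square algebra_simps)
  qed (intro continuous_intros C)
  have "(\<integral>x. d x * ((- v0 x * v1 x + \<Psi> x - lam * v0 x) - (- u0 x * u1 x + \<Phi> x - lam * u0 x)) \<partial>circ) =
     (\<integral>x. - (1/4) * (2 * (d x * d1 x) * S x + (d x)\<^sup>2 * S1 x) - 1/4 * (S1 x * d x * d x) + d x * X x - lam * (d x)\<^sup>2 \<partial>circ)"
    by (intro Bochner_Integration.integral_cong)
      (auto simp: d_def d1_def S_def S1_def X_def power2_eq_square algebra_simps)
  also have "\<dots> = - (1/4) * (\<integral>x. 2 * (d x * d1 x) * S x + (d x)\<^sup>2 * S1 x \<partial>circ) - 1/4 * (\<integral>x. S1 x * d x * d x \<partial>circ)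
      + (\<integral>x. d x * X x \<partial>circ) - lam * n\<^sup>2"
  proof -
    have "integrable circ (\<lambda>x. 2 * (d x * d1 x) * S x + (d x)\<^sup>2 * S1 x)" "integrable circ (\<lambda>x. S1 x * d x * d x)"
      "integrable circ (\<lambda>x. d x * X x)" "integrable circ (\<lambda>x. (d x)\<^sup>2)"
      by (intro integrable_circ_continuous continuous_intros C XC)+
    then show ?thesis
      unfolding n_def L2_norm_square
      by (simp only: Bochner_Integration.integral_add Bochner_Integration.integral_diff integral_mult_right_zero
        Bochner_Integration.integrable_add Bochner_Integration.integrable_diff integrable_mult_right)
  qed
  also have "\<dots> \<le> (5 * M + 4 * A) * n\<^sup>2"
  proof -
    have "0 \<le> lam * n\<^sup>2" "0 \<le> M * n\<^sup>2" using lam M0 by auto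
    then show ?thesis using parts d2S dX by (simp add: algebra_simps)
  qed
  finally show ?thesis by (simp add: d_def n_def)
qed

text \<open>
  This removes the chosen weak derivatives and the chosen value of \<open>A_inv\<close> from the equation at a fixed time.
\<close>

lemma muHS_rhs_classical:
  fixes m e lam :: real
  assumes w: "w \<in> sobolev 3"
    and eq: "AE x in lebesgue. wt x + w x * wderiv w x =
       - wderiv (A_inv (\<lambda>z. 2 * m * e * w z + 1/2 * (wderiv w z)\<^sup>2)) x - lam * w x"
  obtains f0 f1 f2 \<Phi> c where "periodic f0" "periodic f1" "periodic f2"
    "\<forall>x. (f0 has_real_derivative f1 x) (at x)" "\<forall>x. (f1 has_real_derivative f2 x) (at x)" "continuous_on UNIV f2"
    "\<forall>x. \<bar>f1 x\<bar> \<le> L2_norm ((wderiv ^^ 3) w) / sqrt 12" "\<forall>x. \<bar>f2 x\<bar> \<le> L2_norm ((wderiv ^^ 3) w) / sqrt 12"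
    "periodic \<Phi>" "\<forall>x. (\<Phi> has_real_derivative 2 * (m * e) * f0 x + 1/2 * (f1 x)\<^sup>2 - c) (at x)" "mean \<Phi> = 0"
    "AE x in lebesgue. w x = f0 x" "AE x in lebesgue. wt x = - f0 x * f1 x + \<Phi> x - lam * f0 x"
proof -
  obtain f0 f1 f2 where f: "periodic f0" "periodic f1" "periodic f2"
    "\<forall>x. (f0 has_real_derivative f1 x) (at x)" "\<forall>x. (f1 has_real_derivative f2 x) (at x)" "continuous_on UNIV f2"
    "AE x in lebesgue. w x = f0 x" "AE x in lebesgue. wderiv w x = f1 x"
    "\<forall>x. \<bar>f1 x\<bar> \<le> L2_norm ((wderiv ^^ 3) w) / sqrt 12" "\<forall>x. \<bar>f2 x\<bar> \<le> L2_norm ((wderiv ^^ 3) w) / sqrt 12"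
    by (rule sobolev3_classical[OF w])
  have fc: "continuous_on UNIV f0" "continuous_on UNIV f1" using f(4,5) by (auto intro!: DERIV_continuous_UNIV)
  have wL: "w \<in> L2" "wderiv w \<in> L2"
    using sobolev_L2[OF w] sobolev_wderiv(1)[of w 2] w sobolev_L2[of "wderiv w" 2] by (auto simp: numeral_3_eq_3 numeral_2_eq_2)
  define F where "F = (\<lambda>z. 2 * m * e * w z + 1/2 * (wderiv w z)\<^sup>2)"
  define F0 where "F0 = (\<lambda>z. 2 * (m * e) * f0 z + 1/2 * (f1 z)\<^sup>2)"
  have F0: "periodic F0" "continuous_on UNIV F0"
    unfolding F0_def using f(1,2) by (auto simp: periodic_def intro!: continuous_intros fc)
  have "continuous_on UNIV (\<lambda>x. F0 x - mean F0)" "periodic (\<lambda>x. F0 x - mean F0)" "integral\<^sup>L circ (\<lambda>x. F0 x - mean F0) = 0"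
    using F0 integrable_circ_continuous[OF F0(2)] by (auto intro!: continuous_intros simp: periodic_def mean_circ)
  then obtain \<Phi> where \<Phi>: "\<And>x. (\<Phi> has_real_derivative F0 x - mean F0) (at x)" "periodic \<Phi>" "mean \<Phi> = 0"
    using ex_periodic_primitive_mean[of "\<lambda>x. F0 x - mean F0" 0] by metis
  have "AE x in lebesgue. - wderiv (A_inv F) x = \<Phi> x"
  proof (rule wderiv_A_inv[OF _ _ _ F0 \<Phi>(2,1,3)])
    show "periodic F" using L2_periodic[OF wL(1)] L2_periodic[OF wL(2)] by (simp add: periodic_def F_def)
    show "F \<in> borel_measurable lebesgue" unfolding F_def using wL by measurable
    show "AE x in lebesgue. F x = F0 x" using f(7,8) by eventually_elim (simp add: F_def F0_def)
  qed
  then have "AE x in lebesgue. wt x = - f0 x * f1 x + \<Phi> x - lam * f0 x"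
    using eq[folded F_def] f(7,8) by eventually_elim simp
  then show thesis
    using that[of f0 f1 f2 \<Phi> "mean F0"] f \<Phi> by (simp add: F0_def)
qed

text \<open>
  The squared norm of the difference of the solutions vanishes at time zero and satisfies the linear differential inequality
  that \<open>energy_estimate\<close> provides, with a constant that is uniform on the compact interval from \<open>0\<close> to \<open>b\<close>.
\<close>

theorem muHS_solution_unique:
  assumes lam: "0 < lam" and u: "muHS_solution lam u0 T u" and v: "muHS_solution lam u0 T' v"
    and b: "0 \<le> b" "ereal b < T" "ereal b < T'"
  shows "AE x in lebesgue. v b x = u b x"
proof -
  define I where "I = {t. 0 \<le> t \<and> ereal t < T}"
  define J where "J = {t. 0 \<le> t \<and> ereal t < T'}"
  obtain u' where u3: "sobolev_continuous_on 3 I u" and u00: "AE x in lebesgue. u 0 x = u0 x"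
    and uC1: "sobolev_C1_on 2 I u u'"
    and ueq: "\<And>t. t \<in> I \<Longrightarrow> AE x in lebesgue. u' t x + u t x * wderiv (u t) x =
               - wderiv (A_inv (\<lambda>z. 2 * mean u0 * exp (- lam * t) * u t z + 1/2 * (wderiv (u t) z)\<^sup>2)) x - lam * u t x"
    using u unfolding muHS_solution_def Let_def I_def by blast
  obtain v' where v3: "sobolev_continuous_on 3 J v" and v00: "AE x in lebesgue. v 0 x = u0 x"
    and vC1: "sobolev_C1_on 2 J v v'"
    and veq: "\<And>t. t \<in> J \<Longrightarrow> AE x in lebesgue. v' t x + v t x * wderiv (v t) x =
               - wderiv (A_inv (\<lambda>z. 2 * mean u0 * exp (- lam * t) * v t z + 1/2 * (wderiv (v t) z)\<^sup>2)) x - lam * v t x"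
    using v unfolding muHS_solution_def Let_def J_def by blast
  have sub: "{0..b} \<subseteq> I" "{0..b} \<subseteq> J"
    using le_less_trans[OF _ b(2)] le_less_trans[OF _ b(3)] by (auto simp: I_def J_def)
  show ?thesis
  proof (cases "b = 0")
    case True
    then show ?thesis using u00 v00 by (auto elim: eventually_elim2)
  next
    case False
    then have b0: "0 < b" using b by simp
    obtain Mu where Mu: "0 \<le> Mu" "\<forall>t\<in>{0..b}. L2_norm ((wderiv ^^ 3) (u t)) \<le> Mu"
      by (rule sobolev_continuous_bounded[OF u3 sub(1)])
    obtain Mv where Mv: "0 \<le> Mv" "\<forall>t\<in>{0..b}. L2_norm ((wderiv ^^ 3) (v t)) \<le> Mv"
      by (rule sobolev_continuous_bounded[OF v3 sub(2)])
    define M where "M = (Mu + Mv) / sqrt 12"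
    define C where "C = 2 * (5 * M + 4 * \<bar>mean u0\<bar>)"
    define E where "E t = (L2_norm (\<lambda>x. v t x - u t x))\<^sup>2" for t
    define E' where "E' t = 2 * (\<integral>x. (v t x - u t x) * (v' t x - u' t x) \<partial>circ)" for t
    have uS: "u t \<in> sobolev 3" "u' t \<in> sobolev 2" if "t \<in> {0..b}" for t
      using u3 uC1 sub(1) that by (auto simp: sobolev_C1_on_def sobolev_continuous_on_def)
    have vS: "v t \<in> sobolev 3" "v' t \<in> sobolev 2" if "t \<in> {0..b}" for t
      using v3 vC1 sub(2) that by (auto simp: sobolev_C1_on_def sobolev_continuous_on_def)
    note uL = uS[THEN sobolev_L2] and vL = vS[THEN sobolev_L2]
    have der: "(E has_real_derivative E' t) (at t within {0..b})" if t: "t \<in> {0..b}" for t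
    proof -
      have "((\<lambda>s. sobolev_norm 2 (\<lambda>x. (u s x - u t x) / (s - t) - u' t x)) \<longlongrightarrow> 0) (at t within I)"
        "((\<lambda>s. sobolev_norm 2 (\<lambda>x. (v s x - v t x) / (s - t) - v' t x)) \<longlongrightarrow> 0) (at t within J)"
        using uC1 vC1 t sub unfolding sobolev_C1_on_def by blast+
      then have "((\<lambda>s. sobolev_norm 2 (\<lambda>x. (u s x - u t x) / (s - t) - u' t x)) \<longlongrightarrow> 0) (at t within {0..b})"
        "((\<lambda>s. sobolev_norm 2 (\<lambda>x. (v s x - v t x) / (s - t) - v' t x)) \<longlongrightarrow> 0) (at t within {0..b})"
        using tendsto_within_subset sub by blast+
      from tendsto_add[OF this]
      have lim: "((\<lambda>s. sobolev_norm 2 (\<lambda>x. (u s x - u t x) / (s - t) - u' t x) +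
          sobolev_norm 2 (\<lambda>x. (v s x - v t x) / (s - t) - v' t x)) \<longlongrightarrow> 0) (at t within {0..b})" by simp
      have bound: "norm (L2_norm (\<lambda>x. ((v s x - u s x) - (v t x - u t x)) / (s - t) - (v' t x - u' t x))) \<le>
          sobolev_norm 2 (\<lambda>x. (u s x - u t x) / (s - t) - u' t x) +
          sobolev_norm 2 (\<lambda>x. (v s x - v t x) / (s - t) - v' t x)" if s: "s \<in> {0..b}" for s
      proof -
        define qu where "qu = (\<lambda>x. (u s x - u t x) / (s - t) - u' t x)"
        define qv where "qv = (\<lambda>x. (v s x - v t x) / (s - t) - v' t x)"
        have q: "qu \<in> L2" "qv \<in> L2"
          using L2_diff[OF L2_cmult[OF L2_diff[OF uL(1)[OF s] uL(1)[OF t]], of "1 / (s - t)"] uL(2)[OF t]]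
            L2_diff[OF L2_cmult[OF L2_diff[OF vL(1)[OF s] vL(1)[OF t]], of "1 / (s - t)"] vL(2)[OF t]]
          by (auto simp: qu_def qv_def)
        have "(\<lambda>x. ((v s x - u s x) - (v t x - u t x)) / (s - t) - (v' t x - u' t x)) = (\<lambda>x. qv x - qu x)"
          by (simp add: qu_def qv_def diff_divide_distrib add_divide_distrib algebra_simps)
        then show ?thesis
          using L2_norm_triangle_diff[OF q(2,1)] L2_norm_le_sobolev_norm[of 0 2 qu] L2_norm_le_sobolev_norm[of 0 2 qv]
          by (simp add: qu_def[symmetric] qv_def[symmetric])
      qed
      have ev: "\<forall>\<^sub>F s in at t within {0..b}. norm (L2_norm (\<lambda>x. ((v s x - u s x) - (v t x - u t x)) / (s - t) - (v' t x - u' t x))) \<le>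
          sobolev_norm 2 (\<lambda>x. (u s x - u t x) / (s - t) - u' t x) +
          sobolev_norm 2 (\<lambda>x. (v s x - v t x) / (s - t) - v' t x)"
        unfolding eventually_at_filter by (rule always_eventually, intro allI impI, rule bound)
      show ?thesis
        unfolding E_def[abs_def] E'_def
        by (rule L2_norm_square_derivative[OF _ _ t Lim_null_comparison[OF ev lim]])
          (intro L2_diff uL vL t | assumption)+
    qed
    have le: "E' t \<le> C * E t" if t: "t \<in> {0..b}" for t
    proof -
      have tI: "t \<in> I" "t \<in> J" using t sub by auto
      obtain f0 f1 f2 \<Phi> c where f: "periodic f0" "periodic f1" "periodic f2"
        "\<forall>x. (f0 has_real_derivative f1 x) (at x)" "\<forall>x. (f1 has_real_derivative f2 x) (at x)" "continuous_on UNIV f2"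
        "\<forall>x. \<bar>f1 x\<bar> \<le> L2_norm ((wderiv ^^ 3) (u t)) / sqrt 12" "\<forall>x. \<bar>f2 x\<bar> \<le> L2_norm ((wderiv ^^ 3) (u t)) / sqrt 12"
        "periodic \<Phi>" "\<forall>x. (\<Phi> has_real_derivative 2 * (mean u0 * exp (- lam * t)) * f0 x + 1/2 * (f1 x)\<^sup>2 - c) (at x)" "mean \<Phi> = 0"
        "AE x in lebesgue. u t x = f0 x" "AE x in lebesgue. u' t x = - f0 x * f1 x + \<Phi> x - lam * f0 x"
        by (rule muHS_rhs_classical[OF uS(1)[OF t] ueq[OF tI(1)]])
      obtain g0 g1 g2 \<Psi> c' where g: "periodic g0" "periodic g1" "periodic g2"
        "\<forall>x. (g0 has_real_derivative g1 x) (at x)" "\<forall>x. (g1 has_real_derivative g2 x) (at x)" "continuous_on UNIV g2"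
        "\<forall>x. \<bar>g1 x\<bar> \<le> L2_norm ((wderiv ^^ 3) (v t)) / sqrt 12" "\<forall>x. \<bar>g2 x\<bar> \<le> L2_norm ((wderiv ^^ 3) (v t)) / sqrt 12"
        "periodic \<Psi>" "\<forall>x. (\<Psi> has_real_derivative 2 * (mean u0 * exp (- lam * t)) * g0 x + 1/2 * (g1 x)\<^sup>2 - c') (at x)" "mean \<Psi> = 0"
        "AE x in lebesgue. v t x = g0 x" "AE x in lebesgue. v' t x = - g0 x * g1 x + \<Psi> x - lam * g0 x"
        by (rule muHS_rhs_classical[OF vS(1)[OF t] veq[OF tI(2)]])
      have fu: "L2_norm ((wderiv ^^ 3) (u t)) / sqrt 12 \<le> M" "L2_norm ((wderiv ^^ 3) (v t)) / sqrt 12 \<le> M"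
        using Mu(1) Mv(1) bspec[OF Mu(2) t] bspec[OF Mv(2) t] by (auto simp: M_def intro!: divide_right_mono)
      have a: "\<bar>mean u0 * exp (- lam * t)\<bar> \<le> \<bar>mean u0\<bar>"
        using lam t by (simp add: abs_mult mult_left_le)
      have en: "(\<integral>x. (g0 x - f0 x) * ((- g0 x * g1 x + \<Psi> x - lam * g0 x) - (- f0 x * f1 x + \<Phi> x - lam * f0 x)) \<partial>circ)
         \<le> (5 * M + 4 * \<bar>mean u0\<bar>) * (L2_norm (\<lambda>x. g0 x - f0 x))\<^sup>2"
        by (rule energy_estimate[OF f(1-3) g(1-3) f(4-6) g(4-6) _ _ _ _ a less_imp_le[OF lam] f(9-11) g(9-11)])
           (use f(7,8) g(7,8) fu order_trans in blast)+
      have f0L: "f0 \<in> L2" "g0 \<in> L2" using f(1,4) g(1,4) by (auto intro!: L2_continuous intro: DERIV_continuous_UNIV)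
      have AE: "AE x in circ. u t x = f0 x" "AE x in circ. v t x = g0 x"
        "AE x in circ. u' t x = - f0 x * f1 x + \<Phi> x - lam * f0 x" "AE x in circ. v' t x = - g0 x * g1 x + \<Psi> x - lam * g0 x"
        using f(12,13) g(12,13) by (auto intro: AE_lebesgue_imp_circ)
      have "L2_norm (\<lambda>x. v t x - u t x) = L2_norm (\<lambda>x. g0 x - f0 x)"
        by (rule L2_norm_cong_AE[OF _ L2_diff[OF vL(1)[OF t] uL(1)[OF t]] L2_diff[OF f0L(2,1)]])
          (use AE in eventually_elim, simp)
      moreover have "(\<integral>x. (v t x - u t x) * (v' t x - u' t x) \<partial>circ) =
        (\<integral>x. (g0 x - f0 x) * ((- g0 x * g1 x + \<Psi> x - lam * g0 x) - (- f0 x * f1 x + \<Phi> x - lam * f0 x)) \<partial>circ)"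
      proof (rule integral_cong_AE)
        have "continuous_on UNIV f1" "continuous_on UNIV g1" "continuous_on UNIV \<Phi>" "continuous_on UNIV \<Psi>"
          "continuous_on UNIV f0" "continuous_on UNIV g0"
          using f(4,5,10) g(4,5,10) by (auto intro: DERIV_continuous_UNIV)
        then have "f1 \<in> L2" "g1 \<in> L2" "\<Phi> \<in> L2" "\<Psi> \<in> L2"
          using f(2,9) g(2,9) by (auto intro!: L2_continuous)
        then show "(\<lambda>x. (g0 x - f0 x) * ((- g0 x * g1 x + \<Psi> x - lam * g0 x) - (- f0 x * f1 x + \<Phi> x - lam * f0 x))) \<in> borel_measurable circ"
          using f0L by measurable
        show "(\<lambda>x. (v t x - u t x) * (v' t x - u' t x)) \<in> borel_measurable circ"
          using uL(1)[OF t] uL(2)[OF t] vL(1)[OF t] vL(2)[OF t] by measurable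
        show "AE x in circ. (v t x - u t x) * (v' t x - u' t x) =
           (g0 x - f0 x) * ((- g0 x * g1 x + \<Psi> x - lam * g0 x) - (- f0 x * f1 x + \<Phi> x - lam * f0 x))"
          using AE by eventually_elim simp
      qed
      ultimately show ?thesis
        using mult_left_mono[OF en, of 2, OF zero_le_numeral] by (simp only: E_def E'_def C_def mult.assoc)
    qed
    have E0: "E 0 = 0"
    proof -
      have z: "0 \<in> {0..b}" using b by simp
      have "AE x in lebesgue. v 0 x - u 0 x = 0" using u00 v00 by eventually_elim simp
      then have "L2_norm (\<lambda>x. v 0 x - u 0 x) = L2_norm (\<lambda>x. 0)"
        by (intro L2_norm_cong_AE AE_lebesgue_imp_circ L2_diff uL vL z L2_const) auto
      then show ?thesis by (simp add: E_def)
    qed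
    have bb: "b \<in> {0..b}" using b by simp
    have "E b = 0" by (rule Gronwall_zero[OF b0 E0 _ der le]) (simp add: E_def)
    then have "L2_norm (\<lambda>x. v b x - u b x) = 0" by (simp add: E_def)
    from L2_norm_eq_0[OF L2_diff[OF vL(1)[OF bb] uL(1)[OF bb]] this]
    show ?thesis by (intro AE_circ_imp_lebesgue L2_periodic uL vL bb) auto
  qed
qed

section \<open>Primitives and parametric integrals\<close>

definition jointly_continuous :: "(real \<Rightarrow> real \<Rightarrow> real) \<Rightarrow> bool" where
  "jointly_continuous f \<longleftrightarrow> continuous_on UNIV (\<lambda>p. f (fst p) (snd p))"

lemma jointly_continuous_compose:
  assumes "jointly_continuous f" "continuous_on S g" "continuous_on S h"
  shows "continuous_on S (\<lambda>z. f (g z) (h z))"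
proof -
  have "continuous_on S (\<lambda>z. (\<lambda>p. f (fst p) (snd p)) (g z, h z))"
    by (rule continuous_on_compose2[OF assms(1)[unfolded jointly_continuous_def]])
       (use assms in \<open>auto intro: continuous_on_Pair\<close>)
  then show ?thesis by simp
qed

lemma jointly_continuous_section:
  assumes "jointly_continuous f"
  shows "continuous_on S (f t)" "continuous_on S (\<lambda>t. f t x)"
  by (rule jointly_continuous_compose[OF assms]; intro continuous_intros)+

lemma continuous_on_parametric_integral:
  fixes g :: "'a::topological_space \<Rightarrow> real \<Rightarrow> real"
  assumes "continuous_on (UNIV :: ('a \<times> real) set) (\<lambda>p. g (fst p) (snd p))"
  shows "continuous_on UNIV (\<lambda>t. integral {0..1} (g t))"
proof -
  have "continuous_on (UNIV \<times> cbox (0::real) 1) (\<lambda>(t, x). g t x)"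
    using continuous_on_subset[OF assms subset_UNIV] by (simp add: split_beta')
  from integral_continuous_on_param[OF this] show ?thesis by simp
qed

lemma leibniz_unit_interval:
  assumes d: "\<And>t x. ((\<lambda>t. g t x) has_real_derivative g' t x) (at t)"
    and g: "\<And>t. continuous_on UNIV (g t)" and g': "jointly_continuous g'"
  shows "((\<lambda>t. integral {0..1} (g t)) has_real_derivative integral {0..1} (g' t)) (at t)"
proof -
  have "((\<lambda>t. integral (cbox 0 1) (g t)) has_real_derivative integral (cbox 0 1) (g' t)) (at t within UNIV)"
  proof (rule leibniz_rule_field_derivative)
    show "g s integrable_on cbox 0 1" for s
      using g by (auto intro!: integrable_continuous_real intro: continuous_on_subset)
    show "continuous_on (UNIV \<times> cbox 0 1) (\<lambda>(x, t). g' x t)"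
      using continuous_on_subset[OF g'[unfolded jointly_continuous_def] subset_UNIV] by (simp add: split_beta')
  qed (use d in auto)
  then show ?thesis by simp
qed

lemma continuous_integrable_Icc:
  fixes f :: "real \<Rightarrow> real"
  assumes "continuous_on UNIV f"
  shows "f integrable_on {a..b}"
  by (rule integrable_continuous_real[OF continuous_on_subset[OF assms subset_UNIV]])

text \<open>
  This is the integral of \<open>g\<close> from \<open>0\<close> to \<open>x\<close>, with its sign for negative \<open>x\<close>. In the rescaled form the domain of
  integration is fixed, so that continuity and derivatives with respect to further parameters follow from
  the theorems on parametric integrals.
\<close>

definition primitive :: "(real \<Rightarrow> real) \<Rightarrow> real \<Rightarrow> real" where
  "primitive g x = x * integral {0..1} (\<lambda>\<theta>. g (x * \<theta>))"

lemma primitive_unique: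
  assumes g: "continuous_on UNIV g" and F: "\<And>x. (F has_real_derivative g x) (at x)"
  shows "primitive g x = F x - F 0"
proof -
  have "((\<lambda>\<theta>. x * g (x * \<theta>)) has_integral F (x * 1) - F (x * 0)) {0..1}"
  proof (rule fundamental_theorem_of_calculus)
    show "((\<lambda>\<theta>. F (x * \<theta>)) has_vector_derivative x * g (x * \<theta>)) (at \<theta> within {0..1})" for \<theta>
    proof -
      have "((\<lambda>\<theta>. F (x * \<theta>)) has_real_derivative g (x * \<theta>) * x) (at \<theta>)"
        by (rule DERIV_chain2[OF F]) (auto intro!: derivative_eq_intros)
      then show ?thesis
        by (auto simp: has_real_derivative_iff_has_vector_derivative[symmetric] mult.commute intro: has_field_derivative_at_within)
    qed
  qed simp
  from integral_unique[OF this] have "integral {0..1} (\<lambda>\<theta>. x * g (x * \<theta>)) = F x - F 0" by simp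
  then show ?thesis by (simp add: primitive_def)
qed

lemma primitive_DERIV:
  assumes g: "continuous_on UNIV g"
  shows "(primitive g has_real_derivative g x) (at x)"
proof -
  obtain F where F: "\<And>x. (F has_real_derivative g x) (at x)" using ex_primitive[OF g, of 0] by blast
  have "primitive g = (\<lambda>x. F x - F 0)" using primitive_unique[OF g F] by auto
  then show ?thesis using F by (auto intro!: derivative_eq_intros)
qed

lemma primitive_0 [simp]: "primitive g 0 = 0"
  by (simp add: primitive_def)

lemma primitive_eq_integral:
  assumes g: "continuous_on UNIV g" and "0 \<le> x"
  shows "primitive g x = integral {0..x} g"
proof -
  have "(g has_integral primitive g x - primitive g 0) {0..x}"
    using primitive_DERIV[OF g] assms(2) by (intro fundamental_theorem_of_calculus)
      (auto simp: has_real_derivative_iff_has_vector_derivative[symmetric] intro: has_field_derivative_at_within)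
  then show ?thesis by (simp add: integral_unique)
qed

lemma primitive_diff:
  assumes "continuous_on UNIV f" "continuous_on UNIV g"
  shows "primitive (\<lambda>x. f x - g x) t = primitive f t - primitive g t"
proof -
  have "((\<lambda>t. primitive f t - primitive g t) has_real_derivative f x - g x) (at x)" for x
    using primitive_DERIV[OF assms(1)] primitive_DERIV[OF assms(2)] by (auto intro!: derivative_intros)
  from primitive_unique[OF continuous_on_diff[OF assms] this] show ?thesis by simp
qed

lemma primitive_bound:
  assumes f: "continuous_on UNIV f" and b: "\<And>x. \<bar>f x\<bar> \<le> B"
  shows "\<bar>primitive f t\<bar> \<le> B * \<bar>t\<bar>"
proof -
  have "norm (integral {0..1} (\<lambda>\<theta>. f (t * \<theta>))) \<le> integral {0..1} (\<lambda>\<theta>::real. B)"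
    by (rule integral_norm_bound_integral)
      (auto intro!: continuous_integrable_Icc continuous_on_compose2[OF f] continuous_intros simp: b)
  then have "\<bar>t\<bar> * \<bar>integral {0..1} (\<lambda>\<theta>. f (t * \<theta>))\<bar> \<le> \<bar>t\<bar> * B"
    by (intro mult_left_mono) auto
  then show ?thesis by (simp add: primitive_def abs_mult mult.commute)
qed

text \<open>
  In the norm weighted by \<open>exp (- K * \<bar>x\<bar>)\<close> integration from the origin has norm at most \<open>1 / K\<close>.
\<close>

lemma primitive_exp_bound:
  assumes f: "continuous_on UNIV f" and b: "\<And>x. \<bar>f x\<bar> \<le> D * exp (K * \<bar>x\<bar>)" and K: "0 < K" and D: "0 \<le> D"
  shows "\<bar>primitive f t\<bar> \<le> D / K * exp (K * \<bar>t\<bar>)"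
proof -
  have FTC: "((\<lambda>\<theta>. D * \<bar>t\<bar> * exp (K * \<bar>t\<bar> * \<theta>)) has_integral D / K * exp (K * \<bar>t\<bar> * 1) - D / K * exp (K * \<bar>t\<bar> * 0)) {0..1}"
  proof (rule fundamental_theorem_of_calculus)
    show "((\<lambda>\<theta>. D / K * exp (K * \<bar>t\<bar> * \<theta>)) has_vector_derivative D * \<bar>t\<bar> * exp (K * \<bar>t\<bar> * \<theta>)) (at \<theta> within {0..1})" for \<theta>
      unfolding has_real_derivative_iff_has_vector_derivative[symmetric] using K
      by (auto intro!: derivative_eq_intros)
  qed simp
  have "norm (integral {0..1} (\<lambda>\<theta>. t * f (t * \<theta>))) \<le> integral {0..1} (\<lambda>\<theta>. D * \<bar>t\<bar> * exp (K * \<bar>t\<bar> * \<theta>))"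
  proof (rule integral_norm_bound_integral)
    fix \<theta> :: real assume \<theta>: "\<theta> \<in> {0..1}"
    have "\<bar>t\<bar> * \<bar>f (t * \<theta>)\<bar> \<le> \<bar>t\<bar> * (D * exp (K * \<bar>t * \<theta>\<bar>))" by (intro mult_left_mono b) simp
    then show "norm (t * f (t * \<theta>)) \<le> D * \<bar>t\<bar> * exp (K * \<bar>t\<bar> * \<theta>)"
      using \<theta> by (simp add: abs_mult mult.assoc mult.left_commute)
  qed (auto intro!: continuous_integrable_Icc continuous_on_compose2[OF f] continuous_intros)
  then have "\<bar>primitive f t\<bar> \<le> D / K * exp (K * \<bar>t\<bar>) - D / K"
    using integral_unique[OF FTC] by (simp add: primitive_def)
  moreover have "0 \<le> D / K" using K D by simp
  ultimately show ?thesis by linarith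
qed

lemma jointly_continuous_primitive2:
  assumes "jointly_continuous g"
  shows "jointly_continuous (\<lambda>t x. primitive (g t) x)"
  unfolding jointly_continuous_def primitive_def
  by (intro continuous_intros continuous_on_parametric_integral jointly_continuous_compose[OF assms])

lemma jointly_continuous_primitive1:
  assumes "jointly_continuous g"
  shows "jointly_continuous (\<lambda>t x. primitive (\<lambda>r. g r x) t)"
  unfolding jointly_continuous_def primitive_def
  by (intro continuous_intros continuous_on_parametric_integral jointly_continuous_compose[OF assms])

lemma primitive_DERIV_parameter:
  assumes d: "\<And>r x. ((\<lambda>x. g r x) has_real_derivative g' r x) (at x)"
    and g: "jointly_continuous g" and g': "jointly_continuous g'"
  shows "((\<lambda>x. primitive (\<lambda>r. g r x) t) has_real_derivative primitive (\<lambda>r. g' r x) t) (at x)"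
proof -
  have "((\<lambda>x. integral {0..1} (\<lambda>\<theta>. g (t * \<theta>) x)) has_real_derivative integral {0..1} (\<lambda>\<theta>. g' (t * \<theta>) x)) (at x)"
  proof (rule leibniz_unit_interval)
    show "jointly_continuous (\<lambda>x \<theta>. g' (t * \<theta>) x)"
      unfolding jointly_continuous_def by (intro jointly_continuous_compose[OF g'] continuous_intros)
  qed (intro d jointly_continuous_compose[OF g] continuous_intros)+
  then show ?thesis unfolding primitive_def by (rule DERIV_cmult)
qed

lemma integral_pos_continuous:
  fixes f :: "real \<Rightarrow> real"
  assumes "continuous_on UNIV f" "\<And>x. 0 < f x"
  shows "0 < integral {0..1} f"
proof -
  obtain x where x: "x \<in> {0..1}" "\<forall>y\<in>{0..1}. f x \<le> f y"
    using continuous_attains_inf[of "{0..1::real}" f] continuous_on_subset[OF assms(1)] by auto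
  have "integral {0..1} (\<lambda>y::real. f x) \<le> integral {0..1} f"
    by (rule integral_le) (use x(2) in \<open>auto intro: continuous_integrable_Icc assms(1)\<close>)
  then show ?thesis using assms(2)[of x] by simp
qed

text \<open>
  If the logarithms of two densities differ by at most \<open>\<delta>\<close>, then after normalisation each is at most
  \<open>exp (2 * \<delta>)\<close> times the other. This bounds their distance by \<open>exp (2 * \<delta>) - 1\<close>, which is good for small \<open>\<delta>\<close>; for
  large \<open>\<delta>\<close> the trivial bound \<open>2\<close> is better. Together they give a bound that is linear in \<open>\<delta>\<close> without any
  restriction.
\<close>

lemma normalized_density_Lipschitz:
  fixes p q :: "real \<Rightarrow> real"
  assumes p: "continuous_on UNIV p" "\<And>x. x \<in> {0..1} \<Longrightarrow> 0 \<le> p x" "0 < integral {0..1} p"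
    and q: "continuous_on UNIV q" "\<And>x. x \<in> {0..1} \<Longrightarrow> 0 \<le> q x" "0 < integral {0..1} q"
    and pq: "\<And>x. x \<in> {0..1} \<Longrightarrow> p x \<le> exp \<delta> * q x" "\<And>x. x \<in> {0..1} \<Longrightarrow> q x \<le> exp \<delta> * p x"
    and \<delta>: "0 \<le> \<delta>"
  shows "integral {0..1} (\<lambda>x. \<bar>p x / integral {0..1} p - q x / integral {0..1} q\<bar>) \<le> 4 * \<delta>"
proof -
  define Ip Iq where "Ip = integral {0..1} p" and "Iq = integral {0..1} q"
  have pos: "0 < Ip" "0 < Iq" using p(3) q(3) by (auto simp: Ip_def Iq_def)
  have I: "Ip \<le> exp \<delta> * Iq" "Iq \<le> exp \<delta> * Ip"
  proof -
    have "integral {0..1} p \<le> integral {0..1} (\<lambda>x. exp \<delta> * q x)"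
      by (intro integral_le continuous_integrable_Icc continuous_intros p q pq)
    then show "Ip \<le> exp \<delta> * Iq" by (simp add: Ip_def Iq_def)
    have "integral {0..1} q \<le> integral {0..1} (\<lambda>x. exp \<delta> * p x)"
      by (intro integral_le continuous_integrable_Icc continuous_intros p q pq)
    then show "Iq \<le> exp \<delta> * Ip" by (simp add: Ip_def Iq_def)
  qed
  have hat: "p' / J \<le> exp (2 * \<delta>) * (q' / J')" if "p' \<le> exp \<delta> * q'" "J' \<le> exp \<delta> * J" "0 < J" "0 < J'" "0 \<le> q'"
    for p' q' J J' :: real
  proof -
    have "p' * J' \<le> (exp \<delta> * q') * (exp \<delta> * J)"
      using that by (intro mult_mono) auto
    also have "\<dots> = exp (2 * \<delta>) * q' * J" by (simp add: exp_double power2_eq_square)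
    finally show ?thesis using that by (simp add: field_simps)
  qed
  have split: "integral {0..1} (\<lambda>x. \<bar>p x / Ip - q x / Iq\<bar>) \<le> integral {0..1} (\<lambda>x. (exp (2 * \<delta>) - 1) * (p x / Ip))"
  proof (intro integral_le continuous_integrable_Icc continuous_intros p q)
    fix x :: real assume x: "x \<in> {0..1}"
    define P Q where "P = p x / Ip" and "Q = q x / Iq"
    have "P \<le> exp (2 * \<delta>) * Q" "Q \<le> exp (2 * \<delta>) * P" "0 \<le> P" "0 \<le> Q"
      using hat[OF pq(1)[OF x] I(2) pos q(2)[OF x]] hat[OF pq(2)[OF x] I(1) pos(2,1) p(2)[OF x]] p(2)[OF x] q(2)[OF x] pos
      by (auto simp: P_def Q_def)
    moreover have "1 \<le> exp (2 * \<delta>)" using \<delta> by simp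
    ultimately have "\<bar>P - Q\<bar> \<le> (exp (2 * \<delta>) - 1) * P"
    proof (cases "P \<le> Q")
      case False
      have "P - Q \<le> (exp (2 * \<delta>) - 1) * Q" using \<open>P \<le> exp (2 * \<delta>) * Q\<close> by (simp add: algebra_simps)
      also have "\<dots> \<le> (exp (2 * \<delta>) - 1) * P" using False \<open>1 \<le> exp (2 * \<delta>)\<close> by (intro mult_left_mono) auto
      finally show ?thesis using False by simp
    qed (simp add: algebra_simps)
    then show "\<bar>p x / Ip - q x / Iq\<bar> \<le> (exp (2 * \<delta>) - 1) * (p x / Ip)" by (simp add: P_def Q_def)
  qed (use pos in auto)
  also have "\<dots> = exp (2 * \<delta>) - 1"
    using pos by (simp add: Ip_def)
  finally have b1: "integral {0..1} (\<lambda>x. \<bar>p x / Ip - q x / Iq\<bar>) \<le> exp (2 * \<delta>) - 1" .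
  have "integral {0..1} (\<lambda>x. \<bar>p x / Ip - q x / Iq\<bar>) \<le> integral {0..1} (\<lambda>x. p x / Ip + q x / Iq)"
  proof (intro integral_le continuous_integrable_Icc continuous_intros p q)
    fix x :: real assume x: "x \<in> {0..1}"
    have "0 \<le> p x / Ip" "0 \<le> q x / Iq" using p(2)[OF x] q(2)[OF x] pos by auto
    then show "\<bar>p x / Ip - q x / Iq\<bar> \<le> p x / Ip + q x / Iq" by linarith
  qed (use pos in auto)
  also have "\<dots> = 2"
    using pos by (subst Henstock_Kurzweil_Integration.integral_add)
      (auto simp: Ip_def[symmetric] Iq_def[symmetric] intro!: continuous_integrable_Icc continuous_intros p q)
  finally have b2: "integral {0..1} (\<lambda>x. \<bar>p x / Ip - q x / Iq\<bar>) \<le> 2" .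
  show ?thesis
  proof (cases "2 * \<delta> \<le> 1")
    case True
    have "exp (2 * \<delta>) \<le> 1 + 2 * \<delta> + (2 * \<delta>)\<^sup>2" by (rule exp_bound) (use True \<delta> in auto)
    also have "(2 * \<delta>)\<^sup>2 \<le> 2 * \<delta>" using mult_right_mono[OF True, of "2 * \<delta>"] \<delta> by (simp add: power2_eq_square)
    finally show ?thesis using b1 by (simp add: Ip_def Iq_def)
  next
    case False
    then show ?thesis using b2 by (simp add: Ip_def Iq_def)
  qed
qed

section \<open>The logarithm of the Jacobian as the solution of an ordinary differential equation\<close>

text \<open>
  The function \<open>k\<close> is the initial value of \<open>y\<close> divided by its mean. Its nonnegativity is the sign condition on the
  initial momentum that the smallness of the third derivative provides.
\<close>

locale circle_density =
  fixes k :: "real \<Rightarrow> real"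
  assumes k_periodic: "periodic k" and k_continuous: "continuous_on UNIV k"
    and k_nonneg: "0 \<le> k x" and k_integral: "integral {0..1} k = 1"
begin

text \<open>
  For \<open>s = ln q_x\<close> this density and the following one are \<open>q_x\<close> and \<open>K (t, q) * q_x\<close>, divided by their
  integrals. The integrals equal one along the flow; dividing by them makes the slope \<open>drift s\<close> a bounded and
  Lipschitz function of an arbitrary \<open>s\<close>.
\<close>

definition normal_rho :: "(real \<Rightarrow> real) \<Rightarrow> real \<Rightarrow> real" where
  "normal_rho s x = exp (s x) / integral {0..1} (\<lambda>x. exp (s x))"

definition normal_kappa :: "(real \<Rightarrow> real) \<Rightarrow> real \<Rightarrow> real" where
  "normal_kappa s x = k x * exp (- s x) / integral {0..1} (\<lambda>x. k x * exp (- s x))"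

definition height :: "(real \<Rightarrow> real) \<Rightarrow> real \<Rightarrow> real" where
  "height s = primitive (\<lambda>x. normal_rho s x - normal_kappa s x)"

text \<open>
  The slope \<open>w_x\<close> at the particle \<open>x\<close>. The constant is determined by the condition that \<open>w_x\<close>, as a derivative of a
  periodic function, has mean zero; in the coordinates of the flow the mean is taken with the density \<open>q_x\<close>.
\<close>

definition drift :: "(real \<Rightarrow> real) \<Rightarrow> real \<Rightarrow> real" where
  "drift s x = height s x - integral {0..1} (\<lambda>z. normal_rho s z * height s z)"

context
  fixes s :: "real \<Rightarrow> real"
  assumes s: "continuous_on UNIV s"
begin

lemma rho_mass_pos: "0 < integral {0..1} (\<lambda>x. exp (s x))"
  by (intro integral_pos_continuous continuous_intros s) auto

lemma kappa_mass_pos: "0 < integral {0..1} (\<lambda>x. k x * exp (- s x))"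
proof -
  obtain M where M: "\<And>x. x \<in> {0..1} \<Longrightarrow> \<bar>s x\<bar> \<le> M" using continuous_bounded_Icc[OF s] by metis
  have "integral {0..1} (\<lambda>x. k x * exp (- M)) \<le> integral {0..1} (\<lambda>x. k x * exp (- s x))"
  proof (intro integral_le continuous_integrable_Icc continuous_intros k_continuous s)
    fix x :: real assume "x \<in> {0..1}"
    then have "- M \<le> - s x" using M[of x] by auto
    then show "k x * exp (- M) \<le> k x * exp (- s x)" using k_nonneg by (intro mult_left_mono) auto
  qed
  then have "exp (- M) \<le> integral {0..1} (\<lambda>x. k x * exp (- s x))" using k_integral by simp
  then show ?thesis using exp_gt_zero[of "- M"] by linarith
qed

lemma normal_continuous:
  "continuous_on UNIV (normal_rho s)" "continuous_on UNIV (normal_kappa s)"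
  using rho_mass_pos kappa_mass_pos unfolding normal_rho_def[abs_def] normal_kappa_def[abs_def]
  by (intro continuous_intros s k_continuous; simp)+

lemma normal_nonneg: "0 \<le> normal_rho s x" "0 \<le> normal_kappa s x"
  using rho_mass_pos kappa_mass_pos k_nonneg by (auto simp: normal_rho_def normal_kappa_def)

lemma normal_integral: "integral {0..1} (normal_rho s) = 1" "integral {0..1} (normal_kappa s) = 1"
  using rho_mass_pos kappa_mass_pos unfolding normal_rho_def[abs_def] normal_kappa_def[abs_def] by auto

lemma normal_diff_continuous: "continuous_on UNIV (\<lambda>x. normal_rho s x - normal_kappa s x)"
  by (intro continuous_intros normal_continuous)

lemma height_DERIV: "(height s has_real_derivative normal_rho s x - normal_kappa s x) (at x)"
  unfolding height_def by (rule primitive_DERIV[OF normal_diff_continuous])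

lemma height_continuous: "continuous_on UNIV (height s)"
  by (rule DERIV_continuous_UNIV[OF height_DERIV])

lemma drift_DERIV: "(drift s has_real_derivative normal_rho s x - normal_kappa s x) (at x)"
  unfolding drift_def[abs_def] using height_DERIV by (auto intro!: derivative_eq_intros)

text \<open>
  The height is a difference of two cumulative distribution functions.
\<close>

lemma height_bound_Icc:
  assumes "x \<in> {0..1}"
  shows "\<bar>height s x\<bar> \<le> 1"
proof -
  have le1: "0 \<le> integral {0..x} f \<and> integral {0..x} f \<le> 1"
    if "continuous_on UNIV f" "\<And>x. 0 \<le> f x" "integral {0..1} f = 1" for f :: "real \<Rightarrow> real"
  proof
    show "0 \<le> integral {0..x} f" using that by (intro Henstock_Kurzweil_Integration.integral_nonneg continuous_integrable_Icc) auto
    have "integral {0..x} f \<le> integral {0..1} f"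
      using that assms by (intro integral_subset_le continuous_integrable_Icc) auto
    then show "integral {0..x} f \<le> 1" using that by simp
  qed
  have "height s x = integral {0..x} (normal_rho s) - integral {0..x} (normal_kappa s)"
    unfolding height_def using assms
    by (subst primitive_eq_integral[OF normal_diff_continuous])
      (auto intro!: Henstock_Kurzweil_Integration.integral_diff continuous_integrable_Icc normal_continuous)
  then show ?thesis
    using le1[OF normal_continuous(1) normal_nonneg(1) normal_integral(1)]
      le1[OF normal_continuous(2) normal_nonneg(2) normal_integral(2)] by auto
qed

lemma average_height_bound: "\<bar>integral {0..1} (\<lambda>z. normal_rho s z * height s z)\<bar> \<le> 1"
proof -
  have "norm (integral {0..1} (\<lambda>z. normal_rho s z * height s z)) \<le> integral {0..1} (normal_rho s)"
  proof (rule integral_norm_bound_integral)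
    fix z :: real assume "z \<in> {0..1}"
    then show "norm (normal_rho s z * height s z) \<le> normal_rho s z"
      using height_bound_Icc[of z] normal_nonneg(1)[of z] by (simp add: abs_mult mult_left_le)
  qed (intro continuous_integrable_Icc continuous_intros normal_continuous height_continuous)+
  then show ?thesis by (simp add: normal_integral)
qed

lemma drift_mean: "integral {0..1} (\<lambda>x. exp (s x) * drift s x) = 0"
proof -
  have "(\<lambda>x. exp (s x) * drift s x) = (\<lambda>x. integral {0..1} (\<lambda>x. exp (s x)) *
      (normal_rho s x * height s x - normal_rho s x * integral {0..1} (\<lambda>z. normal_rho s z * height s z)))"
    using rho_mass_pos by (auto simp: drift_def normal_rho_def field_simps)
  moreover have "integral {0..1} (\<lambda>x. normal_rho s x * height s x - normal_rho s x * integral {0..1} (\<lambda>z. normal_rho s z * height s z)) = 0"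
    by (subst Henstock_Kurzweil_Integration.integral_diff)
      (auto simp: normal_integral intro!: continuous_integrable_Icc continuous_intros normal_continuous height_continuous)
  ultimately show ?thesis by simp
qed

context
  assumes sp: "periodic s"
begin

lemma normal_periodic: "periodic (\<lambda>x. normal_rho s x - normal_kappa s x)"
  using sp k_periodic by (simp add: periodic_def normal_rho_def normal_kappa_def)

lemma height_periodic: "periodic (height s)"
proof (rule periodic_primitive[OF normal_periodic normal_diff_continuous height_DERIV])
  have "integral {0..1} (\<lambda>x. normal_rho s x - normal_kappa s x) = 0"
    by (subst Henstock_Kurzweil_Integration.integral_diff)
      (auto simp: normal_integral intro!: continuous_integrable_Icc normal_continuous)
  then show "(\<integral>x. normal_rho s x - normal_kappa s x \<partial>circ) = 0"
    by (simp add: integral_circ_eq_integral[OF normal_diff_continuous])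
qed

lemma drift_periodic: "periodic (drift s)"
  using height_periodic by (simp add: periodic_def drift_def)

lemma drift_bound: "\<bar>drift s x\<bar> \<le> 2"
proof -
  have "\<bar>height s (frac x)\<bar> \<le> 1" by (rule height_bound_Icc) (simp add: less_imp_le[OF frac_lt_1])
  then show ?thesis
    using average_height_bound periodic_frac[OF height_periodic, of x] unfolding drift_def by linarith
qed

end

end

text \<open>
  The height is a difference of two distribution functions, each of which changes by at most \<open>4 * \<delta>\<close>. In the average of the height
  the density changes as well, which adds another \<open>4 * \<delta>\<close>: in total \<open>8 + (8 + 4)\<close>.
\<close>

lemma drift_Lipschitz:
  assumes s: "continuous_on UNIV s" "periodic s" and r: "continuous_on UNIV r" "periodic r"
    and \<delta>: "\<And>x. \<bar>s x - r x\<bar> \<le> \<delta>"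
  shows "\<bar>drift s x - drift r x\<bar> \<le> 20 * \<delta>"
proof -
  have \<delta>0: "0 \<le> \<delta>" using \<delta>[of 0] by linarith
  note nc = normal_continuous[OF s(1)] normal_continuous[OF r(1)]
  note hc = height_continuous[OF s(1)] height_continuous[OF r(1)]
  have e: "exp (s x) \<le> exp \<delta> * exp (r x)" "exp (r x) \<le> exp \<delta> * exp (s x)"
    "exp (- s x) \<le> exp \<delta> * exp (- r x)" "exp (- r x) \<le> exp \<delta> * exp (- s x)" for x
    using \<delta>[of x] by (auto simp: exp_add[symmetric])
  have rho: "integral {0..1} (\<lambda>x. \<bar>normal_rho s x - normal_rho r x\<bar>) \<le> 4 * \<delta>"
    unfolding normal_rho_def
    by (rule normalized_density_Lipschitz)
      (auto intro!: continuous_intros s r rho_mass_pos e \<delta>0)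
  have kappa: "integral {0..1} (\<lambda>x. \<bar>normal_kappa s x - normal_kappa r x\<bar>) \<le> 4 * \<delta>"
    unfolding normal_kappa_def
  proof (rule normalized_density_Lipschitz)
    show "k x * exp (- s x) \<le> exp \<delta> * (k x * exp (- r x))" "k x * exp (- r x) \<le> exp \<delta> * (k x * exp (- s x))" for x
      using mult_left_mono[OF e(3) k_nonneg, of x x] mult_left_mono[OF e(4) k_nonneg, of x x] by (simp_all add: mult.left_commute)
  qed (auto intro!: continuous_intros s r kappa_mass_pos k_nonneg k_continuous mult_nonneg_nonneg \<delta>0)
  have height: "\<bar>height s x - height r x\<bar> \<le> 8 * \<delta>" if x: "x \<in> {0..1}" for x
  proof -
    define G where "G = (\<lambda>x. (normal_rho s x - normal_kappa s x) - (normal_rho r x - normal_kappa r x))"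
    have Gc: "continuous_on UNIV G" unfolding G_def by (intro continuous_intros nc)
    have "height s x - height r x = integral {0..x} G"
      unfolding height_def G_def
      using x primitive_eq_integral[OF normal_diff_continuous[OF s(1)]] primitive_eq_integral[OF normal_diff_continuous[OF r(1)]]
        Henstock_Kurzweil_Integration.integral_diff[OF continuous_integrable_Icc[OF normal_diff_continuous[OF s(1)]]
          continuous_integrable_Icc[OF normal_diff_continuous[OF r(1)]], of 0 x] by simp
    also have "\<bar>\<dots>\<bar> \<le> integral {0..x} (\<lambda>x. \<bar>G x\<bar>)"
      using integral_norm_bound_integral[of G "{0..x}" "\<lambda>x. \<bar>G x\<bar>"]
      by (auto intro!: continuous_integrable_Icc continuous_intros Gc)
    also have "\<dots> \<le> integral {0..1} (\<lambda>x. \<bar>G x\<bar>)"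
      using x by (intro integral_subset_le continuous_integrable_Icc continuous_intros Gc) auto
    also have "\<dots> \<le> integral {0..1} (\<lambda>x. \<bar>normal_rho s x - normal_rho r x\<bar> + \<bar>normal_kappa s x - normal_kappa r x\<bar>)"
      by (intro integral_le continuous_integrable_Icc continuous_intros Gc nc) (auto simp: G_def)
    also have "\<dots> \<le> 8 * \<delta>"
      using rho kappa by (subst Henstock_Kurzweil_Integration.integral_add)
        (auto intro!: continuous_integrable_Icc continuous_intros nc)
    finally show ?thesis .
  qed
  have avg: "\<bar>integral {0..1} (\<lambda>z. normal_rho s z * height s z) - integral {0..1} (\<lambda>z. normal_rho r z * height r z)\<bar> \<le> 12 * \<delta>"
  proof -
    have diff: "integral {0..1} (\<lambda>z. normal_rho s z * height s z) - integral {0..1} (\<lambda>z. normal_rho r z * height r z) =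
       integral {0..1} (\<lambda>z. normal_rho s z * height s z - normal_rho r z * height r z)"
      by (intro Henstock_Kurzweil_Integration.integral_diff[symmetric] continuous_integrable_Icc continuous_intros nc hc)
    have "norm (integral {0..1} (\<lambda>z. normal_rho s z * height s z - normal_rho r z * height r z)) \<le>
       integral {0..1} (\<lambda>z. normal_rho s z * (8 * \<delta>) + \<bar>normal_rho s z - normal_rho r z\<bar>)"
    proof (rule integral_norm_bound_integral)
      fix z :: real assume z: "z \<in> {0..1}"
      have split: "normal_rho s z * height s z - normal_rho r z * height r z =
         normal_rho s z * (height s z - height r z) + (normal_rho s z - normal_rho r z) * height r z"
        by (simp add: algebra_simps)
      have "\<bar>normal_rho s z * (height s z - height r z)\<bar> \<le> normal_rho s z * (8 * \<delta>)"
        unfolding abs_mult using mult_left_mono[OF height[OF z] normal_nonneg(1)[OF s(1), of z]]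
          normal_nonneg(1)[OF s(1), of z] by simp
      moreover have "\<bar>(normal_rho s z - normal_rho r z) * height r z\<bar> \<le> \<bar>normal_rho s z - normal_rho r z\<bar>"
        unfolding abs_mult using mult_left_mono[OF height_bound_Icc[OF r(1) z], of "\<bar>normal_rho s z - normal_rho r z\<bar>"] by simp
      ultimately show "norm (normal_rho s z * height s z - normal_rho r z * height r z) \<le>
         normal_rho s z * (8 * \<delta>) + \<bar>normal_rho s z - normal_rho r z\<bar>"
        unfolding split real_norm_def by linarith
    qed (intro continuous_integrable_Icc continuous_intros nc hc)+
    moreover have "integral {0..1} (\<lambda>z. normal_rho s z * (8 * \<delta>) + \<bar>normal_rho s z - normal_rho r z\<bar>) =
       integral {0..1} (\<lambda>z. normal_rho s z * (8 * \<delta>)) + integral {0..1} (\<lambda>z. \<bar>normal_rho s z - normal_rho r z\<bar>)"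
      by (rule Henstock_Kurzweil_Integration.integral_add) (intro continuous_integrable_Icc continuous_intros nc)+
    moreover have "integral {0..1} (\<lambda>z. normal_rho s z * (8 * \<delta>)) = 8 * \<delta>"
      using normal_integral(1)[OF s(1)] by simp
    ultimately show ?thesis using rho unfolding diff real_norm_def by linarith
  qed
  have "\<bar>height s (frac x) - height r (frac x)\<bar> \<le> 8 * \<delta>" by (rule height) (simp add: less_imp_le[OF frac_lt_1])
  then have "\<bar>height s x - height r x\<bar> \<le> 8 * \<delta>"
    using periodic_frac[OF height_periodic[OF s]] periodic_frac[OF height_periodic[OF r]] by simp
  then show ?thesis using avg unfolding drift_def by linarith
qed

lemma drift_jointly_continuous:
  assumes s: "jointly_continuous s"
  shows "jointly_continuous (\<lambda>t. drift (s t))"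
proof -
  note sec = jointly_continuous_section(1)[OF s]
  have I: "continuous_on UNIV (\<lambda>t. integral {0..1} (\<lambda>x. exp (s t x)))"
    "continuous_on UNIV (\<lambda>t. integral {0..1} (\<lambda>x. k x * exp (- s t x)))"
    by (intro continuous_on_parametric_integral continuous_intros jointly_continuous_compose[OF s]
        continuous_on_compose2[OF k_continuous] | simp)+
  have n: "jointly_continuous (\<lambda>t. normal_rho (s t))" "jointly_continuous (\<lambda>t. normal_kappa (s t))"
    unfolding jointly_continuous_def normal_rho_def normal_kappa_def
    using rho_mass_pos[OF sec] kappa_mass_pos[OF sec]
    by (intro continuous_intros jointly_continuous_compose[OF s] continuous_on_compose2[OF I(1)]
        continuous_on_compose2[OF I(2)] continuous_on_compose2[OF k_continuous] | force simp: less_le)+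
  have "jointly_continuous (\<lambda>t x. normal_rho (s t) x - normal_kappa (s t) x)"
    using n unfolding jointly_continuous_def by (intro continuous_intros)
  from jointly_continuous_primitive2[OF this] have h: "jointly_continuous (\<lambda>t. height (s t))"
    by (simp add: height_def)
  have "continuous_on UNIV (\<lambda>t. integral {0..1} (\<lambda>z. normal_rho (s t) z * height (s t) z))"
    using n(1) h unfolding jointly_continuous_def
    by (intro continuous_on_parametric_integral continuous_intros)
  then show ?thesis
    using h unfolding jointly_continuous_def drift_def
    by (intro continuous_intros continuous_on_compose2[of UNIV "\<lambda>t. integral {0..1} (\<lambda>z. normal_rho (s t) z * height (s t) z)" UNIV fst]) auto
qed

text \<open>
  The unknown \<open>z\<close> of the fixed point problem is \<open>s\<close> multiplied by \<open>exp (- K * \<bar>t\<bar>)\<close>, as a bounded continuous function of time and space that is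
  periodic in space. The weight makes the Picard map a contraction on the whole time axis at once, because the vector field has a
  global Lipschitz constant.
\<close>

theorem flow_exists:
  fixes a :: "real \<Rightarrow> real"
  assumes a: "continuous_on UNIV a" "\<And>t. \<bar>a t\<bar> \<le> A"
  obtains s where "jointly_continuous s" "\<And>t. periodic (s t)"
    "\<And>t x. ((\<lambda>t. s t x) has_real_derivative a t * drift (s t) x) (at t)"
    "\<And>x. s 0 x = 0" "\<And>t x. \<bar>s t x\<bar> \<le> 2 * A * \<bar>t\<bar>"
proof -
  have A: "0 \<le> A" using a(2)[of 0] by linarith
  \<comment> \<open>The vector field has the Lipschitz constant \<open>20 * A\<close>; the weight makes the contraction factor at most \<open>20 * A / K\<close>.\<close>
  define K where "K = 40 * A + 1"
  have K: "0 < K" using A by (simp add: K_def)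
  define P :: "((real \<times> real) \<Rightarrow>\<^sub>C real) set" where "P = {z. \<forall>t x. apply_bcontfun z (t, x + 1) = apply_bcontfun z (t, x)}"
  define W where "W z t x = exp (K * \<bar>t\<bar>) * apply_bcontfun z (t, x)" for z :: "(real \<times> real) \<Rightarrow>\<^sub>C real" and t x
  define h where "h z r x = a r * drift (W z r) x" for z r x
  define \<Gamma>0 where "\<Gamma>0 z p = exp (- K * \<bar>fst p\<bar>) * primitive (\<lambda>r. h z r (snd p)) (fst p)" for z and p :: "real \<times> real"
  define \<Gamma> where "\<Gamma> z = Bcontfun (\<Gamma>0 z)" for z
  have Wc: "jointly_continuous (W z)" for z
    unfolding jointly_continuous_def W_def by (auto intro!: continuous_intros)
  have Ws: "continuous_on UNIV (W z r)" for z r by (rule jointly_continuous_section(1)[OF Wc])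
  have Wp: "periodic (W z t)" if "z \<in> P" for z t
    using that by (simp add: periodic_def W_def P_def)
  have hc: "jointly_continuous (h z)" for z
    using drift_jointly_continuous[OF Wc[of z]] unfolding jointly_continuous_def h_def
    by (intro continuous_intros continuous_on_compose2[OF a(1)]) auto
  have hs: "continuous_on UNIV (\<lambda>r. h z r x)" for z x by (rule jointly_continuous_section(2)[OF hc])
  have hb: "\<bar>h z r x\<bar> \<le> 2 * A" if "z \<in> P" for z r x
    using mult_mono[OF a(2)[of r] drift_bound[OF Ws[of z r] Wp[OF that], of x]] A by (simp add: h_def abs_mult mult.commute)
  have \<Gamma>0b: "norm (\<Gamma>0 z p) \<le> 2 * A / K" if "z \<in> P" for z p
  proof -
    have "\<bar>primitive (\<lambda>r. h z r (snd p)) (fst p)\<bar> \<le> 2 * A / K * exp (K * \<bar>fst p\<bar>)"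
    proof (rule primitive_exp_bound[OF hs])
      fix r :: real
      have "2 * A \<le> 2 * A * exp (K * \<bar>r\<bar>)" using A K by (simp add: mult_le_cancel_left1)
      then show "\<bar>h z r (snd p)\<bar> \<le> 2 * A * exp (K * \<bar>r\<bar>)" using hb[OF that, of r "snd p"] by linarith
    qed (use K A in auto)
    then have "exp (- K * \<bar>fst p\<bar>) * \<bar>primitive (\<lambda>r. h z r (snd p)) (fst p)\<bar> \<le> exp (- K * \<bar>fst p\<bar>) * (2 * A / K * exp (K * \<bar>fst p\<bar>))"
      by (intro mult_left_mono) auto
    also have "\<dots> = 2 * A / K" by (simp add: exp_minus field_simps)
    finally show ?thesis by (simp add: \<Gamma>0_def abs_mult)
  qed
  have \<Gamma>: "apply_bcontfun (\<Gamma> z) = \<Gamma>0 z" if "z \<in> P" for z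
  proof -
    have "continuous_on UNIV (\<Gamma>0 z)"
      using jointly_continuous_primitive1[OF hc[of z]] unfolding jointly_continuous_def \<Gamma>0_def[abs_def]
      by (intro continuous_intros) auto
    then have "\<Gamma>0 z \<in> bcontfun" using \<Gamma>0b[OF that] by (rule bcontfun_normI)
    then show ?thesis unfolding \<Gamma>_def by (rule Bcontfun_inverse)
  qed
  have "\<exists>!z\<in>P. \<Gamma> z = z"
  proof (rule Banach_fix[where c = "1/2"])
    show "complete P"
      unfolding complete_eq_closed closed_sequential_limits
    proof (intro allI impI, elim conjE)
      fix y :: "nat \<Rightarrow> (real \<times> real) \<Rightarrow>\<^sub>C real" and l
      assume y: "\<forall>n. y n \<in> P" "y \<longlonglongrightarrow> l"
      have "(\<lambda>n. apply_bcontfun (y n) p) \<longlonglongrightarrow> apply_bcontfun l p" for p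
        using tendsto_uniform_limitI[OF tendsto_bcontfun_uniform_limit[OF y(2)]] by auto
      note lim = this
      have "apply_bcontfun l (t, x + 1) = apply_bcontfun l (t, x)" for t x
      proof (rule LIMSEQ_unique[OF lim])
        have "(\<lambda>n. apply_bcontfun (y n) (t, x + 1)) = (\<lambda>n. apply_bcontfun (y n) (t, x))"
          using y(1) by (simp add: P_def)
        then show "(\<lambda>n. apply_bcontfun (y n) (t, x + 1)) \<longlonglongrightarrow> apply_bcontfun l (t, x)"
          using lim[of "(t, x)"] by simp
      qed
      then show "l \<in> P" by (simp add: P_def)
    qed
    show "P \<noteq> {}"
    proof -
      have "0 \<in> P" by (simp add: P_def)
      then show ?thesis by blast
    qed
    show "\<Gamma> ` P \<subseteq> P"
    proof (rule image_subsetI)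
      fix z assume z: "z \<in> P"
      have "h z r (x + 1) = h z r x" for r x
        using drift_periodic[OF Ws Wp[OF z], of r] by (simp add: periodic_def h_def)
      then show "\<Gamma> z \<in> P" by (simp add: P_def \<Gamma>[OF z] \<Gamma>0_def)
    qed
    show "dist (\<Gamma> y) (\<Gamma> z) \<le> 1/2 * dist y z" if yz: "y \<in> P" "z \<in> P" for y z
    proof -
      define d where "d = dist y z"
      have d: "0 \<le> d" by (simp add: d_def)
      have hd: "\<bar>h y r x - h z r x\<bar> \<le> 20 * A * d * exp (K * \<bar>r\<bar>)" for r x
      proof -
        have "\<bar>W y r x - W z r x\<bar> \<le> d * exp (K * \<bar>r\<bar>)" for x
        proof -
          have "\<bar>apply_bcontfun y (r, x) - apply_bcontfun z (r, x)\<bar> \<le> d" using dist_bounded[of y "(r, x)" z] by (simp add: d_def dist_real_def)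
          then have "exp (K * \<bar>r\<bar>) * \<bar>apply_bcontfun y (r, x) - apply_bcontfun z (r, x)\<bar> \<le> exp (K * \<bar>r\<bar>) * d" by (intro mult_left_mono) auto
          moreover have "W y r x - W z r x = exp (K * \<bar>r\<bar>) * (apply_bcontfun y (r, x) - apply_bcontfun z (r, x))" by (simp add: W_def right_diff_distrib)
          ultimately show ?thesis by (simp add: abs_mult mult.commute)
        qed
        then have "\<bar>drift (W y r) x - drift (W z r) x\<bar> \<le> 20 * (d * exp (K * \<bar>r\<bar>))"
          by (intro drift_Lipschitz Ws Wp yz)
        then have "\<bar>a r\<bar> * \<bar>drift (W y r) x - drift (W z r) x\<bar> \<le> A * (20 * (d * exp (K * \<bar>r\<bar>)))"
          using a(2)[of r] A by (intro mult_mono) auto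
        moreover have "h y r x - h z r x = a r * (drift (W y r) x - drift (W z r) x)" by (simp add: h_def right_diff_distrib)
        ultimately show ?thesis by (simp add: abs_mult mult_ac)
      qed
      show "dist (\<Gamma> y) (\<Gamma> z) \<le> 1/2 * dist y z"
      proof (rule dist_bound)
        fix p :: "real \<times> real"
        have "\<bar>primitive (\<lambda>r. h y r (snd p) - h z r (snd p)) (fst p)\<bar> \<le> 20 * A * d / K * exp (K * \<bar>fst p\<bar>)"
          by (rule primitive_exp_bound[OF continuous_on_diff[OF hs hs] hd K]) (use A d in simp)
        then have pd: "\<bar>primitive (\<lambda>r. h y r (snd p)) (fst p) - primitive (\<lambda>r. h z r (snd p)) (fst p)\<bar> \<le> 20 * A * d / K * exp (K * \<bar>fst p\<bar>)"
          by (simp only: primitive_diff[OF hs hs])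
        have "dist (apply_bcontfun (\<Gamma> y) p) (apply_bcontfun (\<Gamma> z) p) = exp (- K * \<bar>fst p\<bar>) * \<bar>primitive (\<lambda>r. h y r (snd p)) (fst p) - primitive (\<lambda>r. h z r (snd p)) (fst p)\<bar>"
          by (simp add: \<Gamma> yz \<Gamma>0_def dist_real_def right_diff_distrib[symmetric] abs_mult)
        also have "\<dots> \<le> exp (- K * \<bar>fst p\<bar>) * (20 * A * d / K * exp (K * \<bar>fst p\<bar>))"
          by (intro mult_left_mono pd) simp
        also have "\<dots> = 20 * A * d / K" by (simp add: exp_minus field_simps)
        also have "\<dots> \<le> 1/2 * d"
        proof -
          have "40 * A * d \<le> K * d" using d by (intro mult_right_mono) (auto simp: K_def)
          then show ?thesis using K by (simp add: field_simps)
        qed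
        finally show "dist (apply_bcontfun (\<Gamma> y) p) (apply_bcontfun (\<Gamma> z) p) \<le> 1/2 * dist y z" by (simp add: d_def)
      qed
    qed
  qed auto
  then obtain z where z: "z \<in> P" "\<Gamma> z = z" by blast
  define s where "s = W z"
  have fp: "s t x = primitive (\<lambda>r. a r * drift (s r) x) t" for t x
  proof -
    have "apply_bcontfun z (t, x) = \<Gamma>0 z (t, x)" using \<Gamma>[OF z(1)] z(2) by simp
    then have "s t x = exp (K * \<bar>t\<bar>) * (exp (- K * \<bar>t\<bar>) * primitive (\<lambda>r. h z r x) t)"
      by (simp add: s_def W_def \<Gamma>0_def)
    then show ?thesis by (simp add: exp_minus field_simps h_def s_def)
  qed
  have hs': "continuous_on UNIV (\<lambda>r. a r * drift (s r) x)" for x using hs[of z x] by (simp add: h_def s_def)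
  show thesis
  proof (rule that[of s])
    show "jointly_continuous s" unfolding s_def by (rule Wc)
  next
    fix t
    show "periodic (s t)" unfolding s_def by (rule Wp[OF z(1)])
  next
    fix t x
    show "((\<lambda>t. s t x) has_real_derivative a t * drift (s t) x) (at t)"
    proof -
      have "primitive (\<lambda>r. a r * drift (s r) x) = (\<lambda>t. s t x)" by (rule ext) (rule fp[symmetric])
      then show ?thesis using primitive_DERIV[OF hs', of x t] by simp
    qed
  next
    fix x
    show "s 0 x = 0" using fp[of 0 x] by simp
  next
    fix t x
    show "\<bar>s t x\<bar> \<le> 2 * A * \<bar>t\<bar>"
      unfolding fp[of t x] by (rule primitive_bound[OF hs']) (use hb[OF z(1)] in \<open>simp add: h_def s_def\<close>)
  qed
qed

end

section \<open>Changes of variables and continuous curves in L2\<close>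

lemma circ_integral_shift:
  assumes g: "periodic g" "continuous_on UNIV g" and F: "\<And>x. (F has_real_derivative g x) (at x)"
  shows "F (x + 1) - F x = integral {0..1} g"
proof -
  have "((\<lambda>y. F (y + 1) - F y) has_real_derivative 0) (at y)" for y
  proof -
    have "((\<lambda>y. F (y + 1)) has_real_derivative g (y + 1)) (at y)"
      using F[of "y + 1"] DERIV_shift by blast
    from DERIV_diff[OF this F[of y]] show ?thesis using g(1) by (simp add: periodic_def)
  qed
  then have "F (x + 1) - F x = F (0 + 1) - F 0" using DERIV_isconst_all by blast
  also have "\<dots> = integral {0..1} g"
    using circ_FTC[OF g(2) F] by (simp add: integral_circ_eq_integral[OF g(2)])
  finally show ?thesis .
qed

lemma circle_substitution:
  assumes g: "periodic g" "continuous_on UNIV g"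
    and q: "\<And>x. (q has_real_derivative q' x) (at x)" "continuous_on UNIV q'" "q 1 = q 0 + 1"
  shows "integral {0..1} g = integral {0..1} (\<lambda>x. g (q x) * q' x)"
proof -
  obtain F where F: "\<And>x. (F has_real_derivative g x) (at x)" using ex_primitive[OF g(2), of 0] by blast
  have qc: "continuous_on UNIV q" by (rule DERIV_continuous_UNIV[OF q(1)])
  have c: "continuous_on UNIV (\<lambda>x. g (q x) * q' x)"
    by (intro continuous_intros q(2) continuous_on_compose2[OF g(2) qc]) auto
  have "(\<integral>x. g (q x) * q' x \<partial>circ) = F (q 1) - F (q 0)"
    by (rule circ_FTC[OF c DERIV_chain2[OF F q(1)]])
  then show ?thesis using circ_integral_shift[OF g F, of "q 0"] q(3) by (simp add: integral_circ_eq_integral[OF c])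
qed

lemma nn_integral_circ_borel:
  fixes f :: "real \<Rightarrow> real"
  assumes "f \<in> borel_measurable borel"
  shows "(\<integral>\<^sup>+x. ennreal (f x) * indicator {0..1} x \<partial>lborel) = (\<integral>\<^sup>+x. ennreal (f x) \<partial>circ)"
  by (simp add: nn_integral_restrict_space nn_integral_completion)

text \<open>
  Change of variables. The image of a period under \<open>p\<close> is an interval of length one, which lies in two consecutive
  integer periods; this is where the factor \<open>2\<close> comes from.
\<close>

lemma L2_compose:
  assumes p: "\<And>z. (p has_real_derivative p' z) (at z)" "continuous_on UNIV p'" "\<And>z. m \<le> p' z" "0 < m"
      "\<And>z. p (z + 1) = p z + 1"
    and g: "g \<in> L2" "g \<in> borel_measurable borel"
  shows "(\<lambda>z. g (p z)) \<in> L2" "L2_norm (\<lambda>z. g (p z)) \<le> sqrt (2 / m) * L2_norm g"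
proof -
  have pc: "continuous_on UNIV p" by (rule DERIV_continuous_UNIV[OF p(1)])
  have pm [measurable]: "p \<in> borel_measurable borel" by (rule borel_measurable_continuous_onI[OF pc])
  have p'm [measurable]: "p' \<in> borel_measurable borel" by (rule borel_measurable_continuous_onI[OF p(2)])
  have gm [measurable]: "g \<in> borel_measurable borel" by (rule g)
  define N where "N = (\<integral>x. (g x)\<^sup>2 \<partial>circ)"
  have N0: "0 \<le> N" by (simp add: N_def)
  have unit: "(\<integral>\<^sup>+x. ennreal ((g x)\<^sup>2) * indicator {0..1} x \<partial>lborel) = ennreal N"
    unfolding N_def nn_integral_circ_borel[OF borel_measurable_power[OF gm, of 2]]
    by (rule nn_integral_eq_integral[OF L2_square_integrable[OF g(1)]]) simp
  have shift: "(\<integral>\<^sup>+x. ennreal ((g x)\<^sup>2) * indicator {of_int n .. of_int n + 1} x \<partial>lborel) = ennreal N" for n :: int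
  proof -
    have "(\<integral>\<^sup>+x. ennreal ((g x)\<^sup>2) * indicator {of_int n .. of_int n + 1} x \<partial>lborel) =
      ennreal \<bar>1\<bar> * (\<integral>\<^sup>+x. ennreal ((g (of_int n + 1 * x))\<^sup>2) * indicator {of_int n .. of_int n + 1} (of_int n + 1 * x) \<partial>lborel)"
      by (rule nn_integral_real_affine) auto
    also have "\<dots> = (\<integral>\<^sup>+x. ennreal ((g x)\<^sup>2) * indicator {0..1} x \<partial>lborel)"
      using periodic_int[OF L2_periodic[OF g(1)], of _ n] by (auto intro!: nn_integral_cong simp: add.commute split: split_indicator)
    finally show ?thesis using unit by simp
  qed
  define n where "n = \<lfloor>p 0\<rfloor>"
  have p01: "p 1 = p 0 + 1" using p(5)[of 0] by simp
  have "(\<integral>\<^sup>+z. ennreal ((g (p z))\<^sup>2 * p' z * indicator {0..1} z) \<partial>lborel) =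
      (\<integral>\<^sup>+x. ennreal ((g x)\<^sup>2 * indicator {p 0..p 1} x) \<partial>lborel)"
  proof -
    have "set_borel_measurable borel {p 0..p 1} (\<lambda>x. (g x)\<^sup>2)" unfolding set_borel_measurable_def by measurable
    moreover have "0 \<le> p' z" for z using p(3)[of z] p(4) by linarith
    ultimately show ?thesis
      using nn_integral_substitution[where f = "\<lambda>x. (g x)\<^sup>2" and g = p and a = 0 and b = 1 and g' = p'] p(1) continuous_on_subset[OF p(2)]
      by simp
  qed
  also have "\<dots> \<le> (\<integral>\<^sup>+x. ennreal ((g x)\<^sup>2) * indicator {of_int n .. of_int n + 1} x +
      ennreal ((g x)\<^sup>2) * indicator {of_int (n + 1) .. of_int (n + 1) + 1} x \<partial>lborel)"
  proof (rule nn_integral_mono)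
    fix x
    have "of_int n \<le> p 0" "p 0 < of_int n + 1" by (auto simp: n_def)
    then show "ennreal ((g x)\<^sup>2 * indicator {p 0..p 1} x) \<le> ennreal ((g x)\<^sup>2) * indicator {of_int n .. of_int n + 1} x +
      ennreal ((g x)\<^sup>2) * indicator {of_int (n + 1) .. of_int (n + 1) + 1} x"
      unfolding p01 by (auto simp: indicator_def)
  qed
  also have "\<dots> = ennreal N + ennreal N"
    by (subst nn_integral_add) (auto simp only: shift intro!: borel_measurable_times_ennreal measurable_compose[OF _ measurable_ennreal] borel_measurable_power gm borel_measurable_indicator, auto)
  also have "\<dots> = ennreal (2 * N)" using N0 by (simp add: ennreal_plus[symmetric] del: ennreal_plus)
  finally have le: "(\<integral>\<^sup>+z. ennreal ((g (p z))\<^sup>2 * p' z * indicator {0..1} z) \<partial>lborel) \<le> ennreal (2 * N)" .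
  have "ennreal m * (\<integral>\<^sup>+z. ennreal ((g (p z))\<^sup>2) * indicator {0..1} z \<partial>lborel) =
     (\<integral>\<^sup>+z. ennreal m * (ennreal ((g (p z))\<^sup>2) * indicator {0..1} z) \<partial>lborel)"
    by (rule nn_integral_cmult[symmetric]) measurable
  also have "\<dots> \<le> (\<integral>\<^sup>+z. ennreal ((g (p z))\<^sup>2 * p' z * indicator {0..1} z) \<partial>lborel)"
  proof (rule nn_integral_mono)
    fix z
    have "m * (g (p z))\<^sup>2 \<le> (g (p z))\<^sup>2 * p' z" using mult_right_mono[OF p(3)[of z], of "(g (p z))\<^sup>2"] by (simp add: mult.commute)
    then show "ennreal m * (ennreal ((g (p z))\<^sup>2) * indicator {0..1} z) \<le> ennreal ((g (p z))\<^sup>2 * p' z * indicator {0..1} z)"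
      using p(4) by (auto simp: indicator_def ennreal_mult'[symmetric] intro!: ennreal_leI)
  qed
  finally have le2: "ennreal m * (\<integral>\<^sup>+z. ennreal ((g (p z))\<^sup>2) * indicator {0..1} z \<partial>lborel) \<le> ennreal (2 * N)" using le by (rule order_trans)
  have gpm: "(\<lambda>z. (g (p z))\<^sup>2) \<in> borel_measurable borel" by measurable
  have fin: "(\<integral>\<^sup>+z. ennreal ((g (p z))\<^sup>2) \<partial>circ) \<le> ennreal (2 / m * N)"
  proof -
    have "(\<integral>\<^sup>+z. ennreal ((g (p z))\<^sup>2) \<partial>circ) = ennreal (1 / m) * (ennreal m * (\<integral>\<^sup>+z. ennreal ((g (p z))\<^sup>2) * indicator {0..1} z \<partial>lborel))"
      using p(4) by (simp add: nn_integral_circ_borel[OF gpm] mult.assoc[symmetric] ennreal_mult'[symmetric])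
    also have "\<dots> \<le> ennreal (1 / m) * ennreal (2 * N)" by (intro mult_left_mono le2) simp
    also have "\<dots> = ennreal (2 / m * N)" using p(4) N0 by (simp add: ennreal_mult'[symmetric])
    finally show ?thesis .
  qed
  have mc: "(\<lambda>z. (g (p z))\<^sup>2) \<in> borel_measurable circ"
    using gpm by (intro measurable_restrict_space1) (simp add: measurable_completion)
  have int: "integrable circ (\<lambda>z. (g (p z))\<^sup>2)"
  proof (rule integrableI_nonneg[OF mc])
    show "(\<integral>\<^sup>+z. ennreal ((g (p z))\<^sup>2) \<partial>circ) < \<infinity>" using fin le_less_trans by fastforce
  qed simp
  have "(\<lambda>z. g (p z)) \<in> borel_measurable borel" by measurable
  moreover have "periodic (\<lambda>z. g (p z))" using L2_periodic[OF g(1)] by (simp add: periodic_def p(5))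
  ultimately show "(\<lambda>z. g (p z)) \<in> L2" using int by (simp add: L2_circ measurable_completion)
  have "ennreal (\<integral>z. (g (p z))\<^sup>2 \<partial>circ) \<le> ennreal (2 / m * N)"
    using fin nn_integral_eq_integral[OF int] by simp
  then have "(\<integral>z. (g (p z))\<^sup>2 \<partial>circ) \<le> 2 / m * N" using p(4) N0 by (subst (asm) ennreal_le_iff) auto
  then have "sqrt (\<integral>z. (g (p z))\<^sup>2 \<partial>circ) \<le> sqrt (2 / m * N)" by (rule real_sqrt_le_mono)
  then show "L2_norm (\<lambda>z. g (p z)) \<le> sqrt (2 / m) * L2_norm g"
    unfolding real_sqrt_mult L2_norm_circ N_def .
qed

text \<open>
  Compositions of a Borel function with continuous ones are measurable. The almost everywhere equal Borel function is made
  periodic by evaluating it at \<open>frac x\<close>.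
\<close>

lemma Borel_representative:
  assumes f: "f \<in> L2"
  obtains g where "g \<in> L2" "g \<in> borel_measurable borel" "AE x in lebesgue. f x = g x"
proof -
  have "f \<in> borel_measurable lebesgue" using f by measurable
  from completion_ex_borel_measurable_real[OF this] obtain h
    where h: "h \<in> borel_measurable lborel" "AE x in lborel. f x = h x" by blast
  have [measurable]: "h \<in> borel_measurable borel" using h(1) by simp
  define g where "g = (\<lambda>x. h (frac x))"
  have gm: "g \<in> borel_measurable borel" unfolding g_def frac_def by measurable
  have gp: "periodic g" by (simp add: g_def periodic_def frac_1_eq)
  have "AE x in circ. f x = g x"
  proof -
    have "AE x in lebesgue. f x = h x" using h(2) by (rule AE_completion)
    then have "AE x in circ. f x = h x" by (rule AE_lebesgue_imp_circ)
    moreover have "AE x in circ. x \<noteq> 1"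
    proof (rule AE_lebesgue_imp_circ)
      have "negligible {1::real}" by simp
      then show "AE x in lebesgue. x \<noteq> (1::real)" by (intro AE_I'[of "{1}"]) (auto simp: negligible_iff_null_sets)
    qed
    moreover have "AE x in circ. x \<in> space circ" by (rule AE_space)
    ultimately show ?thesis
    proof eventually_elim
      case (elim x)
      then have "frac x = x" by (simp add: frac_eq)
      then show ?case using elim by (simp add: g_def)
    qed
  qed
  then have ae: "AE x in lebesgue. f x = g x" by (intro AE_circ_imp_lebesgue L2_periodic f gp)
  have "g \<in> L2"
    using ae gm by (intro L2_cong_AE[OF f gp]) (auto simp: measurable_completion elim: eventually_mono)
  then show thesis using that gm ae by blast
qed

lemma jointly_continuous_uniform:
  assumes f: "jointly_continuous f" and e: "0 < e"
  shows "\<forall>\<^sub>F t in nhds t0. \<forall>z\<in>{0..1}. \<bar>f t z - f t0 z\<bar> < e"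
proof -
  have c: "compact ({t0 - 1 .. t0 + 1} \<times> {0..1::real})" by (intro compact_Times) auto
  have "continuous_on ({t0 - 1 .. t0 + 1} \<times> {0..1}) (\<lambda>p. f (fst p) (snd p))"
    using f unfolding jointly_continuous_def by (rule continuous_on_subset) simp
  from compact_uniformly_continuous[OF this c] e obtain d where d: "0 < d"
    and u: "\<And>p p'. p \<in> {t0 - 1 .. t0 + 1} \<times> {0..1} \<Longrightarrow> p' \<in> {t0 - 1 .. t0 + 1} \<times> {0..1} \<Longrightarrow> dist p' p < d \<Longrightarrow>
       dist (f (fst p') (snd p')) (f (fst p) (snd p)) < e"
    unfolding uniformly_continuous_on_def by blast
  have "\<forall>\<^sub>F t in nhds t0. t \<in> {t0 - min 1 d <..< t0 + min 1 d}"
    by (rule eventually_nhds_in_open) (use d in auto)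
  then show ?thesis
  proof eventually_elim
    case (elim t)
    show ?case
    proof
      fix z :: real assume z: "z \<in> {0..1}"
      have "dist (t, z) (t0, z) < d" using elim by (auto simp: dist_Pair_Pair dist_real_def)
      moreover have "t \<in> {t0 - 1 .. t0 + 1}" using elim min.cobounded1[of 1 d] by auto
      ultimately show "\<bar>f t z - f t0 z\<bar> < e" using u[of "(t0, z)" "(t, z)"] z by (auto simp: dist_real_def)
    qed
  qed
qed

definition L2_curve :: "(real \<Rightarrow> real \<Rightarrow> real) \<Rightarrow> bool" where
  "L2_curve f \<longleftrightarrow> (\<forall>t. f t \<in> L2) \<and> (\<forall>t0. ((\<lambda>t. L2_norm (\<lambda>x. f t x - f t0 x)) \<longlongrightarrow> 0) (at t0))"

lemma L2_curve_jointly_continuous: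
  assumes f: "jointly_continuous f" "\<And>t. periodic (f t)"
  shows "L2_curve f"
proof -
  have L: "f t \<in> L2" for t by (rule L2_continuous[OF f(2) jointly_continuous_section(1)[OF f(1)]])
  have "((\<lambda>t. L2_norm (\<lambda>x. f t x - f t0 x)) \<longlongrightarrow> 0) (at t0)" for t0
  proof (rule tendstoI)
    fix e :: real assume e: "0 < e"
    have "\<forall>\<^sub>F t in nhds t0. \<forall>z\<in>{0..1}. \<bar>f t z - f t0 z\<bar> < e / 2"
      by (rule jointly_continuous_uniform[OF f(1)]) (use e in simp)
    then have "\<forall>\<^sub>F t in nhds t0. dist (L2_norm (\<lambda>x. f t x - f t0 x)) 0 < e"
    proof eventually_elim
      case (elim t)
      have "L2_norm (\<lambda>x. f t x - f t0 x) \<le> e / 2"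
        by (rule L2_norm_le_bound[OF L2_diff[OF L L]]) (use elim in \<open>auto intro: less_imp_le\<close>)
      then show ?case using e by (simp add: dist_real_def)
    qed
    then show "\<forall>\<^sub>F t in at t0. dist (L2_norm (\<lambda>x. f t x - f t0 x)) 0 < e"
      by (simp add: eventually_nhds_conv_at)
  qed
  then show ?thesis using L by (simp add: L2_curve_def)
qed

lemma L2_curve_add:
  assumes "L2_curve f" "L2_curve g"
  shows "L2_curve (\<lambda>t x. f t x + g t x)"
proof -
  have L: "f t \<in> L2" "g t \<in> L2" for t using assms by (auto simp: L2_curve_def)
  have "((\<lambda>t. L2_norm (\<lambda>x. (f t x + g t x) - (f t0 x + g t0 x))) \<longlongrightarrow> 0) (at t0)" for t0
  proof (rule Lim_null_comparison)
    have "((\<lambda>t. L2_norm (\<lambda>x. f t x - f t0 x) + L2_norm (\<lambda>x. g t x - g t0 x)) \<longlongrightarrow> 0 + 0) (at t0)"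
      using assms by (intro tendsto_add) (auto simp: L2_curve_def)
    then show "((\<lambda>t. L2_norm (\<lambda>x. f t x - f t0 x) + L2_norm (\<lambda>x. g t x - g t0 x)) \<longlongrightarrow> 0) (at t0)" by simp
    have "norm (L2_norm (\<lambda>x. (f t x + g t x) - (f t0 x + g t0 x))) \<le>
      L2_norm (\<lambda>x. f t x - f t0 x) + L2_norm (\<lambda>x. g t x - g t0 x)" for t
      using L2_norm_triangle[OF L2_diff[OF L(1)[of t] L(1)[of t0]] L2_diff[OF L(2)[of t] L(2)[of t0]]]
      by (simp add: algebra_simps)
    then show "\<forall>\<^sub>F t in at t0. norm (L2_norm (\<lambda>x. (f t x + g t x) - (f t0 x + g t0 x))) \<le>
      L2_norm (\<lambda>x. f t x - f t0 x) + L2_norm (\<lambda>x. g t x - g t0 x)" by (rule always_eventually[OF allI])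
  qed
  then show ?thesis using L by (simp add: L2_curve_def L2_add)
qed

lemma L2_curve_mult:
  assumes b: "jointly_continuous b" "\<And>t. periodic (b t)" and f: "L2_curve f"
  shows "L2_curve (\<lambda>t x. b t x * f t x)"
proof -
  have L: "f t \<in> L2" for t using f by (auto simp: L2_curve_def)
  have bc: "continuous_on UNIV (b t)" for t by (rule jointly_continuous_section(1)[OF b(1)])
  have m: "g \<in> L2 \<Longrightarrow> (\<lambda>x. b t x * g x) \<in> L2" for g t
    using L2_continuous_mult[OF b(2)[of t] bc[of t]] .
  have bd: "periodic (\<lambda>x. b t x - b t0 x)" "continuous_on UNIV (\<lambda>x. b t x - b t0 x)" for t t0
    using b(2) by (auto simp: periodic_def intro!: continuous_intros bc)
  have "((\<lambda>t. L2_norm (\<lambda>x. b t x * f t x - b t0 x * f t0 x)) \<longlongrightarrow> 0) (at t0)" for t0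
  proof (rule tendstoI)
    fix e :: real assume e: "0 < e"
    obtain B where B: "0 \<le> B" "\<And>x. x \<in> {0..1} \<Longrightarrow> \<bar>b t0 x\<bar> \<le> B" using continuous_bounded_Icc[OF bc[of t0]] by metis
    define N where "N = L2_norm (f t0)"
    have N: "0 \<le> N" by (simp add: N_def)
    define c where "c = min 1 (e / (2 * (N + 1)))"
    have c: "0 < c" "c \<le> 1" using e N by (auto simp: c_def)
    have cN: "c * N < e / 2"
    proof -
      have "c * N \<le> e / (2 * (N + 1)) * N" using N by (intro mult_right_mono) (auto simp: c_def)
      also have "\<dots> < e / (2 * (N + 1)) * (N + 1)" using e N by (intro mult_strict_left_mono) auto
      also have "\<dots> = e / 2" using N by (simp add: field_simps)
      finally show ?thesis .
    qed
    have "\<forall>\<^sub>F t in at t0. \<forall>z\<in>{0..1}. \<bar>b t z - b t0 z\<bar> < c"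
      using jointly_continuous_uniform[OF b(1) c(1)] by (simp add: eventually_nhds_conv_at)
    moreover have "\<forall>\<^sub>F t in at t0. L2_norm (\<lambda>x. f t x - f t0 x) < e / (2 * (B + 1))"
      using f e B by (intro order_tendstoD(2)[of _ 0]) (auto simp: L2_curve_def)
    ultimately show "\<forall>\<^sub>F t in at t0. dist (L2_norm (\<lambda>x. b t x * f t x - b t0 x * f t0 x)) 0 < e"
    proof eventually_elim
      case (elim t)
      have bt: "\<bar>b t x\<bar> \<le> B + 1" if "x \<in> {0..1}" for x
      proof -
        have "\<bar>b t x - b t0 x\<bar> < c" using elim(1) that by blast
        then show ?thesis using B(2)[OF that] c(2) by linarith
      qed
      note dL = L2_diff[OF L[of t] L[of t0]]
      have bdL: "(\<lambda>x. (b t x - b t0 x) * f t0 x) \<in> L2" by (rule L2_continuous_mult[OF bd L])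
      have "L2_norm (\<lambda>x. b t x * (f t x - f t0 x) + (b t x - b t0 x) * f t0 x) \<le>
        L2_norm (\<lambda>x. b t x * (f t x - f t0 x)) + L2_norm (\<lambda>x. (b t x - b t0 x) * f t0 x)"
        by (rule L2_norm_triangle[OF m[OF dL] bdL])
      moreover have "L2_norm (\<lambda>x. b t x * (f t x - f t0 x)) \<le> (B + 1) * L2_norm (\<lambda>x. f t x - f t0 x)"
        by (rule L2_norm_bounded_mult[OF dL m[OF dL] bt]) (use B in auto)
      moreover have "(B + 1) * L2_norm (\<lambda>x. f t x - f t0 x) < (B + 1) * (e / (2 * (B + 1)))"
        using elim(2) B by (intro mult_strict_left_mono) auto
      moreover have "(B + 1) * (e / (2 * (B + 1))) = e / 2" using B(1) by (simp add: field_simps)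
      moreover have "L2_norm (\<lambda>x. (b t x - b t0 x) * f t0 x) \<le> c * N"
        unfolding N_def by (rule L2_norm_bounded_mult[OF L bdL]) (use elim(1) c in \<open>auto intro: less_imp_le\<close>)
      moreover have "(\<lambda>x. b t x * (f t x - f t0 x) + (b t x - b t0 x) * f t0 x) = (\<lambda>x. b t x * f t x - b t0 x * f t0 x)"
        by (auto simp: algebra_simps)
      ultimately have "L2_norm (\<lambda>x. b t x * f t x - b t0 x * f t0 x) < e" using cN by simp
      then show ?case by (simp add: dist_real_def)
    qed
  qed
  then show ?thesis using m[OF L] by (simp add: L2_curve_def)
qed

section \<open>The flow and its inverse\<close>

text \<open>
  Here \<open>s\<close> is the logarithm of the Jacobian of the flow and \<open>a\<close> the amplitude of the velocity. The weak
  derivative \<open>k1\<close> of \<open>k\<close> is taken Borel measurable, so that its composition with the inverse flow is measurable.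
\<close>

locale muHS_flow = circle_density +
  fixes a :: "real \<Rightarrow> real" and A :: real and k1 :: "real \<Rightarrow> real" and s :: "real \<Rightarrow> real \<Rightarrow> real"
  assumes a_continuous: "continuous_on UNIV a"
    and k1: "k1 \<in> L2" "k1 \<in> borel_measurable borel" "has_weak_deriv k k1"
    and s_joint: "jointly_continuous s" and s_periodic: "periodic (s t)"
    and s_DERIV: "((\<lambda>t. s t x) has_real_derivative a t * drift (s t) x) (at t)"
    and s_0: "s 0 x = 0" and s_bound: "\<bar>s t x\<bar> \<le> 2 * A * \<bar>t\<bar>"
begin

text \<open>
  In terms of the flow \<open>q\<close>, \<open>rho\<close> is \<open>q_x\<close>, \<open>kap\<close> is \<open>K (t, q) * q_x\<close>, and \<open>P\<close> is \<open>w_x (t, q)\<close>.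
\<close>

definition rho :: "real \<Rightarrow> real \<Rightarrow> real" where "rho t x = exp (s t x)"
definition kap :: "real \<Rightarrow> real \<Rightarrow> real" where "kap t x = k x * exp (- s t x)"
definition P :: "real \<Rightarrow> real \<Rightarrow> real" where "P t x = drift (s t) x"

lemma s_continuous: "continuous_on UNIV (s t)"
  by (rule jointly_continuous_section(1)[OF s_joint])

lemma rho_pos: "0 < rho t x" by (simp add: rho_def)

lemma P_joint: "jointly_continuous P"
  using drift_jointly_continuous[OF s_joint] by (simp add: P_def[abs_def])

lemma rho_joint: "jointly_continuous rho"
  using s_joint unfolding jointly_continuous_def rho_def by (intro continuous_intros)

lemma kap_joint: "jointly_continuous kap"
  using s_joint unfolding jointly_continuous_def kap_def
  by (intro continuous_intros continuous_on_compose2[OF k_continuous]) auto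

lemma P_periodic: "periodic (P t)"
  using drift_periodic[OF s_continuous s_periodic] by (simp add: P_def[abs_def])

lemma rho_DERIV_t: "((\<lambda>t. rho t x) has_real_derivative a t * P t x * rho t x) (at t)"
  unfolding rho_def P_def by (rule derivative_eq_intros s_DERIV refl)+ simp

lemma kap_DERIV_t: "((\<lambda>t. kap t x) has_real_derivative - a t * P t x * kap t x) (at t)"
  unfolding kap_def P_def by (rule derivative_eq_intros s_DERIV refl)+ simp

lemmas joint_intros = jointly_continuous_compose[OF P_joint] jointly_continuous_compose[OF rho_joint]
  jointly_continuous_compose[OF kap_joint] jointly_continuous_compose[OF s_joint] continuous_on_compose2[OF a_continuous]

text \<open>
  The time derivative is the integral of \<open>a * P * rho\<close>, which vanishes by the choice of the constant in \<open>drift\<close>.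
\<close>

lemma rho_mass: "integral {0..1} (rho t) = 1"
proof -
  have "((\<lambda>t. integral {0..1} (rho t)) has_real_derivative integral {0..1} (\<lambda>x. a t * P t x * rho t x)) (at t)" for t
    by (rule leibniz_unit_interval[OF rho_DERIV_t])
      (auto simp: jointly_continuous_def intro!: continuous_intros joint_intros)
  moreover have "integral {0..1} (\<lambda>x. a t * P t x * rho t x) = 0" for t
    using drift_mean[OF s_continuous, of t] by (simp add: mult.assoc P_def rho_def mult.commute[of "drift (s t) _"])
  ultimately have "((\<lambda>t. integral {0..1} (rho t)) has_real_derivative 0) (at t)" for t by simp
  then have "integral {0..1} (rho t) = integral {0..1} (rho 0)" using DERIV_isconst_all by blast
  moreover have "rho 0 = (\<lambda>x. 1)" by (auto simp: rho_def s_0)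
  ultimately show ?thesis by simp
qed

text \<open>
  Let \<open>c\<close> be the mass. Then \<open>kap = c * (rho - P_x)\<close>, so the integral of \<open>P * kap\<close> is \<open>c\<close> times the integral of \<open>P * rho\<close>, which
  vanishes, minus \<open>c / 2\<close> times the increment of the periodic function \<open>P\<^sup>2\<close>.
\<close>

lemma kap_mass: "integral {0..1} (kap t) = 1"
proof -
  have "((\<lambda>t. integral {0..1} (kap t)) has_real_derivative integral {0..1} (\<lambda>x. - a t * P t x * kap t x)) (at t)" for t
    by (rule leibniz_unit_interval[OF kap_DERIV_t])
      (auto simp: jointly_continuous_def intro!: continuous_intros joint_intros)
  moreover have "integral {0..1} (\<lambda>x. - a t * P t x * kap t x) = 0" for t
  proof -
    define c where "c = integral {0..1} (kap t)"
    have c: "0 < c" unfolding c_def kap_def by (rule kappa_mass_pos[OF s_continuous])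
    have dP: "(P t has_real_derivative rho t x - kap t x / c) (at x)" for x
      using drift_DERIV[OF s_continuous, of t x] rho_mass[of t]
      by (simp add: P_def[abs_def] normal_rho_def normal_kappa_def rho_def[abs_def] kap_def[abs_def] c_def)
    have Pc: "continuous_on UNIV (P t)" by (rule jointly_continuous_section(1)[OF P_joint])
    have rc: "continuous_on UNIV (rho t)" by (rule jointly_continuous_section(1)[OF rho_joint])
    have kc: "continuous_on UNIV (kap t)" by (rule jointly_continuous_section(1)[OF kap_joint])
    have dc: "continuous_on UNIV (\<lambda>x. 2 * P t x * (rho t x - kap t x / c))"
      using c by (intro continuous_intros Pc rc kc) auto
    have dd: "((\<lambda>x. (P t x)\<^sup>2) has_real_derivative 2 * P t x * (rho t x - kap t x / c)) (at x)" for x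
      by (rule derivative_eq_intros dP refl)+ simp
    have "integral {0..1} (\<lambda>x. 2 * P t x * (rho t x - kap t x / c)) = (P t 1)\<^sup>2 - (P t 0)\<^sup>2"
      using circ_FTC[OF dc dd] integral_circ_eq_integral[OF dc] by simp
    moreover have "P t 1 = P t 0" using P_periodic[of t, unfolded periodic_def, rule_format, of 0] by simp
    moreover have "(\<lambda>x. 2 * P t x * (rho t x - kap t x / c)) = (\<lambda>x. 2 * (P t x * rho t x) - (2 / c) * (P t x * kap t x))"
      by (auto simp: algebra_simps)
    moreover have "integral {0..1} (\<lambda>x. 2 * (P t x * rho t x) - (2 / c) * (P t x * kap t x)) = 2 * integral {0..1} (\<lambda>x. P t x * rho t x) - (2 / c) * integral {0..1} (\<lambda>x. P t x * kap t x)"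
    proof -
      have "(\<lambda>x. 2 * (P t x * rho t x)) integrable_on {0..1}" "(\<lambda>x. (2 / c) * (P t x * kap t x)) integrable_on {0..1}"
        by (intro continuous_integrable_Icc continuous_intros Pc rc kc)+
      from Henstock_Kurzweil_Integration.integral_diff[OF this] show ?thesis
        by (simp only: integral_mult_right)
    qed
    moreover have "integral {0..1} (\<lambda>x. P t x * rho t x) = 0"
      using drift_mean[OF s_continuous, of t] by (simp add: P_def rho_def mult.commute)
    ultimately have "integral {0..1} (\<lambda>x. P t x * kap t x) = 0" using c by simp
    then show ?thesis by (simp add: mult.assoc)
  qed
  ultimately have "((\<lambda>t. integral {0..1} (kap t)) has_real_derivative 0) (at t)" for t by simp
  then have "integral {0..1} (kap t) = integral {0..1} (kap 0)" using DERIV_isconst_all by blast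
  moreover have "kap 0 = k" by (auto simp: kap_def s_0)
  ultimately show ?thesis by (simp add: k_integral)
qed

lemma P_DERIV: "(P t has_real_derivative rho t x - kap t x) (at x)"
  using drift_DERIV[OF s_continuous, of t x] rho_mass[of t] kap_mass[of t]
  by (simp add: P_def[abs_def] normal_rho_def normal_kappa_def rho_def[abs_def] kap_def[abs_def])

text \<open>
  The space derivative of \<open>s\<close>.
\<close>

definition sx :: "real \<Rightarrow> real \<Rightarrow> real" where
  "sx t x = primitive (\<lambda>r. a r * (rho r x - kap r x)) t"

lemma sx_joint: "jointly_continuous sx"
  unfolding sx_def[abs_def]
  by (rule jointly_continuous_primitive1) (auto simp: jointly_continuous_def intro!: continuous_intros joint_intros)

lemma s_DERIV_x: "(s t has_real_derivative sx t x) (at x)"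
proof -
  have j: "jointly_continuous (\<lambda>r x. a r * P r x)" "jointly_continuous (\<lambda>r x. a r * (rho r x - kap r x))"
    by (auto simp: jointly_continuous_def intro!: continuous_intros joint_intros)
  have "s t x = primitive (\<lambda>r. a r * P r x) t" for x
    using primitive_unique[OF jointly_continuous_section(2)[OF j(1)], of "\<lambda>t. s t x" x t] s_DERIV s_0 by (simp add: P_def)
  then have "s t = (\<lambda>x. primitive (\<lambda>r. a r * P r x) t)" by auto
  moreover have "((\<lambda>x. primitive (\<lambda>r. a r * P r x) t) has_real_derivative primitive (\<lambda>r. a r * (rho r x - kap r x)) t) (at x)"
    by (rule primitive_DERIV_parameter[OF _ j]) (auto intro!: derivative_eq_intros P_DERIV)
  ultimately show ?thesis by (simp add: sx_def)
qed

text \<open>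
  The velocity \<open>w\<close> at the particle \<open>x\<close>: the primitive of its \<open>x\<close>-derivative \<open>P * rho\<close>, with the constant for which \<open>w\<close> has
  mean one.
\<close>

definition U :: "real \<Rightarrow> real \<Rightarrow> real" where
  "U t x = primitive (\<lambda>z. P t z * rho t z) x + (1 - integral {0..1} (\<lambda>x. rho t x * primitive (\<lambda>z. P t z * rho t z) x))"

lemma U_joint: "jointly_continuous U"
proof -
  have h: "jointly_continuous (\<lambda>t x. primitive (\<lambda>z. P t z * rho t z) x)"
    by (rule jointly_continuous_primitive2) (auto simp: jointly_continuous_def intro!: continuous_intros joint_intros)
  have "continuous_on UNIV (\<lambda>t. integral {0..1} (\<lambda>x. rho t x * primitive (\<lambda>z. P t z * rho t z) x))"
    by (intro continuous_on_parametric_integral continuous_intros joint_intros jointly_continuous_compose[OF h])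
  then show ?thesis unfolding U_def[abs_def] jointly_continuous_def
    by (intro continuous_intros jointly_continuous_compose[OF h]
      continuous_on_compose2[of UNIV "\<lambda>t. integral {0..1} (\<lambda>x. rho t x * primitive (\<lambda>z. P t z * rho t z) x)" UNIV fst]) auto
qed

lemma section_continuous:
  "continuous_on S (P t)" "continuous_on S (rho t)" "continuous_on S (kap t)" "continuous_on S (U t)" "continuous_on S (s t)" "continuous_on S (sx t)"
  by (rule jointly_continuous_section(1)[OF P_joint] jointly_continuous_section(1)[OF rho_joint]
      jointly_continuous_section(1)[OF kap_joint] jointly_continuous_section(1)[OF U_joint]
      jointly_continuous_section(1)[OF s_joint] jointly_continuous_section(1)[OF sx_joint])+

lemma U_DERIV: "(U t has_real_derivative P t x * rho t x) (at x)"
proof -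
  have "continuous_on UNIV (\<lambda>z. P t z * rho t z)" by (intro continuous_intros section_continuous)
  from primitive_DERIV[OF this] show ?thesis unfolding U_def[abs_def] by (auto intro!: derivative_eq_intros)
qed

lemma rho_periodic: "periodic (rho t)" and kap_periodic: "periodic (kap t)"
  using s_periodic[of t] k_periodic by (auto simp: periodic_def rho_def kap_def)

lemma U_periodic: "periodic (U t)"
proof (rule periodic_primitive[OF _ _ U_DERIV])
  show "periodic (\<lambda>x. P t x * rho t x)" using P_periodic[of t] rho_periodic[of t] by (simp add: periodic_def)
  show c: "continuous_on UNIV (\<lambda>x. P t x * rho t x)" by (intro continuous_intros section_continuous)
  show "(\<integral>x. P t x * rho t x \<partial>circ) = 0"
    unfolding integral_circ_eq_integral[OF c]
    using drift_mean[OF s_continuous, of t] by (simp add: P_def rho_def mult.commute)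
qed

lemma U_mean: "integral {0..1} (\<lambda>x. U t x * rho t x) = 1"
proof -
  define H where "H = primitive (\<lambda>z. P t z * rho t z)"
  define c where "c = integral {0..1} (\<lambda>x. rho t x * H x)"
  have "continuous_on UNIV (\<lambda>z. P t z * rho t z)" by (intro continuous_intros section_continuous)
  then have Hc: "continuous_on UNIV H" unfolding H_def by (rule DERIV_continuous_UNIV[OF primitive_DERIV])
  have "(\<lambda>x. U t x * rho t x) = (\<lambda>x. rho t x * H x + (1 - c) * rho t x)"
    by (auto simp: U_def H_def c_def algebra_simps)
  moreover have "integral {0..1} (\<lambda>x. rho t x * H x + (1 - c) * rho t x) = c + (1 - c) * 1"
    using rho_mass[of t] by (subst Henstock_Kurzweil_Integration.integral_add)
      (auto simp: c_def intro!: continuous_integrable_Icc continuous_intros section_continuous Hc)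
  ultimately show ?thesis by simp
qed

definition q :: "real \<Rightarrow> real \<Rightarrow> real" where
  "q t x = x + primitive (\<lambda>r. a r * U r x) t"

lemma aU_joint: "jointly_continuous (\<lambda>r x. a r * U r x)"
  by (auto simp: jointly_continuous_def intro!: continuous_intros joint_intros jointly_continuous_compose[OF U_joint])

lemma q_joint: "jointly_continuous q"
  using jointly_continuous_primitive1[OF aU_joint] unfolding jointly_continuous_def q_def by (intro continuous_intros)

lemma q_DERIV_t: "((\<lambda>t. q t x) has_real_derivative a t * U t x) (at t)"
  unfolding q_def using primitive_DERIV[OF jointly_continuous_section(2)[OF aU_joint], of x t]
  by (auto intro!: derivative_eq_intros)

text \<open>
  Both \<open>1\<close> plus the time integral of \<open>a * P * rho\<close> and \<open>rho\<close> itself start from \<open>1\<close> and have the same time derivative.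
\<close>

lemma q_DERIV: "(q t has_real_derivative rho t x) (at x)"
proof -
  have j: "jointly_continuous (\<lambda>r x. a r * P r x * rho r x)"
    by (auto simp: jointly_continuous_def intro!: continuous_intros joint_intros)
  have "((\<lambda>x. primitive (\<lambda>r. a r * U r x) t) has_real_derivative primitive (\<lambda>r. a r * P r x * rho r x) t) (at x)"
    by (rule primitive_DERIV_parameter[OF _ aU_joint j]) (auto intro!: derivative_eq_intros U_DERIV)
  moreover have "primitive (\<lambda>r. a r * P r x * rho r x) t = rho t x - 1"
    using primitive_unique[OF jointly_continuous_section(2)[OF j], of "\<lambda>t. rho t x" x t] rho_DERIV_t s_0
    by (simp add: rho_def)
  ultimately show ?thesis unfolding q_def[abs_def] by (auto intro!: derivative_eq_intros)
qed

lemma q_shift: "q t (x + 1) = q t x + 1"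
  using U_periodic by (simp add: q_def periodic_def)

lemma q_0: "q 0 x = x" by (simp add: q_def)

lemma q_strict_mono: "strict_mono (q t)"
  by (rule strict_monoI, rule DERIV_pos_imp_increasing) (use q_DERIV rho_pos in blast)+

lemma q_continuous: "continuous_on S (q t)"
  by (rule jointly_continuous_section(1)[OF q_joint])

lemma q_bij: "bij (q t)"
proof (rule bijI)
  show "inj (q t)" using q_strict_mono by (rule strict_mono_imp_inj_on)
  have int: "q t (x + of_int n) = q t x + of_int n" for x n
  proof -
    have "periodic (\<lambda>x. q t x - x)" by (simp add: periodic_def q_shift)
    from periodic_int[OF this, of x n] show ?thesis by simp
  qed
  have "\<exists>x. q t x = z" for z
  proof -
    define n where "n = \<lfloor>z - q t 0\<rfloor>"
    have "q t (of_int n) \<le> z" "z \<le> q t (of_int n + 1)"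
      using int[of 0 n] q_shift[of t "of_int n"] unfolding n_def by simp_all linarith+
    then have "\<exists>x. of_int n \<le> x \<and> x \<le> of_int n + 1 \<and> q t x = z"
      by (intro IVT') (auto intro: q_continuous)
    then show ?thesis by blast
  qed
  then show "surj (q t)" unfolding surj_def by metis
qed

definition p :: "real \<Rightarrow> real \<Rightarrow> real" where "p t z = inv (q t) z"

lemma q_p: "q t (p t z) = z" and p_q: "p t (q t x) = x"
  using q_bij[of t] by (auto simp: p_def bij_def surj_f_inv_f)

lemma p_shift: "p t (z + 1) = p t z + 1"
proof -
  have "q t (p t z + 1) = z + 1" by (simp add: q_shift q_p)
  then show ?thesis using p_q[of t "p t z + 1"] by simp
qed

lemma p_0: "p 0 z = z" using q_p[of 0 z] by (simp add: q_0)

lemma less_p_iff: "l < p t z \<longleftrightarrow> q t l < z" and p_less_iff: "p t z < l \<longleftrightarrow> z < q t l"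
  using strict_mono_less[OF q_strict_mono, of t l "p t z"] strict_mono_less[OF q_strict_mono, of t "p t z" l]
  by (auto simp: q_p)

text \<open>
  By monotonicity \<open>l < p t z\<close> means \<open>q t l < z\<close>, an open condition on \<open>t\<close> and \<open>z\<close>.
\<close>

lemma p_joint: "jointly_continuous p"
  unfolding jointly_continuous_def
proof (rule continuous_at_imp_continuous_on, intro ballI)
  fix y :: "real \<times> real"
  have lim: "((\<lambda>y. snd y - q (fst y) l) \<longlongrightarrow> snd y - q (fst y) l) (nhds y)" for l
  proof -
    have "continuous_on UNIV (\<lambda>y. snd y - q (fst y) l)"
      by (intro continuous_intros jointly_continuous_compose[OF q_joint])
    then have "isCont (\<lambda>y. snd y - q (fst y) l) y" by (simp only: continuous_on_eq_continuous_at open_UNIV) blast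
    then show ?thesis
      unfolding isCont_def by (rule tendsto_at_iff_tendsto_nhds[of "\<lambda>y. snd y - q (fst y) l" y, THEN iffD1])
  qed
  have "((\<lambda>y. p (fst y) (snd y)) \<longlongrightarrow> p (fst y) (snd y)) (nhds y)"
  proof (rule order_tendstoI)
    fix l assume "l < p (fst y) (snd y)"
    then have "0 < snd y - q (fst y) l" by (simp add: less_p_iff)
    from order_tendstoD(1)[OF lim this] show "\<forall>\<^sub>F y in nhds y. l < p (fst y) (snd y)"
      by eventually_elim (simp add: less_p_iff)
  next
    fix l assume "p (fst y) (snd y) < l"
    then have "snd y - q (fst y) l < 0" by (simp add: p_less_iff)
    from order_tendstoD(2)[OF lim this] show "\<forall>\<^sub>F y in nhds y. p (fst y) (snd y) < l"
      by eventually_elim (simp add: p_less_iff)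
  qed
  then show "isCont (\<lambda>y. p (fst y) (snd y)) y"
    unfolding isCont_def by (rule tendsto_at_iff_tendsto_nhds[of "\<lambda>y. p (fst y) (snd y)" y, THEN iffD2])
qed

lemma p_continuous: "continuous_on S (p t)"
  by (rule jointly_continuous_section(1)[OF p_joint])

lemma p_DERIV: "(p t has_real_derivative exp (- s t (p t z))) (at z)"
proof -
  have "(p t has_real_derivative inverse (rho t (p t z))) (at z)"
  proof (rule DERIV_inverse_function)
    show "(q t has_real_derivative rho t (p t z)) (at (p t z))" by (rule q_DERIV)
    show "isCont (p t) z" using p_continuous[of UNIV t] by (simp add: continuous_on_eq_continuous_at)
    show "q t (p t y) = y" if "z - 1 < y" "y < z + 1" for y by (rule q_p)
  qed (use rho_pos[of t "p t z"] in auto)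
  then show ?thesis by (simp add: rho_def exp_minus)
qed

section \<open>Return to the circle\<close>

text \<open>
  The velocity, its slope and the transported quantity \<open>K\<close> as functions on the circle. The last function is the space
  derivative of \<open>K\<close>; it contains \<open>k1\<close> and is therefore only square integrable.
\<close>

definition w :: "real \<Rightarrow> real \<Rightarrow> real" where "w t z = U t (p t z)"
definition w1 :: "real \<Rightarrow> real \<Rightarrow> real" where "w1 t z = P t (p t z)"
definition K :: "real \<Rightarrow> real \<Rightarrow> real" where "K t z = exp (- 2 * s t (p t z)) * k (p t z)"
definition K1 :: "real \<Rightarrow> real \<Rightarrow> real" where
  "K1 t z = - 2 * sx t (p t z) * exp (- 3 * s t (p t z)) * k (p t z) + exp (- 3 * s t (p t z)) * k1 (p t z)"

lemmas comp_intros = jointly_continuous_compose[OF p_joint] jointly_continuous_compose[OF U_joint]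
  jointly_continuous_compose[OF sx_joint] continuous_on_compose2[OF k_continuous]

lemma Euler_joint: "jointly_continuous w" "jointly_continuous w1" "jointly_continuous K"
  unfolding w_def[abs_def] w1_def[abs_def] K_def[abs_def] jointly_continuous_def
  by (intro continuous_intros joint_intros comp_intros; auto)+

lemma periodic_p: "periodic f \<Longrightarrow> periodic (\<lambda>z. f (p t z))"
  by (simp add: periodic_def p_shift)

lemma sx_periodic: "periodic (sx t)"
  using rho_periodic kap_periodic by (simp add: periodic_def sx_def)

lemma Euler_periodic: "periodic (w t)" "periodic (w1 t)" "periodic (K t)"
  using U_periodic[of t] P_periodic[of t] s_periodic[of t] k_periodic
  by (auto simp: periodic_def w_def w1_def K_def p_shift)

lemma w_DERIV: "(w t has_real_derivative w1 t z) (at z)"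
proof -
  have "(w t has_real_derivative P t (p t z) * rho t (p t z) * exp (- s t (p t z))) (at z)"
    unfolding w_def[abs_def] by (rule DERIV_chain2[OF U_DERIV p_DERIV])
  moreover have "rho t x * exp (- s t x) = 1" for x by (simp add: rho_def exp_add[symmetric])
  ultimately show ?thesis by (simp add: w1_def mult.assoc)
qed

text \<open>
  This is the relation \<open>A w = K\<close> for a function \<open>w\<close> of mean one.
\<close>

lemma w1_DERIV: "(w1 t has_real_derivative 1 - K t z) (at z)"
proof -
  have d: "(w1 t has_real_derivative (rho t (p t z) - kap t (p t z)) * exp (- s t (p t z))) (at z)"
    unfolding w1_def[abs_def] by (rule DERIV_chain2[OF P_DERIV p_DERIV])
  have "exp (- 2 * s t (p t z)) = exp (- s t (p t z)) * exp (- s t (p t z))"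
    by (simp add: exp_add[symmetric])
  then have "(rho t (p t z) - kap t (p t z)) * exp (- s t (p t z)) = 1 - K t z"
    by (simp add: rho_def kap_def K_def left_diff_distrib exp_minus)
  then show ?thesis using d by simp
qed

lemma circle_substitution_q:
  assumes "periodic g" "continuous_on UNIV g"
  shows "integral {0..1} g = integral {0..1} (\<lambda>x. g (q t x) * rho t x)"
  by (rule circle_substitution[OF assms q_DERIV section_continuous(2)]) (use q_shift[of t 0] in simp)

lemma w_mean: "integral {0..1} (w t) = 1"
  using circle_substitution_q[OF Euler_periodic(1)[of t] jointly_continuous_section(1)[OF Euler_joint(1)], of t]
    U_mean[of t] by (simp add: w_def p_q)

lemma compose_p:
  assumes "g \<in> L2" "g \<in> borel_measurable borel"
  shows "(\<lambda>z. g (p t z)) \<in> L2" "L2_norm (\<lambda>z. g (p t z)) \<le> sqrt (2 * exp (2 * A * \<bar>t\<bar>)) * L2_norm g"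
proof -
  have m: "exp (- (2 * A * \<bar>t\<bar>)) \<le> exp (- s t (p t z))" for z
    using s_bound[of t "p t z"] by (simp add: abs_le_iff)
  have c: "continuous_on UNIV (\<lambda>z. exp (- s t (p t z)))" by (intro continuous_intros continuous_on_compose2[OF section_continuous(5)] p_continuous) auto
  note L = L2_compose[OF p_DERIV c m exp_gt_zero p_shift assms]
  show "(\<lambda>z. g (p t z)) \<in> L2" by (rule L(1))
  have "2 / exp (- (2 * A * \<bar>t\<bar>)) = 2 * exp (2 * A * \<bar>t\<bar>)" by (simp add: exp_minus divide_inverse)
  then show "L2_norm (\<lambda>z. g (p t z)) \<le> sqrt (2 * exp (2 * A * \<bar>t\<bar>)) * L2_norm g"
    using L(2) by simp
qed

lemma k_L2: "k \<in> L2" and k_borel: "k \<in> borel_measurable borel"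
  using k_periodic k_continuous by (auto intro: L2_continuous borel_measurable_continuous_onI)

lemma jacobian_props:
  "periodic (\<lambda>z. exp (- s t (p t z)))" "continuous_on UNIV (\<lambda>z. exp (- s t (p t z)))"
  "\<bar>exp (- s t (p t z))\<bar> \<le> exp (2 * A * \<bar>t\<bar>)"
proof -
  show "periodic (\<lambda>z. exp (- s t (p t z)))" using s_periodic[of t] by (simp add: periodic_def p_shift)
  show "continuous_on UNIV (\<lambda>z. exp (- s t (p t z)))" by (intro continuous_intros continuous_on_compose2[OF section_continuous(5)] p_continuous) auto
  show "\<bar>exp (- s t (p t z))\<bar> \<le> exp (2 * A * \<bar>t\<bar>)" using s_bound[of t "p t z"] by (simp add: abs_le_iff)
qed

text \<open>
  The chain rule holds for smooth approximations of \<open>k\<close>, and \<open>L2_compose\<close> bounds the errors after the composition.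
\<close>

lemma k_p_weak_deriv: "has_weak_deriv (\<lambda>z. k (p t z)) (\<lambda>z. exp (- s t (p t z)) * k1 (p t z))"
proof -
  define C where "C = sqrt (2 * exp (2 * A * \<bar>t\<bar>))"
  define M where "M = exp (2 * A * \<bar>t\<bar>)"
  have C: "0 < C" and M: "0 < M" by (auto simp: C_def M_def)
  have jL: "g \<in> L2 \<Longrightarrow> (\<lambda>z. exp (- s t (p t z)) * g z) \<in> L2" for g
    using L2_continuous_mult[OF jacobian_props(1,2)] .
  note kL = compose_p(1)[OF k_L2 k_borel, of t] and k1L = jL[OF compose_p(1)[OF k1(1,2), of t]]
  show ?thesis
  proof (rule weak_deriv_limit[OF kL k1L])
    fix e :: real assume e: "0 < e"
    define d where "d = e / (C * (M + 1))"
    have d: "0 < d" using e C M by (simp add: d_def)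
    have "C * d = e / (M + 1)" using C by (simp add: d_def)
    moreover have "e / (M + 1) < e" "M * (e / (M + 1)) < e" using e M by (auto simp: divide_less_eq)
    ultimately have Cd: "C * d < e" "M * (C * d) < e" by simp_all
    obtain F \<phi> where F: "smooth_periodic F" "smooth_periodic \<phi>" "\<forall>x. (F has_real_derivative \<phi> x) (at x)"
       "L2_norm (\<lambda>x. k1 x - \<phi> x) < d" "L2_norm (\<lambda>x. k x - F x) < d"
      by (rule weak_deriv_approx[OF k_L2 k1(1,3) d])
    note FL = smooth_periodic_L2[OF F(1)] smooth_periodic_L2[OF F(2)]
    note Fb = borel_measurable_continuous_onI[OF smooth_periodicD(3)[OF F(1)]] borel_measurable_continuous_onI[OF smooth_periodicD(3)[OF F(2)]]
    note FpL = compose_p(1)[OF FL(1) Fb(1), of t] and \<phi>pL = jL[OF compose_p(1)[OF FL(2) Fb(2), of t]]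
    have w: "has_weak_deriv (\<lambda>z. F (p t z)) (\<lambda>z. exp (- s t (p t z)) * \<phi> (p t z))"
    proof (rule weak_deriv_C1)
      show "periodic (\<lambda>z. F (p t z))" by (rule periodic_p[OF smooth_periodicD(1)[OF F(1)]])
      show "((\<lambda>z. F (p t z)) has_real_derivative exp (- s t (p t z)) * \<phi> (p t z)) (at z)" for z
        using DERIV_chain2[OF F(3)[rule_format] p_DERIV[of t z]] by (simp add: mult.commute)
      show "continuous_on UNIV (\<lambda>z. exp (- s t (p t z)) * \<phi> (p t z))"
        by (intro continuous_on_mult jacobian_props continuous_on_compose2[OF smooth_periodicD(3)[OF F(2)]] p_continuous) auto
    qed
    have n1: "L2_norm (\<lambda>z. k (p t z) - F (p t z)) < e"
    proof -
      have "L2_norm (\<lambda>z. k (p t z) - F (p t z)) \<le> C * L2_norm (\<lambda>x. k x - F x)"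
        unfolding C_def by (rule compose_p(2)[OF L2_diff[OF k_L2 FL(1)] borel_measurable_diff[OF k_borel Fb(1)]])
      also have "\<dots> \<le> C * d" using C F(5) by (intro mult_left_mono) auto
      finally show ?thesis using Cd by simp
    qed
    have n2: "L2_norm (\<lambda>z. exp (- s t (p t z)) * k1 (p t z) - exp (- s t (p t z)) * \<phi> (p t z)) < e"
    proof -
      note dL = compose_p[OF L2_diff[OF k1(1) FL(2)] borel_measurable_diff[OF k1(2) Fb(2)], of t]
      have "L2_norm (\<lambda>z. exp (- s t (p t z)) * (k1 (p t z) - \<phi> (p t z))) \<le> M * L2_norm (\<lambda>z. k1 (p t z) - \<phi> (p t z))"
        unfolding M_def by (rule L2_norm_bounded_mult[OF dL(1) jL[OF dL(1)] jacobian_props(3)]) simp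
      also have "\<dots> \<le> M * (C * L2_norm (\<lambda>x. k1 x - \<phi> x))"
        using M dL(2) by (intro mult_left_mono) (auto simp: C_def)
      also have "\<dots> \<le> M * (C * d)" using C M F(4) by (intro mult_left_mono) auto
      finally show ?thesis using Cd by (simp add: right_diff_distrib)
    qed
    show "\<exists>F \<phi>. F \<in> L2 \<and> \<phi> \<in> L2 \<and> has_weak_deriv F \<phi> \<and> L2_norm (\<lambda>x. k (p t x) - F x) < e \<and>
        L2_norm (\<lambda>x. exp (- s t (p t x)) * k1 (p t x) - \<phi> x) < e"
      using w n1 n2 FpL \<phi>pL
      by (intro exI[of _ "\<lambda>z. F (p t z)"] exI[of _ "\<lambda>z. exp (- s t (p t z)) * \<phi> (p t z)"] conjI)
  qed
qed

lemma K_weak_deriv: "has_weak_deriv (K t) (K1 t)"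
proof -
  define b where "b = (\<lambda>z. exp (- 2 * s t (p t z)))"
  define b' where "b' = (\<lambda>z. exp (- 2 * s t (p t z)) * (- 2 * (sx t (p t z) * exp (- s t (p t z)))))"
  have kL: "(\<lambda>z. k (p t z)) \<in> L2" "(\<lambda>z. exp (- s t (p t z)) * k1 (p t z)) \<in> L2"
    by (rule compose_p(1)[OF k_L2 k_borel] L2_continuous_mult[OF jacobian_props(1,2) compose_p(1)[OF k1(1,2)]])+
  have "has_weak_deriv (\<lambda>z. b z * k (p t z)) (\<lambda>z. b' z * k (p t z) + b z * (exp (- s t (p t z)) * k1 (p t z)))"
  proof (rule weak_deriv_mult_C1[OF kL k_p_weak_deriv])
    show "periodic b" unfolding b_def using s_periodic[of t] by (simp add: periodic_def p_shift)
    show "(b has_real_derivative b' z) (at z)" for z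
      unfolding b_def b'_def by (rule derivative_eq_intros DERIV_chain2[OF s_DERIV_x p_DERIV] refl)+ simp
    show "continuous_on UNIV b'"
      unfolding b'_def by (intro continuous_intros continuous_on_compose2[OF section_continuous(5)] continuous_on_compose2[OF section_continuous(6)] p_continuous) auto
  qed
  moreover have "(\<lambda>z. b z * k (p t z)) = K t" by (auto simp: b_def K_def)
  moreover have "(\<lambda>z. b' z * k (p t z) + b z * (exp (- s t (p t z)) * k1 (p t z))) = K1 t"
  proof
    fix z
    have e: "exp (- 3 * s t (p t z)) = exp (- 2 * s t (p t z)) * exp (- s t (p t z))" by (simp add: exp_add[symmetric])
    show "b' z * k (p t z) + b z * (exp (- s t (p t z)) * k1 (p t z)) = K1 t z"
      unfolding b_def b'_def K1_def e by (simp add: algebra_simps)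
  qed
  ultimately show ?thesis by simp
qed

text \<open>
  For a smooth function in place of \<open>k1\<close> the continuity is uniform in space. The error of a smooth
  approximation stays small under the composition with \<open>p t\<close>, uniformly for \<open>t\<close> near \<open>t0\<close>, by \<open>L2_compose\<close>.
\<close>

lemma k1_p_curve: "L2_curve (\<lambda>t z. k1 (p t z))"
proof -
  have L: "(\<lambda>z. k1 (p t z)) \<in> L2" for t by (rule compose_p(1)[OF k1(1,2)])
  have "((\<lambda>t. L2_norm (\<lambda>z. k1 (p t z) - k1 (p t0 z))) \<longlongrightarrow> 0) (at t0)" for t0
  proof (rule tendstoI)
    fix e :: real assume e: "0 < e"
    define C where "C = sqrt (2 * exp (2 * \<bar>A\<bar> * (\<bar>t0\<bar> + 1)))"
    have C: "0 < C" by (simp add: C_def)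
    obtain \<phi> where \<phi>: "smooth_periodic \<phi>" "L2_norm (\<lambda>x. k1 x - \<phi> x) < e / (4 * C)"
      using L2_dense[OF k1(1), of "e / (4 * C)"] e C by auto
    note \<phi>L = smooth_periodic_L2[OF \<phi>(1)] and \<phi>b = borel_measurable_continuous_onI[OF smooth_periodicD(3)[OF \<phi>(1)]]
    note dL = compose_p[OF L2_diff[OF k1(1) \<phi>L] borel_measurable_diff[OF k1(2) \<phi>b]]
    have pL: "(\<lambda>z. \<phi> (p t z)) \<in> L2" for t by (rule compose_p(1)[OF \<phi>L \<phi>b])
    have close: "L2_norm (\<lambda>z. k1 (p t z) - \<phi> (p t z)) \<le> e / 4" if "\<bar>t\<bar> \<le> \<bar>t0\<bar> + 1" for t
    proof -
      have "2 * A * \<bar>t\<bar> \<le> 2 * \<bar>A\<bar> * (\<bar>t0\<bar> + 1)" using that by (rule mult_mono[rotated]) auto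
      then have "sqrt (2 * exp (2 * A * \<bar>t\<bar>)) \<le> C" by (simp add: C_def)
      then have "L2_norm (\<lambda>z. k1 (p t z) - \<phi> (p t z)) \<le> C * L2_norm (\<lambda>x. k1 x - \<phi> x)"
        using dL(2)[of t] by (meson L2_norm_nonneg mult_right_mono order_trans)
      also have "\<dots> \<le> C * (e / (4 * C))" using C \<phi>(2) by (intro mult_left_mono) auto
      finally show ?thesis using C by simp
    qed
    have "jointly_continuous (\<lambda>t z. \<phi> (p t z))"
      unfolding jointly_continuous_def
      by (intro continuous_on_compose2[OF smooth_periodicD(3)[OF \<phi>(1)]] jointly_continuous_compose[OF p_joint] continuous_intros) auto
    then have "L2_curve (\<lambda>t z. \<phi> (p t z))"
      by (rule L2_curve_jointly_continuous) (rule periodic_p[OF smooth_periodicD(1)[OF \<phi>(1)]])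
    then have "((\<lambda>t. L2_norm (\<lambda>z. \<phi> (p t z) - \<phi> (p t0 z))) \<longlongrightarrow> 0) (at t0)" by (simp add: L2_curve_def)
    then have "\<forall>\<^sub>F t in at t0. L2_norm (\<lambda>z. \<phi> (p t z) - \<phi> (p t0 z)) < e / 4"
      using e by (intro order_tendstoD(2)) auto
    moreover have "\<forall>\<^sub>F t in at t0. t \<in> {t0 - 1<..<t0 + 1}"
      by (intro eventually_at_in_open') auto
    ultimately show "\<forall>\<^sub>F t in at t0. dist (L2_norm (\<lambda>z. k1 (p t z) - k1 (p t0 z))) 0 < e"
    proof eventually_elim
      case (elim t)
      have "L2_norm (\<lambda>z. k1 (p t z) - k1 (p t0 z)) \<le> L2_norm (\<lambda>z. k1 (p t z) - \<phi> (p t z)) +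
         (L2_norm (\<lambda>z. \<phi> (p t z) - \<phi> (p t0 z)) + L2_norm (\<lambda>z. \<phi> (p t0 z) - k1 (p t0 z)))"
        using L2_norm_diff_triangle[OF L[of t] pL[of t] L[of t0]] L2_norm_diff_triangle[OF pL[of t] pL[of t0] L[of t0]] by linarith
      moreover have "L2_norm (\<lambda>z. k1 (p t z) - \<phi> (p t z)) \<le> e / 4" using elim by (intro close) auto
      moreover have "L2_norm (\<lambda>z. \<phi> (p t0 z) - k1 (p t0 z)) \<le> e / 4"
        using close[of t0] by (subst L2_norm_minus_commute) simp
      ultimately show ?case using elim(1) e by (simp add: dist_real_def)
    qed
  qed
  then show ?thesis using L by (simp add: L2_curve_def)
qed

lemma K1_curve: "L2_curve K1"
proof -
  have j: "jointly_continuous (\<lambda>t z. - 2 * sx t (p t z) * exp (- 3 * s t (p t z)) * k (p t z))"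
    "jointly_continuous (\<lambda>t z. exp (- 3 * s t (p t z)))"
    unfolding jointly_continuous_def by (intro continuous_intros joint_intros comp_intros; auto)+
  have "L2_curve (\<lambda>t z. (- 2 * sx t (p t z) * exp (- 3 * s t (p t z)) * k (p t z)) + exp (- 3 * s t (p t z)) * k1 (p t z))"
  proof (rule L2_curve_add[OF L2_curve_jointly_continuous[OF j(1)] L2_curve_mult[OF j(2) _ k1_p_curve]])
    show "periodic (\<lambda>z. - 2 * sx t (p t z) * exp (- 3 * s t (p t z)) * k (p t z))"
      "periodic (\<lambda>z. exp (- 3 * s t (p t z)))" for t
      using sx_periodic[of t] s_periodic[of t] k_periodic by (auto simp: periodic_def p_shift)
  qed
  then show ?thesis by (simp add: K1_def[abs_def])
qed

lemma Euler_continuous: "continuous_on S (w t)" "continuous_on S (w1 t)" "continuous_on S (K t)"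
  by (rule jointly_continuous_section(1)[OF Euler_joint(1)] jointly_continuous_section(1)[OF Euler_joint(2)]
      jointly_continuous_section(1)[OF Euler_joint(3)])+

text \<open>
  In the coordinates of the flow the integral of \<open>K * \<phi>\<close> becomes that of \<open>kap * \<phi> (q)\<close>, where both factors are
  differentiable in time although \<open>K\<close>, at a fixed point of the circle, need not be.
\<close>

lemma K_evolution:
  assumes \<phi>: "periodic \<phi>" "\<And>x. (\<phi> has_real_derivative \<phi>' x) (at x)" "continuous_on UNIV \<phi>'"
  shows "((\<lambda>t. integral {0..1} (\<lambda>z. K t z * \<phi> z)) has_real_derivative
      a t * integral {0..1} (\<lambda>z. K t z * (w t z * \<phi>' z - w1 t z * \<phi> z))) (at t)"
proof -
  have \<phi>c: "continuous_on UNIV \<phi>" by (rule DERIV_continuous_UNIV[OF \<phi>(2)])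
  have \<phi>'p: "periodic \<phi>'" by (rule periodic_deriv[OF \<phi>(1,2)])
  have Krho: "K t (q t x) * rho t x = kap t x" for t x
  proof -
    have "exp (- 2 * s t x) = exp (- s t x) * exp (- s t x)" by (simp add: exp_add[symmetric])
    then show ?thesis by (simp add: K_def p_q rho_def kap_def exp_minus)
  qed
  have Lagrange: "integral {0..1} (\<lambda>z. K t z * g z) = integral {0..1} (\<lambda>x. kap t x * g (q t x))"
    if g: "periodic g" "continuous_on UNIV g" for g t
  proof -
    have "integral {0..1} (\<lambda>z. K t z * g z) = integral {0..1} (\<lambda>x. (K t (q t x) * g (q t x)) * rho t x)"
      using g Euler_periodic(3)[of t] by (intro circle_substitution_q continuous_intros Euler_continuous) (auto simp: periodic_def)
    also have "(\<lambda>x. (K t (q t x) * g (q t x)) * rho t x) = (\<lambda>x. kap t x * g (q t x))"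
      by (simp add: Krho[symmetric] mult_ac)
    finally show ?thesis .
  qed
  have "((\<lambda>t. integral {0..1} (\<lambda>x. kap t x * \<phi> (q t x))) has_real_derivative
      integral {0..1} (\<lambda>x. a t * (kap t x * (U t x * \<phi>' (q t x) - P t x * \<phi> (q t x))))) (at t)"
  proof (rule leibniz_unit_interval)
    show "((\<lambda>t. kap t x * \<phi> (q t x)) has_real_derivative a t * (kap t x * (U t x * \<phi>' (q t x) - P t x * \<phi> (q t x)))) (at t)" for t x
      by (rule derivative_eq_intros kap_DERIV_t DERIV_chain2[OF \<phi>(2) q_DERIV_t] refl)+ (simp add: algebra_simps)
    show "continuous_on UNIV (\<lambda>x. kap t x * \<phi> (q t x))" for t
      by (intro continuous_intros section_continuous continuous_on_compose2[OF \<phi>c] q_continuous) auto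
    show "jointly_continuous (\<lambda>t x. a t * (kap t x * (U t x * \<phi>' (q t x) - P t x * \<phi> (q t x))))"
      unfolding jointly_continuous_def
      by (intro continuous_intros joint_intros comp_intros continuous_on_compose2[OF \<phi>c] continuous_on_compose2[OF \<phi>(3)]
          jointly_continuous_compose[OF q_joint]) auto
  qed
  moreover have "integral {0..1} (\<lambda>x. a t * (kap t x * (U t x * \<phi>' (q t x) - P t x * \<phi> (q t x)))) =
      a t * integral {0..1} (\<lambda>z. K t z * (w t z * \<phi>' z - w1 t z * \<phi> z))"
  proof -
    have "integral {0..1} (\<lambda>z. K t z * (w t z * \<phi>' z - w1 t z * \<phi> z)) =
       integral {0..1} (\<lambda>x. kap t x * (w t (q t x) * \<phi>' (q t x) - w1 t (q t x) * \<phi> (q t x)))"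
      using Euler_periodic[of t] \<phi>(1) \<phi>'p
      by (intro Lagrange continuous_intros Euler_continuous \<phi>c \<phi>(3)) (auto simp: periodic_def)
    then show ?thesis by (simp add: w_def w1_def p_q)
  qed
  ultimately show ?thesis by (simp only: Lagrange[OF \<phi>(1) \<phi>c])
qed

end

section \<open>The global solution\<close>

lemma less_3_cases: "j < 3 \<longleftrightarrow> j = 0 \<or> j = 1 \<or> j = (2::nat)"
  by auto

lemma deriv_chain_mono: "deriv_chain n E \<Longrightarrow> i \<le> n \<Longrightarrow> deriv_chain i E"
  by (auto simp: deriv_chain_def)

text \<open>
  Only the mean and the highest derivative have to be examined.
\<close>

lemma sobolev_tendsto_0:
  fixes E :: "real \<Rightarrow> nat \<Rightarrow> real \<Rightarrow> real"
  assumes "\<And>s. deriv_chain n (E s)" "((\<lambda>s. \<bar>mean (E s 0)\<bar>) \<longlongrightarrow> 0) Fl" "((\<lambda>s. L2_norm (E s n)) \<longlongrightarrow> 0) Fl"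
  shows "((\<lambda>s. sobolev_norm n (E s 0)) \<longlongrightarrow> 0) Fl"
proof (rule Lim_null_comparison)
  have "((\<lambda>s. (real n + 1) * (\<bar>mean (E s 0)\<bar> + L2_norm (E s n))) \<longlongrightarrow> (real n + 1) * (0 + 0)) Fl"
    by (intro tendsto_intros assms)
  then show "((\<lambda>s. (real n + 1) * (\<bar>mean (E s 0)\<bar> + L2_norm (E s n))) \<longlongrightarrow> 0) Fl" by simp
  have "norm (sobolev_norm n (E s 0)) \<le> (real n + 1) * (\<bar>mean (E s 0)\<bar> + L2_norm (E s n))" for s
  proof -
    have "E s 0 \<in> L2" using assms(1)[of s] by (simp add: deriv_chain_def)
    moreover have "0 \<le> sobolev_norm n (E s 0)" by (simp add: sobolev_norm_def sum_nonneg)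
    ultimately show ?thesis using sobolev_norm_le[OF assms(1)[of s]] by simp
  qed
  then show "\<forall>\<^sub>F s in Fl. norm (sobolev_norm n (E s 0)) \<le> (real n + 1) * (\<bar>mean (E s 0)\<bar> + L2_norm (E s n))"
    by (rule always_eventually[OF allI])
qed

lemma L2_curve_tendsto: "L2_curve f \<Longrightarrow> ((\<lambda>s. L2_norm (\<lambda>z. f s z - f t z)) \<longlongrightarrow> 0) (at t within S)"
  unfolding L2_curve_def by (meson subset_UNIV tendsto_within_subset)

lemma mean_diff: "f \<in> L2 \<Longrightarrow> g \<in> L2 \<Longrightarrow> mean (\<lambda>x. f x - g x) = mean f - mean g"
  using L2_integrable[of f] L2_integrable[of g] by (simp add: mean_circ)

lemma sobolev_continuous_onI:
  assumes E: "\<And>t. deriv_chain n (E t)"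
    and m: "\<And>t. ((\<lambda>s. \<bar>mean (E s 0) - mean (E t 0)\<bar>) \<longlongrightarrow> 0) (at t within S)"
    and top: "L2_curve (\<lambda>t. E t n)"
  shows "sobolev_continuous_on n S (\<lambda>t. E t 0)"
  unfolding sobolev_continuous_on_def
proof (intro ballI conjI)
  fix t
  have L: "E s 0 \<in> L2" for s using E[of s] by (simp add: deriv_chain_def)
  show "E t 0 \<in> sobolev n" by (rule deriv_chain_sobolev[OF E])
  show "((\<lambda>s. sobolev_norm n (\<lambda>x. E s 0 x - E t 0 x)) \<longlongrightarrow> 0) (at t within S)"
    by (rule sobolev_tendsto_0[where E = "\<lambda>s j x. E s j x - E t j x"])
      (use m[of t] L2_curve_tendsto[OF top] in \<open>auto intro: deriv_chain_diff E simp: mean_diff[OF L L]\<close>)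
qed

text \<open>
  The amplitude is kept constant for negative times. The flow then exists on the whole time axis with a bounded amplitude, and
  one-sided derivatives in time appear only for \<open>a\<close>.
\<close>

locale muHS_eulerian = muHS_flow +
  fixes m lam :: real
  assumes a_eq: "a t = m * exp (- lam * max 0 t)"
begin

lemma a_DERIV: assumes "0 \<le> t" shows "(a has_real_derivative - lam * a t) (at t within {0..})"
proof (rule has_field_derivative_transform_within[where d = 1 and f = "\<lambda>t. m * exp (- lam * t)"])
  show "((\<lambda>t. m * exp (- lam * t)) has_real_derivative - lam * a t) (at t within {0..})"
    using assms by (auto intro!: derivative_eq_intros simp: a_eq)
qed (use assms in \<open>auto simp: a_eq\<close>)

definition u :: "real \<Rightarrow> real \<Rightarrow> real" where "u t z = a t * w t z"
definition u1 :: "real \<Rightarrow> real \<Rightarrow> real" where "u1 t z = a t * w1 t z"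
definition u2 :: "real \<Rightarrow> real \<Rightarrow> real" where "u2 t z = a t * (1 - K t z)"
definition u3 :: "real \<Rightarrow> real \<Rightarrow> real" where "u3 t z = - a t * K1 t z"

lemma u_joint: "jointly_continuous u" "jointly_continuous u1" "jointly_continuous u2"
  unfolding jointly_continuous_def u_def u1_def u2_def
  by (intro continuous_intros continuous_on_compose2[OF a_continuous] jointly_continuous_compose[OF Euler_joint(1)]
      jointly_continuous_compose[OF Euler_joint(2)] jointly_continuous_compose[OF Euler_joint(3)]; auto)+

lemma u_continuous: "continuous_on S (u t)" "continuous_on S (u1 t)" "continuous_on S (u2 t)"
  by (rule jointly_continuous_section(1)[OF u_joint(1)] jointly_continuous_section(1)[OF u_joint(2)]
      jointly_continuous_section(1)[OF u_joint(3)])+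

lemma u_periodic: "periodic (u t)" "periodic (u1 t)" "periodic (u2 t)"
  using Euler_periodic[of t] by (auto simp: periodic_def u_def u1_def u2_def)

lemma u_DERIV: "(u t has_real_derivative u1 t z) (at z)" "(u1 t has_real_derivative u2 t z) (at z)"
  unfolding u_def[abs_def] u1_def[abs_def] u2_def
  by (auto intro!: derivative_eq_intros w_DERIV w1_DERIV)

lemma u_L2: "u t \<in> L2" "u1 t \<in> L2" "u2 t \<in> L2"
  by (intro L2_continuous u_continuous u_periodic)+

lemma K_L2: "K t \<in> L2" "K1 t \<in> L2"
  using L2_continuous[OF Euler_periodic(3) Euler_continuous(3)] K1_curve by (auto simp: L2_curve_def)

lemma u3_L2: "u3 t \<in> L2"
  using L2_cmult[OF K_L2(2)[of t], of "- a t"] by (simp add: u3_def[abs_def])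

lemma u2_weak_deriv: "has_weak_deriv (u2 t) (u3 t)"
  using weak_deriv_lincomb[OF weak_deriv_const[of 1] K_weak_deriv[of t] L2_const L2_const K_L2, of "a t" "- a t"]
  by (simp add: u2_def[abs_def] u3_def[abs_def] algebra_simps)

definition u_derivs :: "real \<Rightarrow> nat \<Rightarrow> real \<Rightarrow> real" where
  "u_derivs t j = (if j = 0 then u t else if j = 1 then u1 t else if j = 2 then u2 t else u3 t)"

lemma u_derivs_chain: "deriv_chain 3 (u_derivs t)"
proof -
  have "has_weak_deriv (u_derivs t j) (u_derivs t (Suc j))" if "j < 3" for j
    using that weak_deriv_C1[OF u_periodic(1) u_DERIV(1) u_continuous(2)]
      weak_deriv_C1[OF u_periodic(2) u_DERIV(2) u_continuous(3)] u2_weak_deriv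
    by (auto simp: less_3_cases u_derivs_def)
  then show ?thesis by (simp add: deriv_chain_def u_derivs_def u_L2 u3_L2)
qed

definition source :: "real \<Rightarrow> real \<Rightarrow> real" where "source t z = 2 * a t * u t z + 1/2 * (u1 t z)\<^sup>2"

lemma source_periodic: "periodic (source t)" and source_continuous: "continuous_on UNIV (source t)"
  using u_periodic[of t] unfolding source_def[abs_def] by (auto simp: periodic_def intro!: continuous_intros u_continuous)

text \<open>
  The nonlocal term of the equation, in the form given by \<open>wderiv_A_inv\<close>.
\<close>

definition Phi :: "real \<Rightarrow> real \<Rightarrow> real" where
  "Phi t = (SOME \<Phi>. periodic \<Phi> \<and> (\<forall>x. (\<Phi> has_real_derivative source t x - mean (source t)) (at x)) \<and> mean \<Phi> = 0)"

lemma Phi: "periodic (Phi t)" "(Phi t has_real_derivative source t x - mean (source t)) (at x)" "mean (Phi t) = 0"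
proof -
  have "periodic (\<lambda>x. source t x - mean (source t))" using source_periodic[of t] by (simp add: periodic_def)
  moreover have "continuous_on UNIV (\<lambda>x. source t x - mean (source t))" by (intro continuous_intros source_continuous)
  moreover have "integral\<^sup>L circ (\<lambda>x. source t x - mean (source t)) = 0"
    using integrable_circ_continuous[OF source_continuous] by (simp add: mean_circ)
  ultimately obtain \<Phi> where "\<And>x. (\<Phi> has_real_derivative source t x - mean (source t)) (at x)" "periodic \<Phi>" "mean \<Phi> = 0"
    using ex_periodic_primitive_mean[of "\<lambda>x. source t x - mean (source t)" 0] by metis
  then have "\<exists>\<Phi>. periodic \<Phi> \<and> (\<forall>x. (\<Phi> has_real_derivative source t x - mean (source t)) (at x)) \<and> mean \<Phi> = 0" by blast
  from someI_ex[OF this] show "periodic (Phi t)" "(Phi t has_real_derivative source t x - mean (source t)) (at x)" "mean (Phi t) = 0"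
    by (auto simp: Phi_def[symmetric])
qed

lemma Phi_continuous: "continuous_on UNIV (Phi t)"
  by (rule DERIV_continuous_UNIV[OF Phi(2)])

definition ut :: "real \<Rightarrow> real \<Rightarrow> real" where "ut t z = - u t z * u1 t z + Phi t z - lam * u t z"
definition ut1 :: "real \<Rightarrow> real \<Rightarrow> real" where
  "ut1 t z = - (u1 t z)\<^sup>2 - u t z * u2 t z + (source t z - mean (source t)) - lam * u1 t z"
text \<open>
  The second space derivative of \<open>ut\<close>, written in terms of \<open>w\<close> and \<open>K\<close>. It equals \<open>lam * y + 2 * u_x * y + u * y_x - lam * mean u\<close>
  for \<open>y = a * K\<close>, and so is what the equation for \<open>y\<close> predicts for the time derivative of \<open>u_xx = mean u - y\<close>.
\<close>

definition ut2 :: "real \<Rightarrow> real \<Rightarrow> real" where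
  "ut2 t z = (a t)\<^sup>2 * (2 * w1 t z * K t z + w t z * K1 t z) - lam * a t * (1 - K t z)"

lemma ut_props: "periodic (ut t)" "(ut t has_real_derivative ut1 t z) (at z)" "continuous_on UNIV (ut1 t)" "periodic (ut1 t)"
proof -
  show p: "periodic (ut t)" using u_periodic[of t] Phi(1)[of t] by (simp add: periodic_def ut_def)
  show d: "(ut t has_real_derivative ut1 t z) (at z)" for z
    unfolding ut_def[abs_def] ut1_def
    by (rule derivative_eq_intros u_DERIV Phi(2) refl)+ (simp add: power2_eq_square)
  show "continuous_on UNIV (ut1 t)" unfolding ut1_def[abs_def]
    by (intro continuous_intros u_continuous source_continuous)
  show "periodic (ut1 t)" by (rule periodic_deriv[OF p d])
qed

lemma ut1_weak_deriv: "has_weak_deriv (ut1 t) (ut2 t)"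
proof -
  define G where "G = (\<lambda>z. - (1/2) * (u1 t z)\<^sup>2 + 2 * a t * u t z - mean (source t) - lam * u1 t z)"
  define G' where "G' = (\<lambda>z. - u1 t z * u2 t z + 2 * a t * u1 t z - lam * u2 t z)"
  have G: "periodic G" "\<And>z. (G has_real_derivative G' z) (at z)" "continuous_on UNIV G'"
    using u_periodic[of t] unfolding G_def G'_def
    by (auto simp: periodic_def intro!: derivative_eq_intros u_DERIV continuous_intros u_continuous)
  have GL: "G \<in> L2" "G' \<in> L2"
    using G periodic_deriv[OF G(1,2)] by (auto intro!: L2_continuous intro: DERIV_continuous_UNIV)
  have uu: "has_weak_deriv (\<lambda>z. u t z * u2 t z) (\<lambda>z. u1 t z * u2 t z + u t z * u3 t z)"
    by (rule weak_deriv_mult_C1[OF u_L2(3) u3_L2 u2_weak_deriv u_periodic(1) u_DERIV(1) u_continuous(2)])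
  have uuL: "(\<lambda>z. u t z * u2 t z) \<in> L2" "(\<lambda>z. u1 t z * u2 t z + u t z * u3 t z) \<in> L2"
    by (intro L2_add L2_continuous_mult u_periodic u_continuous u_L2 u3_L2)+
  have "has_weak_deriv (\<lambda>z. G z - u t z * u2 t z) (\<lambda>z. G' z - (u1 t z * u2 t z + u t z * u3 t z))"
    by (rule weak_deriv_diff[OF weak_deriv_C1[OF G] uu GL uuL])
  moreover have "(\<lambda>z. G z - u t z * u2 t z) = ut1 t"
    by (auto simp: G_def ut1_def source_def)
  moreover have "(\<lambda>z. G' z - (u1 t z * u2 t z + u t z * u3 t z)) = ut2 t"
    by (auto simp: G'_def ut2_def u_def u1_def u2_def u3_def power2_eq_square algebra_simps)
  ultimately show ?thesis by simp
qed

lemma ut2_curve: "L2_curve ut2"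
proof -
  have j: "jointly_continuous (\<lambda>t z. (a t)\<^sup>2 * w t z)"
    "jointly_continuous (\<lambda>t z. 2 * (a t)\<^sup>2 * w1 t z * K t z - lam * a t * (1 - K t z))"
    unfolding jointly_continuous_def
    by (intro continuous_intros continuous_on_compose2[OF a_continuous] jointly_continuous_compose[OF Euler_joint(1)]
      jointly_continuous_compose[OF Euler_joint(2)] jointly_continuous_compose[OF Euler_joint(3)]; auto)+
  have "L2_curve (\<lambda>t z. (2 * (a t)\<^sup>2 * w1 t z * K t z - lam * a t * (1 - K t z)) + (a t)\<^sup>2 * w t z * K1 t z)"
    by (rule L2_curve_add[OF L2_curve_jointly_continuous[OF j(2)] L2_curve_mult[OF j(1) _ K1_curve]])
      (use Euler_periodic in \<open>auto simp: periodic_def\<close>)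
  then show ?thesis by (simp add: ut2_def[abs_def] algebra_simps)
qed

lemma u3_curve: "L2_curve u3"
proof -
  have "jointly_continuous (\<lambda>t z. - a t)"
    unfolding jointly_continuous_def by (intro continuous_intros continuous_on_compose2[OF a_continuous]) auto
  from L2_curve_mult[OF this _ K1_curve] show ?thesis by (simp add: u3_def[abs_def] periodic_def)
qed

definition ut_derivs :: "real \<Rightarrow> nat \<Rightarrow> real \<Rightarrow> real" where
  "ut_derivs t j = (if j = 0 then ut t else if j = 1 then ut1 t else ut2 t)"

lemma ut_L2: "ut t \<in> L2" "ut1 t \<in> L2" "ut2 t \<in> L2"
  using ut2_curve L2_continuous[OF ut_props(1) DERIV_continuous_UNIV[OF ut_props(2)]] L2_continuous[OF ut_props(4,3)]
  by (auto simp: L2_curve_def)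

lemma ut_derivs_chain: "deriv_chain 2 (ut_derivs t)"
proof -
  have "has_weak_deriv (ut_derivs t j) (ut_derivs t (Suc j))" if "j < 2" for j
    using that weak_deriv_C1[OF ut_props(1-3)] ut1_weak_deriv by (auto simp: less_2_cases_iff ut_derivs_def)
  then show ?thesis by (simp add: deriv_chain_def ut_derivs_def ut_L2)
qed

lemma u_mean: "mean (u t) = a t"
  using w_mean[of t] integral_circ_eq_integral[OF Euler_continuous(1)[of UNIV t]]
  by (simp add: u_def[abs_def] mean_circ)

lemma ut_mean: "mean (ut t) = - lam * a t"
proof -
  have "integral\<^sup>L circ (\<lambda>z. u t z * u1 t z) = 0"
  proof -
    have c: "continuous_on UNIV (\<lambda>z. u t z * u1 t z)" by (intro continuous_intros u_continuous)
    have d: "((\<lambda>z. 1/2 * (u t z)\<^sup>2) has_real_derivative u t z * u1 t z) (at z)" for z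
      by (rule derivative_eq_intros u_DERIV refl)+ simp
    have "u t 1 = u t 0" using u_periodic(1)[of t, unfolded periodic_def, rule_format, of 0] by simp
    then show ?thesis using circ_FTC[OF c d] by simp
  qed
  moreover have "integrable circ (\<lambda>z. u t z * u1 t z)" "integrable circ (u t)" "integrable circ (Phi t)"
    by (intro integrable_circ_continuous continuous_intros u_continuous Phi_continuous)+
  ultimately show ?thesis using Phi(3)[of t] u_mean[of t] by (simp add: ut_def[abs_def] mean_circ)
qed

text \<open>
  The derivative given by \<open>K_evolution\<close> contains \<open>\<phi>'\<close>; integrating by parts against \<open>w * \<phi>\<close> moves it to \<open>K\<close>, where it produces
  \<open>K1\<close>.
\<close>

lemma tested_u2_DERIV:
  assumes \<phi>: "smooth_periodic \<phi>" and t: "0 < t"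
  shows "((\<lambda>t. \<integral>z. u2 t z * \<phi> z \<partial>circ) has_real_derivative (\<integral>z. ut2 t z * \<phi> z \<partial>circ)) (at t)"
proof -
  note \<phi>D = smooth_periodicD[OF \<phi>] and \<phi>'c = smooth_periodicD(3)[OF smooth_periodic_deriv[OF \<phi>]]
  note \<phi>L = smooth_periodic_L2[OF \<phi>]
  define I where "I = (\<integral>z. \<phi> z \<partial>circ)"
  have Kc: "continuous_on UNIV (\<lambda>z. K t z * \<phi> z)" for t by (intro continuous_intros Euler_continuous \<phi>D)
  have eq: "(\<integral>z. u2 t z * \<phi> z \<partial>circ) = a t * (I - integral {0..1} (\<lambda>z. K t z * \<phi> z))" for t
  proof -
    have "(\<integral>z. u2 t z * \<phi> z \<partial>circ) = (\<integral>z. a t * (\<phi> z - K t z * \<phi> z) \<partial>circ)"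
      by (simp add: u2_def algebra_simps)
    also have "\<dots> = a t * (I - (\<integral>z. K t z * \<phi> z \<partial>circ))"
      using L2_integrable[OF \<phi>L] integrable_circ_continuous[OF Kc[of t]] by (simp add: I_def)
    finally show ?thesis by (simp add: integral_circ_eq_integral[OF Kc])
  qed
  have "at t within {0..} = at t" using t by (intro at_within_interior) auto
  then have da: "(a has_real_derivative - lam * a t) (at t)" using a_DERIV[of t] t by simp
  define J where "J = integral {0..1} (\<lambda>z. K t z * (w t z * deriv \<phi> z - w1 t z * \<phi> z))"
  have "((\<lambda>t. a t * (I - integral {0..1} (\<lambda>z. K t z * \<phi> z))) has_real_derivative
     - lam * a t * (I - integral {0..1} (\<lambda>z. K t z * \<phi> z)) - (a t)\<^sup>2 * J) (at t)"
    unfolding J_def by (rule derivative_eq_intros da K_evolution[OF \<phi>D(1,2) \<phi>'c] refl)+ (simp add: power2_eq_square algebra_simps)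
  moreover have "(\<integral>z. ut2 t z * \<phi> z \<partial>circ) = - lam * a t * (I - integral {0..1} (\<lambda>z. K t z * \<phi> z)) - (a t)\<^sup>2 * J"
  proof -
    define b where "b = (\<lambda>z. w t z * \<phi> z)"
    define b' where "b' = (\<lambda>z. w1 t z * \<phi> z + w t z * deriv \<phi> z)"
    have b: "periodic b" "\<And>z. (b has_real_derivative b' z) (at z)" "continuous_on UNIV b'"
      using Euler_periodic(1)[of t] \<phi>D(1) unfolding b_def b'_def
      by (auto simp: periodic_def intro!: derivative_eq_intros w_DERIV \<phi>D(2) continuous_intros Euler_continuous \<phi>D \<phi>'c)
    have ibp: "(\<integral>z. b' z * K t z \<partial>circ) = - (\<integral>z. b z * K1 t z \<partial>circ)"
      by (rule weak_deriv_test_C1[OF K_L2 K_weak_deriv b])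
    have bc: "continuous_on UNIV b" by (rule DERIV_continuous_UNIV[OF b(2)])
    have iK1: "integrable circ (\<lambda>z. b z * K1 t z)"
      by (rule L2_mult_integrable[OF L2_continuous[OF b(1) bc] K_L2(2)])
    have ib': "integrable circ (\<lambda>z. b' z * K t z)" by (intro integrable_circ_continuous continuous_intros b Euler_continuous)
    have iw: "integrable circ (\<lambda>z. 2 * (w1 t z * (K t z * \<phi> z)))"
      by (intro integrable_circ_continuous continuous_intros Euler_continuous \<phi>D)
    have JC: "continuous_on UNIV (\<lambda>z. K t z * (w t z * deriv \<phi> z - w1 t z * \<phi> z))"
      by (intro continuous_intros Euler_continuous \<phi>D \<phi>'c)
    have "(\<integral>z. ut2 t z * \<phi> z \<partial>circ) =
       (\<integral>z. (a t)\<^sup>2 * (2 * (w1 t z * (K t z * \<phi> z)) + b z * K1 t z) - lam * a t * (\<phi> z - K t z * \<phi> z) \<partial>circ)"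
      by (simp add: ut2_def b_def algebra_simps)
    also have "\<dots> = (a t)\<^sup>2 * ((\<integral>z. 2 * (w1 t z * (K t z * \<phi> z)) \<partial>circ) + (\<integral>z. b z * K1 t z \<partial>circ))
        - lam * a t * (I - (\<integral>z. K t z * \<phi> z \<partial>circ))"
      unfolding I_def
      using iK1 iw L2_integrable[OF \<phi>L] integrable_circ_continuous[OF Kc[of t]]
      by (simp only: Bochner_Integration.integral_diff Bochner_Integration.integral_add integral_mult_right_zero
          Bochner_Integration.integrable_diff Bochner_Integration.integrable_add integrable_mult_right)
    also have "(\<integral>z. b z * K1 t z \<partial>circ) = - (\<integral>z. b' z * K t z \<partial>circ)" using ibp by simp
    also have "(\<integral>z. 2 * (w1 t z * (K t z * \<phi> z)) \<partial>circ) + - (\<integral>z. b' z * K t z \<partial>circ) =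
        (\<integral>z. - (K t z * (w t z * deriv \<phi> z - w1 t z * \<phi> z)) \<partial>circ)"
    proof -
      have "(\<integral>z. 2 * (w1 t z * (K t z * \<phi> z)) \<partial>circ) - (\<integral>z. b' z * K t z \<partial>circ) =
          (\<integral>z. 2 * (w1 t z * (K t z * \<phi> z)) - b' z * K t z \<partial>circ)"
        by (rule Bochner_Integration.integral_diff[OF iw ib', symmetric])
      also have "\<dots> = (\<integral>z. - (K t z * (w t z * deriv \<phi> z - w1 t z * \<phi> z)) \<partial>circ)"
        by (intro Bochner_Integration.integral_cong) (auto simp: b'_def algebra_simps)
      finally show ?thesis by simp
    qed
    also have "\<dots> = - J" unfolding J_def by (simp add: integral_circ_eq_integral[OF JC])
    finally show ?thesis by (simp add: integral_circ_eq_integral[OF Kc])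
  qed
  ultimately show ?thesis by (simp only: eq)
qed

lemma tested_u2_continuous:
  assumes \<phi>: "smooth_periodic \<phi>"
  shows "continuous_on S (\<lambda>t. \<integral>z. u2 t z * \<phi> z \<partial>circ)"
proof -
  have "continuous_on UNIV (\<lambda>t. integral {0..1} (\<lambda>z. u2 t z * \<phi> z))"
    by (intro continuous_on_parametric_integral continuous_intros jointly_continuous_compose[OF u_joint(3)]
        continuous_on_compose2[OF smooth_periodicD(3)[OF \<phi>]]) auto
  moreover have "(\<integral>z. u2 t z * \<phi> z \<partial>circ) = integral {0..1} (\<lambda>z. u2 t z * \<phi> z)" for t
    by (intro integral_circ_eq_integral continuous_intros u_continuous smooth_periodicD(3)[OF \<phi>])
  ultimately have "continuous_on UNIV (\<lambda>t. \<integral>z. u2 t z * \<phi> z \<partial>circ)" by simp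
  then show ?thesis by (rule continuous_on_subset) simp
qed

text \<open>
  By duality it suffices to test the difference quotient against a smooth function. The mean value theorem in
  time turns the tested quotient into \<open>ut2\<close> tested at an intermediate time, which is close to \<open>ut2 t\<close> in \<open>L2\<close>,
  uniformly in the test function.
\<close>

lemma u2_difference_quotient:
  assumes t: "0 \<le> t"
  shows "((\<lambda>s. L2_norm (\<lambda>z. (u2 s z - u2 t z) / (s - t) - ut2 t z)) \<longlongrightarrow> 0) (at t within {0..})"
proof (rule tendstoI)
  fix e :: real assume e: "0 < e"
  have "((\<lambda>r. L2_norm (\<lambda>z. ut2 r z - ut2 t z)) \<longlongrightarrow> 0) (at t)" using ut2_curve by (simp add: L2_curve_def)
  then have "\<forall>\<^sub>F r in at t. L2_norm (\<lambda>z. ut2 r z - ut2 t z) < e / 2" using e by (intro order_tendstoD(2)) auto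
  then obtain d where d: "0 < d" "\<And>r. r \<noteq> t \<Longrightarrow> dist r t < d \<Longrightarrow> L2_norm (\<lambda>z. ut2 r z - ut2 t z) < e / 2"
    unfolding eventually_at by blast
  have main: "L2_norm (\<lambda>z. (u2 s z - u2 t z) / (s - t) - ut2 t z) \<le> e / 2" if s: "0 \<le> s" "s \<noteq> t" "dist s t < d" for s
  proof -
    have qL: "(\<lambda>z. (u2 s z - u2 t z) / (s - t)) \<in> L2"
      using L2_cmult[OF L2_diff[OF u_L2(3)[of s] u_L2(3)[of t]], of "1 / (s - t)"] by simp
    show ?thesis
    proof (rule L2_norm_le_dual[OF L2_diff[OF qL ut_L2(3)]])
      fix \<phi> assume \<phi>: "smooth_periodic \<phi>"
      note \<phi>L = smooth_periodic_L2[OF \<phi>]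
      define \<psi> where "\<psi> = (\<lambda>t. \<integral>z. u2 t z * \<phi> z \<partial>circ)"
      have "\<exists>r. r \<noteq> t \<and> dist r t < d \<and> \<psi> s - \<psi> t = (s - t) * (\<integral>z. ut2 r z * \<phi> z \<partial>circ)"
      proof -
        define l h where "l = min s t" and "h = max s t"
        have lh: "l < h" "0 \<le> l" using s t by (auto simp: l_def h_def)
        have "\<exists>r. l < r \<and> r < h \<and> \<psi> h - \<psi> l = (h - l) * (\<integral>z. ut2 r z * \<phi> z \<partial>circ)"
          using MVT2[OF lh(1), of \<psi> "\<lambda>r. \<integral>z. ut2 r z * \<phi> z \<partial>circ"] MVT[OF lh(1) tested_u2_continuous[OF \<phi>]]
        proof -
          obtain y r where r: "l < r" "r < h" "(\<psi> has_real_derivative y) (at r)" "\<psi> h - \<psi> l = (h - l) * y"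
          proof (rule MVT[OF lh(1), of \<psi>, THEN exE])
            show "continuous_on {l..h} \<psi>" unfolding \<psi>_def by (rule tested_u2_continuous[OF \<phi>])
            show "\<psi> differentiable (at r)" if "l < r" "r < h" for r
              using tested_u2_DERIV[OF \<phi>, of r] that lh unfolding \<psi>_def real_differentiable_def by (meson le_less_trans)
          qed blast
          have "y = (\<integral>z. ut2 r z * \<phi> z \<partial>circ)"
            using DERIV_unique[OF r(3)] tested_u2_DERIV[OF \<phi>, of r] r(1) lh(2) unfolding \<psi>_def by simp
          then show ?thesis using r by blast
        qed
        then obtain r where r: "l < r" "r < h" "\<psi> h - \<psi> l = (h - l) * (\<integral>z. ut2 r z * \<phi> z \<partial>circ)" by blast
        have "\<psi> s - \<psi> t = (s - t) * (\<integral>z. ut2 r z * \<phi> z \<partial>circ)"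
        proof (cases "s < t")
          case True
          then have "\<psi> t - \<psi> s = (t - s) * (\<integral>z. ut2 r z * \<phi> z \<partial>circ)" using r(3) by (simp add: l_def h_def)
          then show ?thesis by (simp add: left_diff_distrib)
        qed (use r(3) in \<open>simp add: l_def h_def\<close>)
        moreover have "r \<noteq> t \<and> dist r t < d"
          using r(1,2) s(3) by (auto simp: l_def h_def dist_real_def min_def max_def split: if_splits)
        ultimately show ?thesis by blast
      qed
      then obtain r where r: "r \<noteq> t" "dist r t < d" "\<psi> s - \<psi> t = (s - t) * (\<integral>z. ut2 r z * \<phi> z \<partial>circ)" by blast
      note int = L2_mult_integrable[OF u_L2(3)[of s] \<phi>L] L2_mult_integrable[OF u_L2(3)[of t] \<phi>L]
        L2_mult_integrable[OF ut_L2(3)[of r] \<phi>L] L2_mult_integrable[OF ut_L2(3)[of t] \<phi>L]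
      have "(\<integral>z. ((u2 s z - u2 t z) / (s - t) - ut2 t z) * \<phi> z \<partial>circ) =
         (\<integral>z. 1 / (s - t) * (u2 s z * \<phi> z - u2 t z * \<phi> z) - ut2 t z * \<phi> z \<partial>circ)"
        by (intro Bochner_Integration.integral_cong) (auto simp: left_diff_distrib diff_divide_distrib)
      also have "\<dots> = 1 / (s - t) * (\<psi> s - \<psi> t) - (\<integral>z. ut2 t z * \<phi> z \<partial>circ)"
        unfolding \<psi>_def using int
        by (simp only: Bochner_Integration.integral_diff integral_mult_right_zero Bochner_Integration.integrable_diff integrable_mult_right)
      also have "\<dots> = (\<integral>z. ut2 r z * \<phi> z \<partial>circ) - (\<integral>z. ut2 t z * \<phi> z \<partial>circ)" using r(3) s(2) by simp
      also have "\<dots> = (\<integral>z. (ut2 r z - ut2 t z) * \<phi> z \<partial>circ)" using int by (simp add: left_diff_distrib)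
      finally have "\<bar>\<integral>z. ((u2 s z - u2 t z) / (s - t) - ut2 t z) * \<phi> z \<partial>circ\<bar> \<le> L2_norm (\<lambda>z. ut2 r z - ut2 t z) * L2_norm \<phi>"
        using L2_Cauchy_Schwarz[OF L2_diff[OF ut_L2(3)[of r] ut_L2(3)[of t]] \<phi>L] by simp
      also have "\<dots> \<le> e / 2 * L2_norm \<phi>"
        using d(2)[OF r(1,2)] by (intro mult_right_mono) auto
      finally show "\<bar>\<integral>z. ((u2 s z - u2 t z) / (s - t) - ut2 t z) * \<phi> z \<partial>circ\<bar> \<le> e / 2 * L2_norm \<phi>" .
    qed (use e in simp)
  qed
  show "\<forall>\<^sub>F s in at t within {0..}. dist (L2_norm (\<lambda>z. (u2 s z - u2 t z) / (s - t) - ut2 t z)) 0 < e"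
    unfolding eventually_at
  proof (intro exI[of _ d] conjI ballI impI d(1))
    fix s assume "s \<in> {0..}" "s \<noteq> t \<and> dist s t < d"
    then have "L2_norm (\<lambda>z. (u2 s z - u2 t z) / (s - t) - ut2 t z) \<le> e / 2" by (intro main) auto
    then show "dist (L2_norm (\<lambda>z. (u2 s z - u2 t z) / (s - t) - ut2 t z)) 0 < e" using e by (simp add: dist_real_def)
  qed
qed

lemma a_tendsto: "((\<lambda>s. \<bar>a s - a t\<bar>) \<longlongrightarrow> 0) (at t within S)"
proof -
  have "(a \<longlongrightarrow> a t) (at t)" using a_continuous by (simp add: continuous_on_eq_continuous_at isCont_def)
  then have "(a \<longlongrightarrow> a t) (at t within S)" by (rule tendsto_within_subset) simp
  then have "((\<lambda>s. \<bar>a s - a t\<bar>) \<longlongrightarrow> \<bar>a t - a t\<bar>) (at t within S)" by (intro tendsto_intros)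
  then show ?thesis by simp
qed

lemma u_H3_continuous: "sobolev_continuous_on 3 S u"
  and u_H2_continuous: "sobolev_continuous_on 2 S u"
proof -
  have m: "((\<lambda>s. \<bar>mean (u_derivs s 0) - mean (u_derivs t 0)\<bar>) \<longlongrightarrow> 0) (at t within S)" for t
    using a_tendsto[of t S] by (simp add: u_derivs_def u_mean)
  have "L2_curve (\<lambda>t. u_derivs t 3)" using u3_curve by (simp add: u_derivs_def)
  from sobolev_continuous_onI[OF u_derivs_chain m this] show "sobolev_continuous_on 3 S u" by (simp add: u_derivs_def)
  have D2: "deriv_chain 2 (u_derivs t)" for t by (rule deriv_chain_mono[OF u_derivs_chain]) simp
  have "L2_curve (\<lambda>t. u_derivs t 2)"
    using L2_curve_jointly_continuous[OF u_joint(3) u_periodic(3)] by (simp add: u_derivs_def)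
  from sobolev_continuous_onI[OF D2 m this] show "sobolev_continuous_on 2 S u" by (simp add: u_derivs_def)
qed

lemma ut_H2_continuous: "sobolev_continuous_on 2 S ut"
proof -
  have "\<bar>mean (ut_derivs s 0) - mean (ut_derivs t 0)\<bar> = \<bar>lam\<bar> * \<bar>a s - a t\<bar>" for s t
    by (simp add: ut_derivs_def ut_mean abs_mult[symmetric] right_diff_distrib abs_minus_commute)
  then have m: "((\<lambda>s. \<bar>mean (ut_derivs s 0) - mean (ut_derivs t 0)\<bar>) \<longlongrightarrow> 0) (at t within S)" for t
    using tendsto_mult_right_zero[OF a_tendsto[of t S], of "\<bar>lam\<bar>"] by simp
  have "L2_curve (\<lambda>t. ut_derivs t 2)" using ut2_curve by (simp add: ut_derivs_def)
  from sobolev_continuous_onI[OF ut_derivs_chain m this] show ?thesis by (simp add: ut_derivs_def)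
qed

lemma u_H2_difference_quotient:
  assumes t: "0 \<le> t"
  shows "((\<lambda>s. sobolev_norm 2 (\<lambda>x. (u s x - u t x) / (s - t) - ut t x)) \<longlongrightarrow> 0) (at t within {0..})"
proof -
  define E where "E s j x = 1 / (s - t) * (u_derivs s j x - u_derivs t j x) + (- 1) * ut_derivs t j x" for s j x
  have "((\<lambda>s. sobolev_norm 2 (E s 0)) \<longlongrightarrow> 0) (at t within {0..})"
  proof (rule sobolev_tendsto_0)
    show "deriv_chain 2 (E s)" for s
      unfolding E_def[abs_def]
      by (rule deriv_chain_lincomb[OF deriv_chain_mono[OF deriv_chain_diff[OF u_derivs_chain u_derivs_chain]] ut_derivs_chain]) simp
    have "mean (E s 0) = (a s - a t) / (s - t) + lam * a t" for s
    proof -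
      have "(\<lambda>x. 1 / (s - t) * (u s x - u t x)) \<in> L2" by (rule L2_cmult[OF L2_diff[OF u_L2(1) u_L2(1)]])
      from mean_diff[OF this ut_L2(1)[of t]]
      have "mean (E s 0) = mean (\<lambda>x. 1 / (s - t) * (u s x - u t x)) - mean (ut t)" by (simp add: E_def[abs_def] u_derivs_def ut_derivs_def)
      also have "mean (\<lambda>x. 1 / (s - t) * (u s x - u t x)) = 1 / (s - t) * mean (\<lambda>x. u s x - u t x)"
        unfolding mean_circ by (rule integral_mult_right_zero)
      finally show ?thesis by (simp add: mean_diff[OF u_L2(1) u_L2(1)] u_mean ut_mean)
    qed
    moreover have "((\<lambda>s. (a s - a t) / (s - t)) \<longlongrightarrow> - lam * a t) (at t within {0..})"
      using a_DERIV[OF t] by (simp add: has_field_derivative_iff)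
    then have "((\<lambda>s. \<bar>(a s - a t) / (s - t) + lam * a t\<bar>) \<longlongrightarrow> \<bar>- lam * a t + lam * a t\<bar>) (at t within {0..})"
      by (intro tendsto_intros)
    ultimately show "((\<lambda>s. \<bar>mean (E s 0)\<bar>) \<longlongrightarrow> 0) (at t within {0..})" by simp
    show "((\<lambda>s. L2_norm (E s 2)) \<longlongrightarrow> 0) (at t within {0..})"
      using u2_difference_quotient[OF t] by (simp add: E_def[abs_def] u_derivs_def ut_derivs_def)
  qed
  then show ?thesis by (simp add: E_def[abs_def] u_derivs_def ut_derivs_def)
qed

theorem global_solution:
  assumes init: "AE x in lebesgue. u 0 x = u0 x" and m: "mean u0 = m"
  shows "muHS_solution lam u0 \<infinity> u"
proof -
  have I: "{t. 0 \<le> t \<and> ereal t < \<infinity>} = {0..}" by auto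
  have C1: "sobolev_C1_on 2 {0..} u ut"
    unfolding sobolev_C1_on_def
    using u_H2_continuous ut_H2_continuous u_H2_difference_quotient by auto
  have eq: "AE x in lebesgue. ut t x + u t x * wderiv (u t) x =
      - wderiv (A_inv (\<lambda>z. 2 * mean u0 * exp (- lam * t) * u t z + 1/2 * (wderiv (u t) z)\<^sup>2)) x - lam * u t x"
    if t: "0 \<le> t" for t
  proof -
    have wd: "wderiv (u t) \<in> L2" "AE x in lebesgue. wderiv (u t) x = u1 t x"
      using wderiv_L2[OF u_L2(2) weak_deriv_C1[OF u_periodic(1) u_DERIV(1) u_continuous(2)]] by auto
    have "AE x in lebesgue. - wderiv (A_inv (\<lambda>z. 2 * mean u0 * exp (- lam * t) * u t z + 1/2 * (wderiv (u t) z)\<^sup>2)) x = Phi t x"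
    proof (rule wderiv_A_inv[OF _ _ _ source_periodic source_continuous Phi])
      show "periodic (\<lambda>z. 2 * mean u0 * exp (- lam * t) * u t z + 1/2 * (wderiv (u t) z)\<^sup>2)"
        using u_periodic(1)[of t] L2_periodic[OF wd(1)] by (simp add: periodic_def)
      show "(\<lambda>z. 2 * mean u0 * exp (- lam * t) * u t z + 1/2 * (wderiv (u t) z)\<^sup>2) \<in> borel_measurable lebesgue"
        using wd(1) u_L2(1)[of t] by measurable
      show "AE z in lebesgue. 2 * mean u0 * exp (- lam * t) * u t z + 1/2 * (wderiv (u t) z)\<^sup>2 = source t z"
        using wd(2) by eventually_elim (use t m in \<open>simp add: source_def a_eq\<close>)
    qed
    then show ?thesis using wd(2) by eventually_elim (simp add: ut_def)
  qed
  show ?thesis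
    unfolding muHS_solution_def Let_def I
    using u_H3_continuous init C1 eq by auto
qed

end

theorem corollary5p1:
  fixes lam :: real and u0 :: "real \<Rightarrow> real"
  assumes "lam > 0"
    and "u0 \<in> sobolev 3"
    and "L2_norm ((wderiv ^^ 3) u0) \<le> 2 * sqrt 3 * \<bar>mean u0\<bar>"
  shows "\<exists>u. muHS_maximal_solution lam u0 \<infinity> u"
proof -
  define m where "m = mean u0"
  obtain f0 f1 f2 where f: "periodic f0" "periodic f1" "periodic f2"
    "\<forall>x. (f0 has_real_derivative f1 x) (at x)" "\<forall>x. (f1 has_real_derivative f2 x) (at x)" "continuous_on UNIV f2"
    "AE x in lebesgue. u0 x = f0 x" "AE x in lebesgue. wderiv u0 x = f1 x"
    "has_weak_deriv f2 ((wderiv ^^ 3) u0)" "(wderiv ^^ 3) u0 \<in> L2"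
    "\<forall>x. \<bar>f1 x\<bar> \<le> L2_norm ((wderiv ^^ 3) u0) / sqrt 12" "\<forall>x. \<bar>f2 x\<bar> \<le> L2_norm ((wderiv ^^ 3) u0) / sqrt 12"
    by (rule sobolev3_classical[OF assms(2)])
  have f2m: "\<bar>f2 x\<bar> \<le> \<bar>m\<bar>" for x
  proof -
    have "sqrt 12 = sqrt (4 * 3)" by simp
    also have "\<dots> = 2 * sqrt 3" unfolding real_sqrt_mult by simp
    finally have s12: "sqrt 12 = 2 * sqrt 3" .
    have "L2_norm ((wderiv ^^ 3) u0) / sqrt 12 \<le> \<bar>m\<bar>"
      using assms(3) by (simp add: s12 m_def divide_le_eq mult.commute mult.left_commute)
    then show ?thesis using f(12) order_trans by blast
  qed
  \<comment> \<open>For \<open>m = 0\<close> the bound forces \<open>f2 = 0\<close>; then \<open>k = 1\<close>, as division by zero gives zero, and the solution is zero.\<close>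
  define k where "k = (\<lambda>x. 1 - f2 x / m)"
  obtain g where g: "g \<in> L2" "g \<in> borel_measurable borel" "AE x in lebesgue. (wderiv ^^ 3) u0 x = g x"
    by (rule Borel_representative[OF f(10)])
  define k1 where "k1 = (\<lambda>x. - (1 / m) * g x)"
  define a where "a = (\<lambda>t. m * exp (- lam * max 0 t))"
  have fc: "continuous_on UNIV f0" "continuous_on UNIV f1" using f(4,5) by (auto intro!: DERIV_continuous_UNIV)
  have fL: "f0 \<in> L2" "f1 \<in> L2" "f2 \<in> L2" using f fc by (auto intro!: L2_continuous)
  have f2eq: "m * (1 - k x) = f2 x" for x using f2m[of x] by (cases "m = 0") (auto simp: k_def)
  have kc: "continuous_on UNIV k" unfolding k_def using f(6)
    by (cases "m = 0") (auto intro!: continuous_intros)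
  have "circle_density k"
  proof
    show "periodic k" using f(3) by (simp add: periodic_def k_def)
    show "continuous_on UNIV k" by (rule kc)
    show "0 \<le> k x" for x
    proof (cases "m = 0")
      case False
      have "\<bar>f2 x / m\<bar> \<le> 1" using f2m[of x] False by (simp add: divide_le_eq)
      then show ?thesis unfolding k_def by linarith
    qed (simp add: k_def)
    have "integral\<^sup>L circ f2 = 0" using weak_deriv_mean[OF weak_deriv_C1[OF f(2) _ f(6)]] f(5) by simp
    then have "integral\<^sup>L circ k = 1" using L2_integrable[OF fL(3)] by (simp add: k_def)
    then show "integral {0..1} k = 1" by (simp add: integral_circ_eq_integral[OF kc])
  qed
  then interpret circle_density k .
  have ac: "continuous_on UNIV a" unfolding a_def by (intro continuous_intros)
  have ab: "\<bar>a t\<bar> \<le> \<bar>m\<bar>" for t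
    using assms(1) by (simp add: a_def abs_mult mult_left_le)
  obtain s where s: "jointly_continuous s" "\<And>t. periodic (s t)"
    "\<And>t x. ((\<lambda>t. s t x) has_real_derivative a t * drift (s t) x) (at t)"
    "\<And>x. s 0 x = 0" "\<And>t x. \<bar>s t x\<bar> \<le> 2 * \<bar>m\<bar> * \<bar>t\<bar>"
    using flow_exists[OF ac ab] by metis
  interpret muHS_eulerian k a "\<bar>m\<bar>" k1 s m lam
  proof
    show "k1 \<in> L2" unfolding k1_def by (rule L2_cmult[OF g(1)])
    show "k1 \<in> borel_measurable borel" unfolding k1_def using g(2) by measurable
    have "has_weak_deriv f2 g"
      by (rule weak_deriv_cong_AE[OF f(9) fL(3) f(10) fL(3) g(1)]) (use AE_lebesgue_imp_circ[OF g(3)] in auto)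
    from weak_deriv_lincomb[OF weak_deriv_const[of 1] this L2_const L2_const fL(3) g(1), of 1 "- (1 / m)"]
    show "has_weak_deriv k k1" by (simp add: k_def k1_def)
  qed (use s ac in \<open>auto simp: a_def\<close>)
  \<comment> \<open>Both functions have the mean \<open>m\<close> and the second derivative \<open>f2\<close>.\<close>
  have "u 0 x = f0 x" for x
  proof -
    have a0: "a 0 = m" by (simp add: a_def)
    have K0: "K 0 z = k z" for z by (simp add: K_def s(4) p_0)
    have d1: "((\<lambda>x. u1 0 x - f1 x) has_real_derivative 0) (at x)" for x
      using DERIV_diff[OF u_DERIV(2)[of 0 x] f(5)[rule_format, of x]] f2eq[of x] by (simp add: u2_def K0 a0)
    have d0: "((\<lambda>x. u 0 x - f0 x) has_real_derivative u1 0 x - f1 x) (at x)" for x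
      by (rule DERIV_diff[OF u_DERIV(1) f(4)[rule_format]])
    have p: "periodic (\<lambda>x. u 0 x - f0 x)" "periodic (\<lambda>x. u1 0 x - f1 x)"
      using u_periodic[of 0] f(1,2) by (auto simp: periodic_def)
    have c1: "continuous_on UNIV (\<lambda>x. u1 0 x - f1 x)" by (intro continuous_intros u_continuous fc)
    have "mean (\<lambda>x. u1 0 x - f1 x) = 0"
      using weak_deriv_mean[OF weak_deriv_C1[OF p(1) d0 c1]] by (simp add: mean_circ)
    then have "u1 0 x - f1 x = 0" for x
      using periodic_sup_mean[OF p(2) d1 continuous_on_const, of x] by simp
    then have d0': "((\<lambda>x. u 0 x - f0 x) has_real_derivative 0) (at x)" for x using d0[of x] by simp
    have "mean f0 = m" unfolding m_def
      using f(7) by (intro mean_cong_AE[OF fL(1) sobolev_L2[OF assms(2)]]) (auto elim: eventually_mono)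
    then have "mean (\<lambda>x. u 0 x - f0 x) = 0"
      by (simp add: mean_diff[OF u_L2(1) fL(1)] u_mean a0)
    then show ?thesis using periodic_sup_mean[OF p(1) d0' continuous_on_const, of x] by simp
  qed
  then have init: "AE x in lebesgue. u 0 x = u0 x" using f(7) by (auto elim: eventually_mono)
  have sol: "muHS_solution lam u0 \<infinity> u" by (rule global_solution[OF init]) (simp add: m_def)
  have "AE x in lebesgue. v t x = u t x"
    if "muHS_solution lam u0 T' v" "0 \<le> t" "ereal t < T'" for T' v t
    by (rule muHS_solution_unique[OF assms(1) sol that(1,2) _ that(3)]) simp
  then show ?thesis using sol by (auto simp: muHS_maximal_solution_def)
qed

end
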